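(* Let $n \in \mathbb{N}$ and let $C \in \mathbb{Q}[X_1, \ldots, X_n]$ be a cubic form. If $n \ge 2\gamma+3$, then $C$ vanishes on a rational projective line, i.e. there exist linearly independent $\mathbf{x}, \mathbf{y} \in \mathbb{Q}^n$ such that $C(s\mathbf{x} + t\mathbf{y}) = 0$ for all $s, t \in \mathbb{Q}$.
   Context: For an imaginary quadratic field extension $K \mid \mathbb{Q}$, let $\gamma_K$ denote the least integer $n$ with the property that every cubic form in at least $n$ variables with coefficients in $K$ has a non-trivial zero in $K^n$. Define $\gamma = \sup_K \gamma_K$, the supremum taken over all imaginary quadratic extensions $K \mid \mathbb{Q}$. (This is finite, since $\gamma_K \le 16$ for every number field $K$ by a theorem of Pleasants.) *)

theory Defs
  imports
    Complex_Main
    "HOL-Library.Extended_Nat"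
    "HOL-Library.Poly_Mapping"
    "Jordan_Normal_Form.Matrix"
begin

text \<open>
  A polynomial in the variables \<open>X\<^sub>0, X\<^sub>1, \<dots>\<close> is a finitely supported map from monomials to
  coefficients; a monomial is in turn a finitely supported map from variables to exponents.
\<close>

type_synonym 'a mpolynomial = "(nat \<Rightarrow>\<^sub>0 nat) \<Rightarrow>\<^sub>0 'a"

definition eval_poly :: "'a::comm_semiring_1 mpolynomial \<Rightarrow> 'a vec \<Rightarrow> 'a" where
  "eval_poly p x =
    (\<Sum>m\<in>Poly_Mapping.keys p.
       Poly_Mapping.lookup p m *
       (\<Prod>i\<in>Poly_Mapping.keys m. (x $ i) ^ Poly_Mapping.lookup m i))"

text \<open>The \<open>n\<close> variables are those with index below \<open>n\<close>; the zero polynomial counts as a form.\<close>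

definition cubic_form :: "nat \<Rightarrow> 'a::zero mpolynomial \<Rightarrow> bool" where
  "cubic_form n C \<longleftrightarrow>
    (\<forall>m\<in>Poly_Mapping.keys C.
       Poly_Mapping.keys m \<subseteq> {..<n} \<and>
       (\<Sum>i\<in>Poly_Mapping.keys m. Poly_Mapping.lookup m i) = 3)"

global_interpretation rat_complex: vector_space "\<lambda>(q::rat) (z::complex). of_rat q * z"
  by unfold_locales (simp_all add: algebra_simps of_rat_add of_rat_mult)

text \<open>
  Imaginary quadratic fields are taken as subfields of the complex numbers. Every quadratic
  extension of the rationals embeds there, and for a quadratic field (which is normal over the
  rationals) having no real embedding is the same as its image not being contained in \<open>\<real>\<close>.
  An infinite-dimensional space has \<open>dim\<close> equal to 0, so \<open>dim K = 2\<close> does say degree two.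
\<close>

definition imaginary_quadratic_field :: "complex set \<Rightarrow> bool" where
  "imaginary_quadratic_field K \<longleftrightarrow>
    0 \<in> K \<and> 1 \<in> K \<and>
    (\<forall>a\<in>K. \<forall>b\<in>K. a + b \<in> K \<and> a * b \<in> K) \<and>
    (\<forall>a\<in>K. - a \<in> K \<and> inverse a \<in> K) \<and>
    rat_complex.dim K = 2 \<and>
    \<not> K \<subseteq> \<real>"

text \<open>
  The least element and the supremum are formed in the extended naturals, where they exist
  without appealing to the finiteness theorem of Pleasants; in particular the infimum of a
  nonempty set is its least element.
\<close>

definition gamma_field :: "complex set \<Rightarrow> enat" where
  "gamma_field K =
    Inf {enat n | n.
      \<forall>m\<ge>n. \<forall>C. cubic_form m C \<and> range (Poly_Mapping.lookup C) \<subseteq> K \<longrightarrow>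
        (\<exists>x\<in>carrier_vec m. (\<forall>i<m. x $ i \<in> K) \<and> x \<noteq> 0\<^sub>v m \<and> eval_poly C x = 0)}"

definition gamma_sup :: enat where
  "gamma_sup = (SUP K\<in>{K. imaginary_quadratic_field K}. gamma_field K)"

end

theory Submission
  imports Defs "HOL-Number_Theory.Number_Theory"
begin

text \<open>
  If \<open>\<gamma>\<close> is infinite there is nothing to prove. Otherwise, write \<open>T\<close> for the symmetric trilinear form of \<open>C\<close>.
  A zero \<open>z\<close> of \<open>C\<close> over an imaginary quadratic field yields a rational zero \<open>x\<close>, the third point on the
  line through \<open>z\<close> and its conjugate. On a complement of \<open>x\<close> in the hyperplane \<open>T(x,x,\<cdot>) = 0\<close> the
  rational quadratic form \<open>q(v) = T(x,v,v)\<close> has at least \<open>2\<gamma>+1\<close> variables, and there is an imaginary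
  quadratic field \<open>K\<close> over which it vanishes on a \<open>K\<close>-space of dimension \<open>\<gamma>\<close>. On that space \<open>C\<close> has a
  zero \<open>z\<close>, so \<open>C\<close> vanishes on the line through \<open>x\<close> and \<open>z\<close> and on the conjugate line. The residual
  intersection of \<open>C\<close> with the plane spanned by the two lines is a rational line.

  To find \<open>K\<close>, diagonalise \<open>q\<close> and let \<open>S\<close> be the set of primes in its coefficients. It suffices that
  every Hilbert symbol \<open>(a,b)\<close> with \<open>a, b\<close> composed of \<open>-1\<close> and the primes in \<open>S\<close> is trivial over \<open>K\<close>.
  This holds for \<open>K = \<rat>(\<surd>-\<ell>)\<close> when \<open>\<ell> \<equiv> 3 (mod 8)\<close> is a prime such that no odd prime in \<open>S\<close> splits
  in \<open>K\<close>: by Legendre's theorem on ternary forms and quadratic reciprocity. Such an \<open>\<ell>\<close> exists by a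
  version of Dirichlet's theorem that only involves real characters.
\<close>

section \<open>Chebyshev and Mertens estimates\<close>

text \<open>Symbols of rational numbers become trivial over K for a local reason: where only one
  place of K, of local degree 2, lies above a rational place, the symbol of a and b over the
  completion equals the rational local symbol of a and the norm b^2. This covers all places that
  matter: the odd primes in S are inert by choice, 2 is inert because -q = 5 mod 8 for the prime q
  (the \<ell> above), q is ramified, and K is complex at infinity. The proof makes this explicit: in
  K the number q is minus a square, so a Legendre form may carry a coefficient q at no cost, and
  carrying it or not leaves enough freedom to meet the congruence conditions. A whole group of
  coefficients is treated, because splitting a hyperbolic plane off <a,b,c> leaves the new
  coefficient -abc. Each such step turns three variables into one, so 2k+1 variables give an
  isotropic space of dimension k; adding the dimensions lost to x and to the hyperplane gives
  2\<gamma>+3. Only Legendre symbols of q are prescribed, so all characters are real, and L(1) is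
  nonzero by an elementary argument with a nonnegative convolution.\<close>

lemma abel_bound:
  fixes g h :: "nat \<Rightarrow> real"
  assumes g: "\<And>x. \<bar>\<Sum>n<x. g n\<bar> \<le> B"
    and h: "\<And>n. a \<le> n \<Longrightarrow> n < b \<Longrightarrow> h (Suc n) \<le> h n" "\<And>n. a \<le> n \<Longrightarrow> n \<le> b \<Longrightarrow> 0 \<le> h n"
    and "a \<le> b"
  shows "\<bar>\<Sum>n=a..b. g n * h n\<bar> \<le> 2 * B * h a"
proof -
  define A where "A = (\<lambda>n. \<Sum>k=a..n. g k)"
  have A: "\<bar>A n\<bar> \<le> 2 * B" if "a \<le> n" for n
  proof -
    have "{..<Suc n} = {..<a} \<union> {a..n}" using that by auto
    moreover have "sum g ({..<a} \<union> {a..n}) = sum g {..<a} + sum g {a..n}"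
      by (rule sum.union_disjoint) auto
    ultimately have "(\<Sum>k<Suc n. g k) = (\<Sum>k<a. g k) + A n"
      by (simp only: A_def)
    then show ?thesis using g[of "Suc n"] g[of a] by linarith
  qed
  \<comment> \<open>Summation by parts: without the boundary term there remain the products of
    \<open>A n\<close> with the decrements of \<open>h\<close>, and the decrements
    telescope.\<close>
  have "\<bar>(\<Sum>n=a..b'. g n * h n) - A b' * h b'\<bar> \<le> 2 * B * (h a - h b')"
    if "a \<le> b'" "b' \<le> b" for b'
    using that
  proof (induction b' rule: dec_induct)
    case base
    then show ?case by (simp add: A_def)
  next
    case (step n)
    have 1: "A (Suc n) = A n + g (Suc n)" using step by (simp add: A_def)
    have "(\<Sum>k=a..Suc n. g k * h k) - A (Suc n) * h (Suc n) =
      ((\<Sum>k=a..n. g k * h k) - A n * h n) + A n * (h n - h (Suc n))"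
      using step by (simp add: 1 algebra_simps)
    moreover have "\<bar>A n * (h n - h (Suc n))\<bar> \<le> 2 * B * (h n - h (Suc n))"
      using A[of n] h(1)[of n] step by (simp add: abs_mult mult_right_mono)
    ultimately have "\<bar>(\<Sum>k=a..Suc n. g k * h k) - A (Suc n) * h (Suc n)\<bar>
        \<le> 2 * B * (h a - h n) + 2 * B * (h n - h (Suc n))" using step by linarith
    then show ?case by (simp add: algebra_simps)
  qed
  from this[of b] have 1: "\<bar>(\<Sum>n=a..b. g n * h n) - A b * h b\<bar> \<le> 2 * B * (h a - h b)"
    using \<open>a \<le> b\<close> by simp
  have "\<bar>A b * h b\<bar> \<le> 2 * B * h b"
    using A[of b] h(2)[of b] \<open>a \<le> b\<close> by (simp add: abs_mult mult_right_mono)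
  with 1 have "\<bar>\<Sum>n=a..b. g n * h n\<bar> \<le> 2 * B * (h a - h b) + 2 * B * h b" by linarith
  then show ?thesis by (simp add: algebra_simps)
qed

text \<open>Both sides run over the pairs (d, m) with d m <= N. Sums of Dirichlet convolutions
  become iterated sums in this way.\<close>

lemma sum_divisors_swap:
  fixes F :: "nat \<Rightarrow> nat \<Rightarrow> 'a::comm_monoid_add"
  shows "(\<Sum>n=1..N. \<Sum>d | d dvd n. F d (n div d)) = (\<Sum>d=1..N. \<Sum>m=1..N div d. F d m)"
proof -
  have fin: "finite {d. d dvd n}" if "n \<in> {1..N}" for n :: nat using that by auto
  have "(\<Sum>n=1..N. \<Sum>d | d dvd n. F d (n div d)) =
      (\<Sum>(n, d)\<in>Sigma {1..N} (\<lambda>n. {d. d dvd n}). F d (n div d))"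
    by (rule sum.Sigma) (use fin in auto)
  also have "\<dots> = (\<Sum>(d, m)\<in>Sigma {1..N} (\<lambda>d. {1..N div d}). F d m)"
  proof (rule sum.reindex_bij_witness[where i = "\<lambda>(d, m). (d * m, d)" and j = "\<lambda>(n, d). (d, n div d)"],
      goal_cases)
    case (2 a)
    then obtain n d where a: "a = (n, d)" "n \<in> {1..N}" "d dvd n" by auto
    then obtain m where n: "n = d * m" by auto
    with a have "1 \<le> d" "1 \<le> m" by auto
    moreover have "d * 1 \<le> d * m" using \<open>1 \<le> m\<close> by (rule mult_le_mono2)
    moreover have "m * d \<le> N" using a n by (simp add: mult.commute)
    moreover have "d \<le> n" using a by (intro dvd_imp_le) auto
    then have "d \<le> N" using a(2) by simp
    ultimately show ?case using a n by (simp add: less_eq_div_iff_mult_less_eq)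
  next
    case (4 b)
    then obtain d m where b: "b = (d, m)" "d \<ge> 1" "d \<le> N" "m \<ge> 1" "m \<le> N div d" by auto
    then have "d * m \<le> N" by (simp add: less_eq_div_iff_mult_less_eq mult.commute)
    with b show ?case by auto
  qed auto
  also have "\<dots> = (\<Sum>d=1..N. \<Sum>m=1..N div d. F d m)"
    by (rule sum.Sigma[symmetric]) auto
  finally show ?thesis .
qed

text \<open>Legendre's formula, from the divisor sum of \<open>mangoldt\<close>. Terms with d > N
  vanish since then N div d = 0; the free bound \<open>X\<close> puts ln (2n)! and ln n! over a
  common range.\<close>

lemma ln_fact_eq_sum_mangoldt:
  assumes "N \<le> X"
  shows "ln (fact N :: real) = (\<Sum>d=1..X. mangoldt d * real (N div d))"
proof -
  have "ln (fact N :: real) = (\<Sum>n=1..N. ln (real n))"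
    unfolding fact_prod of_nat_prod by (subst ln_prod) auto
  also have "\<dots> = (\<Sum>n=1..N. \<Sum>d | d dvd n. mangoldt d)"
    by (intro sum.cong refl, subst mangoldt_sum) auto
  also have "\<dots> = (\<Sum>d=1..N. mangoldt d * real (N div d))"
    by (subst sum_divisors_swap[where F = "\<lambda>d m. mangoldt d"]) (simp add: mult.commute)
  also have "\<dots> = (\<Sum>d=1..X. mangoldt d * real (N div d))"
    using assms by (intro sum.mono_neutral_left) auto
  finally show ?thesis .
qed

text \<open>Chebyshev's argument: the logarithm of the central binomial coefficient weights
  \<open>mangoldt d\<close> by floor(2n/d) - 2 floor(n/d), which is never negative and is 1 for n <
  d <= 2n. The coefficient is at most 4^n, and ln 2 < 1.\<close>

lemma chebyshev_step: "(\<Sum>d=1..2*n. mangoldt d :: real) \<le> (\<Sum>d=1..n. mangoldt d) + 2 * real n"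
proof -
  have "(\<Sum>d=1..2*n. mangoldt d :: real) = (\<Sum>d=1..n. mangoldt d) + (\<Sum>d=n+1..2*n. mangoldt d)"
    by (subst sum.union_disjoint[symmetric]) (auto intro!: sum.cong)
  also have "(\<Sum>d=n+1..2*n. mangoldt d :: real) =
      (\<Sum>d=n+1..2*n. mangoldt d * (real (2 * n div d) - 2 * real (n div d)))"
  proof (rule sum.cong[OF refl], goal_cases)
    case (1 d)
    then have "2 * n div d = 1" "n div d = 0" by (auto intro: div_nat_eqI)
    then show ?case by simp
  qed
  also have "\<dots> \<le> (\<Sum>d=1..2*n. mangoldt d * (real (2 * n div d) - 2 * real (n div d)))"
  proof (intro sum_mono2 mult_nonneg_nonneg mangoldt_nonneg)
    fix d
    have "2 * (n div d) \<le> 2 * n div d"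
      by (cases "d = 0") (auto simp: less_eq_div_iff_mult_less_eq mult.assoc)
    then show "0 \<le> real (2 * n div d) - 2 * real (n div d)" by linarith
  qed auto
  also have "\<dots> = ln (fact (2 * n)) - 2 * ln (fact n)"
    by (simp add: ln_fact_eq_sum_mangoldt[of "2*n" "2*n"] ln_fact_eq_sum_mangoldt[of n "2*n"]
        sum_distrib_left sum_subtractf right_diff_distrib mult.left_commute)
  also have "\<dots> = ln (fact (2 * n) / (fact n * fact n))"
    by (simp add: ln_div ln_mult)
  also have "fact (2 * n) / (fact n * fact n) = (real (2 * n choose n))"
    by (subst binomial_fact) auto
  also have "ln (real (2 * n choose n)) \<le> ln (2 ^ (2 * n))"
  proof (subst ln_le_cancel_iff)
    have "2 * n choose n \<le> 2 ^ (2 * n)" by (rule binomial_le_pow2)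
    then show "real (2 * n choose n) \<le> 2 ^ (2 * n)"
      by (metis of_nat_le_iff of_nat_numeral of_nat_power)
  qed auto
  also have "\<dots> = 2 * real n * ln 2" by (simp add: ln_realpow)
  also have "\<dots> \<le> 2 * real n" using ln_2_less_1 by (simp add: mult_left_le)
  finally show ?thesis by simp
qed

text \<open>Halving: 4n for the lower half and 2n for the upper half leave room for one more term
  when N = 2n + 1, because \<open>mangoldt N\<close> is at most N - 1 = 2n.\<close>

lemma chebyshev_upper: "(\<Sum>d=1..N. mangoldt d :: real) \<le> 4 * real N"
proof (induction N rule: less_induct)
  case (less N)
  define n where "n = N div 2"
  show ?case
  proof (cases "N = 0")
    case False
    then have "n < N" by (simp add: n_def)
    with less have IH: "(\<Sum>d=1..n. mangoldt d :: real) \<le> 4 * real n" by simp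
    show ?thesis
    proof (cases "even N")
      case True
      then have "N = 2 * n" by (simp add: n_def)
      then show ?thesis using chebyshev_step[of n] IH by simp
    next
      case f: False
      then have N: "N = Suc (2 * n)" by (simp add: n_def)
      have "mangoldt N \<le> ln (real N)" using False by (intro mangoldt_le) simp
      also have "\<dots> \<le> real N - 1" using False by (intro ln_le_minus_one) simp
      finally have "mangoldt N \<le> 2 * real n" by (simp add: N)
      then show ?thesis using chebyshev_step[of n] IH by (simp add: N)
    qed
  qed simp
qed

lemma ln_fact_lower: "real N * ln (real N) - real N \<le> ln (fact N)"
proof (induction N)
  case (Suc N)
  show ?case
  proof (cases "N = 0")
    case False
    have "ln (real (Suc N)) - ln (real N) = ln (1 + 1 / real N)"
      using False by (subst ln_divide_pos[symmetric]) (auto simp: field_simps)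
    also have "\<dots> \<le> 1 / real N" using False by (intro ln_add_one_self_le_self) simp
    finally have "real N * (ln (real (Suc N)) - ln (real N)) \<le> 1"
      using False by (simp add: field_simps)
    moreover have "ln (fact (Suc N) :: real) = ln (real (Suc N)) + ln (fact N)"
      by (subst fact_Suc) (simp add: ln_mult)
    ultimately show ?thesis using Suc by (simp add: algebra_simps)
  qed simp
qed simp

text \<open>The lower half of Mertens' first theorem: Legendre's formula for ln N!, divided by
  N.\<close>

lemma mangoldt_sum_lower:
  assumes "N \<ge> 1"
  shows "ln (real N) - 1 \<le> (\<Sum>d=1..N. mangoldt d / real d)"
proof -
  have "real N * ln (real N) - real N \<le> ln (fact N)" by (rule ln_fact_lower)
  also have "\<dots> = (\<Sum>d=1..N. mangoldt d * real (N div d))" by (rule ln_fact_eq_sum_mangoldt) simp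
  also have "\<dots> \<le> (\<Sum>d=1..N. mangoldt d * (real N / real d))"
    by (intro sum_mono mult_left_mono mangoldt_nonneg of_nat_div_le_of_nat)
  also have "\<dots> = real N * (\<Sum>d=1..N. mangoldt d / real d)"
    by (simp add: sum_distrib_left mult.commute)
  finally have "real N * (ln (real N) - 1) \<le> real N * (\<Sum>d=1..N. mangoldt d / real d)"
    by (simp add: algebra_simps)
  then show ?thesis using assms by simp
qed

section \<open>Real characters\<close>

text \<open>Periodicity is represented only by its consequence \<open>bounded\<close>, which also
  excludes principal characters.\<close>

locale real_character =
  fixes g :: "nat \<Rightarrow> real" and B :: real
  assumes mult: "g (m * n) = g m * g n"
    and one: "g 1 = 1"
    and range: "g n \<in> {-1, 0, 1}"
    and bounded: "\<bar>\<Sum>n<x. g n\<bar> \<le> B"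
begin

text \<open>The convolution of \<open>g\<close> with the constant 1. For the character of a
  quadratic field it counts the ideals of norm n, which explains why it is nonnegative.\<close>

definition r :: "nat \<Rightarrow> real" where "r n = (\<Sum>d | d dvd n. g d)"

lemma abs_le_1: "\<bar>g n\<bar> \<le> 1"
  using range[of n] by auto

lemma B_nonneg: "0 \<le> B"
  using bounded[of 0] by simp

lemma g_power: "g (p ^ k) = g p ^ k"
  by (induction k) (use one in \<open>auto simp: mult\<close>)

lemma r_prime_power:
  assumes "prime p" "\<not> p dvd m" "m > 0"
  shows "r (p ^ k * m) = (\<Sum>j\<le>k. g p ^ j) * r m"
proof -
  have cop: "coprime (p ^ j) d" if "d dvd m" for j d
    using assms that by (metis coprime_power_left_iff dvd_trans prime_imp_coprime)
  have "(\<Sum>j\<le>k. g p ^ j) * r m = (\<Sum>(j, d)\<in>{..k} \<times> {d. d dvd m}. g p ^ j * g d)"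
    by (simp add: r_def sum_product sum.cartesian_product)
  also have "\<dots> = (\<Sum>(j, d)\<in>{..k} \<times> {d. d dvd m}. g (p ^ j * d))"
    by (simp add: mult g_power)
  also have "\<dots> = r (p ^ k * m)"
  proof -
    have "bij_betw (\<lambda>(j, d). p ^ j * d) ({..k} \<times> {d. d dvd m}) {d. d dvd p ^ k * m}"
    proof (rule bij_betwI')
      fix x y assume "x \<in> {..k} \<times> {d. d dvd m}" "y \<in> {..k} \<times> {d. d dvd m}"
      then obtain i d j e where xy: "x = (i, d)" "y = (j, e)" "d dvd m" "e dvd m" by auto
      have nd: "\<not> p dvd d" "\<not> p dvd e" using xy assms(2) dvd_trans by blast+
      have "d \<noteq> 0" "e \<noteq> 0" using nd by (metis dvd_0_right)+
      have "(i = j \<and> d = e)" if "p ^ i * d = p ^ j * e"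
      proof -
        have "multiplicity p (p ^ i * d) = i" "multiplicity p (p ^ j * e) = j"
          using assms(1) nd \<open>d \<noteq> 0\<close> \<open>e \<noteq> 0\<close>
          by (simp_all add: prime_elem_multiplicity_mult_distrib not_dvd_imp_multiplicity_0)
        with that have "i = j" by simp
        with that assms(1) show ?thesis by (auto dest: prime_gt_0_nat)
      qed
      then show "((case x of (j, d) \<Rightarrow> p ^ j * d) = (case y of (j, d) \<Rightarrow> p ^ j * d)) = (x = y)"
        using xy by auto
    next
      fix x assume "x \<in> {..k} \<times> {d. d dvd m}"
      then show "(case x of (j, d) \<Rightarrow> p ^ j * d) \<in> {d. d dvd p ^ k * m}"
        by (auto intro: mult_dvd_mono le_imp_power_dvd)
    next
      fix y assume "y \<in> {d. d dvd p ^ k * m}"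
      then obtain a d where "y = a * d" "a dvd p ^ k" "d dvd m" by (auto elim: dvd_productE)
      moreover from this assms(1) obtain i where "i \<le> k" "a = p ^ i"
        by (auto simp: divides_primepow_nat)
      ultimately show "\<exists>x\<in>{..k} \<times> {d. d dvd m}. y = (case x of (j, d) \<Rightarrow> p ^ j * d)"
        by (intro bexI[of _ "(i, d)"]) auto
    qed
    from sum.reindex_bij_betw[OF this, of g] show ?thesis
      by (simp add: r_def case_prod_unfold)
  qed
  finally show ?thesis by simp
qed

text \<open>The sum can vanish only for \<open>g p = -1\<close> and an odd top exponent; the
  exponents in a square are even.\<close>

lemma geometric_nonneg: "(\<Sum>j\<le>k. g p ^ j) \<ge> 0" and geometric_even_ge_1: "(\<Sum>j\<le>2*k. g p ^ j) \<ge> 1"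
proof -
  have *: "(\<Sum>j\<le>k. (-1::real) ^ j) = (if even k then 1 else 0)" for k by (induction k) auto
  have **: "(\<Sum>j\<le>k. (0::real) ^ j) = 1" for k by (induction k) auto
  show "(\<Sum>j\<le>k. g p ^ j) \<ge> 0" using range[of p] by (auto simp: * **)
  show "(\<Sum>j\<le>2*k. g p ^ j) \<ge> 1" using range[of p] by (auto simp: * **)
qed

lemma prime_power_split:
  assumes "n > (1::nat)"
  obtains p k m where "prime p" "\<not> p dvd m" "m > 0" "n = p ^ k * m" "m < n"
proof -
  from assms obtain p where p: "prime p" "p dvd n" by (metis less_irrefl prime_factor_nat)
  have "n \<noteq> 0" using assms by simp
  then obtain m where m: "n = p ^ multiplicity p n * m" "\<not> p dvd m"
    using p by (metis multiplicity_decompose' not_prime_unit prime_factorization_empty_iff)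
  have "m > 0" using m by (intro Nat.gr0I) auto
  moreover have "p ^ multiplicity p n > 1"
    using p \<open>n \<noteq> 0\<close> by (metis m one_less_power prime_gt_1_nat gr0I mult_1 power_0)
  ultimately have "m < n" by (subst m(1)) simp
  with that p m \<open>m > 0\<close> show ?thesis by blast
qed

lemma r_1: "r 1 = 1"
  using one by (simp add: r_def)

lemma r_nonneg: "n > 0 \<Longrightarrow> r n \<ge> 0"
proof (induction n rule: less_induct)
  case (less n)
  show ?case
  proof (cases "n = 1")
    case False
    with less have "n > 1" by simp
    then obtain p k m where "prime p" "\<not> p dvd m" "m > 0" "n = p ^ k * m" "m < n"
      by (rule prime_power_split)
    with less show ?thesis using r_prime_power geometric_nonneg by simp
  qed (use r_1 in simp)
qed

lemma r_square_ge_1: "n > 0 \<Longrightarrow> r (n ^ 2) \<ge> 1"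
proof (induction n rule: less_induct)
  case (less n)
  show ?case
  proof (cases "n = 1")
    case False
    with less have "n > 1" by simp
    then obtain p k m where n: "prime p" "\<not> p dvd m" "m > 0" "n = p ^ k * m" "m < n"
      by (rule prime_power_split)
    have "n ^ 2 = p ^ (2 * k) * m ^ 2" by (simp add: n power_mult_distrib power_mult mult.commute)
    moreover have "\<not> p dvd m ^ 2" using n by (simp add: prime_dvd_power_iff)
    ultimately have "r (n ^ 2) = (\<Sum>j\<le>2*k. g p ^ j) * r (m ^ 2)"
      using n r_prime_power[of p "m ^ 2" "2 * k"] by simp
    moreover have "r (m ^ 2) \<ge> 1" using less n by simp
    ultimately show ?thesis using mult_mono[OF geometric_even_ge_1[where k = k and p = p], of 1 "r (m^2)"]
      geometric_nonneg[where k = "2*k" and p = p] by simp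
  qed (use r_1 in simp)
qed

text \<open>The value at 1 of the L-series of \<open>g\<close>; the limit exists by
  \<open>partial_sums_Cauchy\<close>.\<close>

definition L :: real where "L = lim (\<lambda>N. \<Sum>n=1..N. g n / real n)"

lemma tail_le:
  assumes "N \<le> N'"
  shows "\<bar>(\<Sum>n=1..N'. g n / real n) - (\<Sum>n=1..N. g n / real n)\<bar> \<le> 2 * B / real (N + 1)"
proof (cases "N = N'")
  case False
  with assms have "N + 1 \<le> N'" by simp
  then have "{1..N'} = {1..N} \<union> {N+1..N'}" by auto
  moreover have "sum (\<lambda>n. g n / real n) ({1..N} \<union> {N+1..N'}) =
      (\<Sum>n=1..N. g n / real n) + (\<Sum>n=N+1..N'. g n / real n)"
    by (rule sum.union_disjoint) auto
  ultimately have 1: "(\<Sum>n=1..N'. g n / real n) - (\<Sum>n=1..N. g n / real n) =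
     (\<Sum>n=N+1..N'. g n * (1 / real n))" by simp
  have "\<bar>\<Sum>n=N+1..N'. g n * (1 / real n)\<bar> \<le> 2 * B * (1 / real (N + 1))"
    using \<open>N + 1 \<le> N'\<close> by (intro abel_bound bounded) (auto simp: field_simps)
  with 1 show ?thesis by simp
qed (use B_nonneg in simp)

lemma partial_sums_Cauchy: "Cauchy (\<lambda>N. \<Sum>n=1..N. g n / real n)"
proof (rule metric_CauchyI)
  fix e :: real assume "e > 0"
  obtain M :: nat where M: "2 * B / e < real M" using reals_Archimedean2 by blast
  have "dist (\<Sum>n=1..m. g n / real n) (\<Sum>n=1..n. g n / real n) < e" if "m \<ge> M" "n \<ge> M" for m n
  proof -
    have "\<bar>(\<Sum>n=1..m. g n / real n) - (\<Sum>n=1..n. g n / real n)\<bar> \<le> 2 * B / real (min m n + 1)"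
      using tail_le[of m n] tail_le[of n m] by (auto simp: min_def abs_minus_commute)
    also have "\<dots> < e"
    proof -
      have "2 * B < e * real M" using M \<open>e > 0\<close> by (simp add: field_simps)
      also have "\<dots> \<le> e * real (min m n + 1)" using that \<open>e > 0\<close> by simp
      finally show ?thesis using \<open>e > 0\<close> by (simp add: field_simps)
    qed
    finally show ?thesis by (simp add: dist_real_def)
  qed
  then show "\<exists>M. \<forall>m\<ge>M. \<forall>n\<ge>M. dist (\<Sum>n=1..m. g n / real n) (\<Sum>n=1..n. g n / real n) < e"
    by blast
qed

lemma L_approx: "\<bar>L - (\<Sum>n=1..N. g n / real n)\<bar> \<le> 2 * B / real (N + 1)"
proof (rule LIMSEQ_le_const2)
  have "(\<lambda>N. \<Sum>n=1..N. g n / real n) \<longlonglongrightarrow> L"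
    unfolding L_def using partial_sums_Cauchy Cauchy_convergent_iff convergent_LIMSEQ_iff by blast
  then show "(\<lambda>N'. \<bar>(\<Sum>n=1..N'. g n / real n) - (\<Sum>n=1..N. g n / real n)\<bar>)
      \<longlonglongrightarrow> \<bar>L - (\<Sum>n=1..N. g n / real n)\<bar>" by (intro tendsto_intros)
qed (use tail_le in auto)

end

section \<open>Sums of inverse square roots\<close>

definition isqrt_sum :: "nat \<Rightarrow> real" where "isqrt_sum y = (\<Sum>m=1..y. 1 / sqrt (real m))"

lemma inverse_sqrt_bounds:
  assumes "m \<ge> 1"
  shows "1 / sqrt (real (Suc m)) \<le> 2 * (sqrt (real (Suc m)) - sqrt (real m))"
    "2 * (sqrt (real (Suc m)) - sqrt (real m)) \<le> 1 / sqrt (real m)"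
proof -
  define a where "a = sqrt (real m)"
  define b where "b = sqrt (real (Suc m))"
  have ab: "0 < a" "a \<le> b" "b * b = a * a + 1" using assms by (auto simp: a_def b_def)
  then have "(b - a) * (b + a) = 1" by (simp add: algebra_simps)
  then have eq: "b - a = 1 / (b + a)" using ab by (simp add: field_simps)
  show "1 / sqrt (real (Suc m)) \<le> 2 * (sqrt (real (Suc m)) - sqrt (real m))"
    unfolding a_def[symmetric] b_def[symmetric] eq using ab by (simp add: field_simps)
  show "2 * (sqrt (real (Suc m)) - sqrt (real m)) \<le> 1 / sqrt (real m)"
    unfolding a_def[symmetric] b_def[symmetric] eq using ab by (simp add: field_simps)
qed

text \<open>\<open>isqrt_sum y - 2 * sqrt (real y)\<close> decreases with y, and increases once 1 /
  sqrt y is subtracted. So it converges, and beyond N it stays within 1 / sqrt N of its value at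
  N.\<close>

lemma isqrt_sum_diff_bounds:
  assumes "1 \<le> N" "N \<le> y"
  shows "isqrt_sum y - 2 * sqrt (real y) \<le> isqrt_sum N - 2 * sqrt (real N)"
    "isqrt_sum N - 2 * sqrt (real N) \<le> isqrt_sum y - 2 * sqrt (real y) + 1 / sqrt (real N) - 1 / sqrt (real y)"
  using assms(2)
proof (induction y rule: dec_induct)
  case (step y)
  have isqrt_sum: "isqrt_sum (Suc y) = isqrt_sum y + 1 / sqrt (real (Suc y))" by (simp add: isqrt_sum_def)
  {
    case 1 then show ?case
      using step inverse_sqrt_bounds[of y] assms(1) isqrt_sum by simp
  next
    case 2 then show ?case
      using step inverse_sqrt_bounds[of y] assms(1) isqrt_sum by simp
  }
qed simp_all

lemma isqrt_sum_le: "isqrt_sum N \<le> 2 * sqrt (real N)"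
proof (cases "N = 0")
  case False
  have "isqrt_sum 1 = 1" by (simp add: isqrt_sum_def)
  then show ?thesis using isqrt_sum_diff_bounds(1)[of 1 N] False by simp
qed (simp add: isqrt_sum_def)

lemma isqrt_sum_ge: "isqrt_sum N \<ge> 2 * sqrt (real N) - 2"
proof (cases "N = 0")
  case False
  have "isqrt_sum 1 = 1" by (simp add: isqrt_sum_def)
  then have "isqrt_sum N \<ge> 2 * sqrt (real N) - 2 + 1 / sqrt (real N)"
    using isqrt_sum_diff_bounds(2)[of 1 N] False by simp
  moreover have "1 / sqrt (real N) \<ge> 0" by simp
  ultimately show ?thesis by linarith
qed (simp add: isqrt_sum_def)

lemma real_div_le_Suc_div:
  assumes "d \<ge> 1"
  shows "real n / real d \<le> real (Suc (n div d))"
proof -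
  have "n \<le> Suc (n div d) * d" using dividend_less_div_times[of d n] assms by simp
  then have "real n \<le> real (Suc (n div d)) * real d" by (metis of_nat_le_iff of_nat_mult)
  then show ?thesis using assms by (simp only: divide_le_eq) simp
qed

text \<open>The point is that the last term does not depend on \<open>d\<close>: in a sum over
  \<open>d\<close> it factors out and meets only a bounded character sum. The condition d <= N
  ensures that N^2 div d is at least N.\<close>

lemma isqrt_sum_div_approx:
  assumes "1 \<le> d" "d \<le> N"
  shows "\<bar>isqrt_sum (N\<^sup>2 div d) - 2 * (real N / sqrt (real d)) - (isqrt_sum N - 2 * sqrt (real N))\<bar> \<le> 2 / sqrt (real N)"
proof -
  define y where "y = N\<^sup>2 div d"
  have "N * d \<le> N * N" using assms by simp
  then have y: "N \<le> y" using assms by (simp add: y_def less_eq_div_iff_mult_less_eq power2_eq_square)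
  have N: "1 \<le> N" using assms by simp
  have "real N / sqrt (real d) = sqrt (real (N\<^sup>2) / real d)"
    by (simp add: real_sqrt_divide)
  moreover have "real y \<le> real (N\<^sup>2) / real d" unfolding y_def by (rule of_nat_div_le_of_nat)
  moreover have "real (N\<^sup>2) / real d \<le> real (Suc y)"
    using real_div_le_Suc_div[of d "N\<^sup>2"] assms by (simp add: y_def)
  ultimately have 1: "sqrt (real y) \<le> real N / sqrt (real d)" "real N / sqrt (real d) \<le> sqrt (real (Suc y))"
    by (metis real_sqrt_le_mono)+
  have 2: "2 * (sqrt (real (Suc y)) - sqrt (real y)) \<le> 1 / sqrt (real y)"
    using inverse_sqrt_bounds(2)[of y] y N by simp
  have 3: "1 / sqrt (real y) \<le> 1 / sqrt (real N)" using y N by (simp add: field_simps)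
  have 4: "0 \<le> 1 / sqrt (real y)" by simp
  have arith: "\<bar>Uy - 2 * T - (w0 - 2 * sN)\<bar> \<le> 2 * v"
    if "sy \<le> T" "T \<le> sy1" "2 * (sy1 - sy) \<le> u" "u \<le> v" "0 \<le> u"
      "Uy - 2 * sy \<le> w0 - 2 * sN" "w0 - 2 * sN \<le> Uy - 2 * sy + v - u"
    for Uy T w0 sN v u sy sy1 :: real
    using that by (simp add: abs_le_iff)
  show ?thesis using arith[OF 1 2 3 4 isqrt_sum_diff_bounds[OF N y]] by (simp add: y_def)
qed

lemma ln_le_harmonic_sum: "ln (real (Suc N)) \<le> (\<Sum>k=1..N. 1 / real k)"
proof (induction N)
  case (Suc N)
  have "ln (real (Suc (Suc N))) - ln (real (Suc N)) = ln (1 + 1 / real (Suc N))"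
    by (subst ln_divide_pos[symmetric]) (auto simp: field_simps)
  also have "\<dots> \<le> 1 / real (Suc N)" by (intro ln_add_one_self_le_self) simp
  finally show ?case using Suc by simp
qed simp

section \<open>Non-vanishing of \<open>L\<close>\<close>

context real_character
begin

lemma sqrt_sum_bound:
  assumes "1 \<le> a"
  shows "\<bar>\<Sum>n=a..b. g n / sqrt (real n)\<bar> \<le> 2 * B / sqrt (real a)"
proof (cases "a \<le> b")
  case True
  have "\<bar>\<Sum>n=a..b. g n * (1 / sqrt (real n))\<bar> \<le> 2 * B * (1 / sqrt (real a))"
    using True assms by (intro abel_bound bounded) (auto simp: field_simps)
  then show ?thesis by simp
qed (use B_nonneg in simp)

text \<open>\<open>r\<close> is nonnegative and at least 1 at squares, so keeping only n = k^2
  leaves the harmonic series.\<close>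

lemma r_sqrt_sum_lower: "(\<Sum>k=1..N. 1 / real k) \<le> (\<Sum>n=1..N\<^sup>2. r n / sqrt (real n))"
proof -
  have "(\<Sum>k=1..N. 1 / real k) \<le> (\<Sum>k=1..N. r (k\<^sup>2) / sqrt (real (k\<^sup>2)))"
    using r_square_ge_1 by (intro sum_mono) (auto simp: divide_right_mono)
  also have "\<dots> = (\<Sum>n\<in>(\<lambda>k. k\<^sup>2) ` {1..N}. r n / sqrt (real n))"
    by (subst sum.reindex) (auto simp: inj_on_def)
  also have "\<dots> \<le> (\<Sum>n=1..N\<^sup>2. r n / sqrt (real n))"
    using r_nonneg by (intro sum_mono2) (auto simp: power_mono)
  finally show ?thesis .
qed

text \<open>Dirichlet's hyperbola method for N^2, cut at N. If \<open>L = 0\<close>, the main term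
  is 2N times a tail of the series for \<open>L\<close> and costs 4B. The constant in the
  approximation of \<open>isqrt_sum\<close> costs 4B, the range d > N another 4B, and the
  approximation error 4.\<close>

lemma r_sqrt_sum_upper:
  assumes "L = 0" "N \<ge> 1"
  shows "(\<Sum>n=1..N\<^sup>2. r n / sqrt (real n)) \<le> 12 * B + 4"
proof -
  define F where "F = (\<lambda>d m. g d / sqrt (real d) * (1 / sqrt (real m)))"
  define X where "X = N\<^sup>2"
  have "(\<Sum>n=1..X. r n / sqrt (real n)) = (\<Sum>n=1..X. \<Sum>d | d dvd n. F d (n div d))"
  proof (intro sum.cong refl)
    fix n assume "n \<in> {1..X}"
    have "(\<Sum>d | d dvd n. F d (n div d)) = (\<Sum>d | d dvd n. g d / sqrt (real n))"
    proof (intro sum.cong refl)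
      fix d assume "d \<in> {d. d dvd n}"
      then obtain m where "n = d * m" by auto
      with \<open>n \<in> {1..X}\<close> show "F d (n div d) = g d / sqrt (real n)"
        by (auto simp: F_def real_sqrt_mult)
    qed
    then show "r n / sqrt (real n) = (\<Sum>d | d dvd n. F d (n div d))"
      by (simp add: r_def sum_divide_distrib)
  qed
  also have "\<dots> = (\<Sum>d=1..X. \<Sum>m=1..X div d. F d m)" by (rule sum_divisors_swap)
  also have "\<dots> = (\<Sum>d=1..N. \<Sum>m=1..X div d. F d m) + (\<Sum>d=N+1..X. \<Sum>m=1..X div d. F d m)"
  proof -
    have "N \<le> X" by (simp add: X_def power2_eq_square)
    then have "{1..X} = {1..N} \<union> {N+1..X}" by auto
    then show ?thesis by (simp only:) (rule sum.union_disjoint, auto)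
  qed
  also have "(\<Sum>d=1..N. \<Sum>m=1..X div d. F d m) = (\<Sum>d=1..N. g d / sqrt (real d) * isqrt_sum (X div d))"
    by (simp add: F_def isqrt_sum_def sum_distrib_left)
  also have "(\<Sum>d=N+1..X. \<Sum>m=1..X div d. F d m) = (\<Sum>m=1..N. \<Sum>d=N+1..X div m. F d m)"
  proof -
    have "(\<Sum>d=N+1..X. \<Sum>m=1..X div d. F d m) = (\<Sum>d=N+1..X. \<Sum>m | m \<in> {1..N} \<and> d * m \<le> X. F d m)"
    proof (intro sum.cong refl)
      fix d assume d: "d \<in> {N+1..X}"
      have "m \<le> N" if "d * m \<le> X" for m
      proof (rule ccontr)
        assume "\<not> m \<le> N"
        then have "(N+1) * (N+1) \<le> d * m" using d by (intro mult_le_mono) auto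
        with that show False by (simp add: X_def power2_eq_square)
      qed
      with d show "{1..X div d} = {m \<in> {1..N}. d * m \<le> X}"
        by (auto simp: less_eq_div_iff_mult_less_eq mult.commute)
    qed
    also have "\<dots> = (\<Sum>m=1..N. \<Sum>d | d \<in> {N+1..X} \<and> d * m \<le> X. F d m)"
      by (rule sum.swap_restrict) auto
    also have "\<dots> = (\<Sum>m=1..N. \<Sum>d=N+1..X div m. F d m)"
    proof (intro sum.cong refl)
      fix m assume m: "m \<in> {1..N}"
      have "d \<le> X" if "d * m \<le> X" for d
      proof -
        have "d * 1 \<le> d * m" using m by (intro mult_le_mono2) auto
        with that show ?thesis by linarith
      qed
      with m show "{d \<in> {N+1..X}. d * m \<le> X} = {N+1..X div m}"
        by (auto simp: less_eq_div_iff_mult_less_eq)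
    qed
    finally show ?thesis .
  qed
  finally have eq: "(\<Sum>n=1..X. r n / sqrt (real n)) =
      (\<Sum>d=1..N. g d / sqrt (real d) * isqrt_sum (X div d)) + (\<Sum>m=1..N. \<Sum>d=N+1..X div m. F d m)" .

  have "(\<Sum>m=1..N. \<Sum>d=N+1..X div m. F d m) \<le> (\<Sum>m=1..N. (2 * B / sqrt (real N)) * (1 / sqrt (real m)))"
  proof (intro sum_mono)
    fix m assume "m \<in> {1..N}"
    have "(\<Sum>d=N+1..X div m. F d m) = (\<Sum>d=N+1..X div m. g d / sqrt (real d)) * (1 / sqrt (real m))"
      by (simp add: F_def sum_divide_distrib)
    also have "\<dots> \<le> (2 * B / sqrt (real (N + 1))) * (1 / sqrt (real m))"
      using sqrt_sum_bound[of "N+1" "X div m"] by (intro mult_right_mono) auto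
    also have "\<dots> \<le> (2 * B / sqrt (real N)) * (1 / sqrt (real m))"
      using B_nonneg assms(2) by (intro mult_right_mono divide_left_mono) auto
    finally show "(\<Sum>d=N+1..X div m. F d m) \<le> (2 * B / sqrt (real N)) * (1 / sqrt (real m))" .
  qed
  also have "\<dots> = 2 * B / sqrt (real N) * isqrt_sum N" by (simp only: isqrt_sum_def sum_distrib_left)
  also have "\<dots> \<le> 2 * B / sqrt (real N) * (2 * sqrt (real N))"
    using isqrt_sum_le[of N] B_nonneg by (intro mult_left_mono) auto
  also have "\<dots> = 4 * B" using assms(2) by simp
  finally have part2: "(\<Sum>m=1..N. \<Sum>d=N+1..X div m. F d m) \<le> 4 * B" .

  define c where "c = isqrt_sum N - 2 * sqrt (real N)"
  define E where "E = (\<lambda>d. isqrt_sum (X div d) - 2 * (real N / sqrt (real d)) - c)"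
  have "(\<Sum>d=1..N. g d / sqrt (real d) * isqrt_sum (X div d)) =
      (\<Sum>d=1..N. 2 * real N * (g d / real d) + c * (g d / sqrt (real d)) + g d / sqrt (real d) * E d)"
  proof (intro sum.cong refl)
    fix d assume "d \<in> {1..N}"
    then have *: "g d / real d = g d / sqrt (real d) / sqrt (real d)" by simp
    show "g d / sqrt (real d) * isqrt_sum (X div d) =
      2 * real N * (g d / real d) + c * (g d / sqrt (real d)) + g d / sqrt (real d) * E d"
      unfolding * E_def by (simp add: algebra_simps)
  qed
  also have "\<dots> = 2 * real N * (\<Sum>d=1..N. g d / real d) + c * (\<Sum>d=1..N. g d / sqrt (real d))
      + (\<Sum>d=1..N. g d / sqrt (real d) * E d)"
    by (simp only: sum.distrib sum_distrib_left)
  finally have part1: "(\<Sum>d=1..N. g d / sqrt (real d) * isqrt_sum (X div d)) =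
      2 * real N * (\<Sum>d=1..N. g d / real d) + c * (\<Sum>d=1..N. g d / sqrt (real d))
      + (\<Sum>d=1..N. g d / sqrt (real d) * E d)" .

  have "2 * real N * (\<Sum>d=1..N. g d / real d) \<le> 2 * real N * (2 * B / real (N + 1))"
    using L_approx[of N] assms by (intro mult_left_mono) auto
  also have "\<dots> \<le> 4 * B" using B_nonneg by (simp add: field_simps)
  finally have b1: "2 * real N * (\<Sum>d=1..N. g d / real d) \<le> 4 * B" .

  have "\<bar>c * (\<Sum>d=1..N. g d / sqrt (real d))\<bar> = \<bar>c\<bar> * \<bar>\<Sum>d=1..N. g d / sqrt (real d)\<bar>"
    by (rule abs_mult)
  also have "\<dots> \<le> 2 * (2 * B)"
    using sqrt_sum_bound[of 1 N] isqrt_sum_le[of N] isqrt_sum_ge[of N] by (intro mult_mono) (auto simp: c_def)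
  finally have b2: "c * (\<Sum>d=1..N. g d / sqrt (real d)) \<le> 4 * B" by simp

  have "(\<Sum>d=1..N. g d / sqrt (real d) * E d) \<le> (\<Sum>d=1..N. 1 / sqrt (real d) * (2 / sqrt (real N)))"
  proof (intro sum_mono)
    fix d assume d: "d \<in> {1..N}"
    have "\<bar>g d / sqrt (real d) * E d\<bar> = \<bar>g d\<bar> / sqrt (real d) * \<bar>E d\<bar>"
      by (simp add: abs_mult)
    also have "\<dots> \<le> 1 / sqrt (real d) * (2 / sqrt (real N))"
      using isqrt_sum_div_approx[of d N] d abs_le_1[of d]
      by (intro mult_mono divide_right_mono) (auto simp: E_def X_def c_def)
    finally show "g d / sqrt (real d) * E d \<le> 1 / sqrt (real d) * (2 / sqrt (real N))"
      by (rule abs_le_D1)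
  qed
  also have "\<dots> = isqrt_sum N * (2 / sqrt (real N))" by (simp only: isqrt_sum_def sum_distrib_right)
  also have "\<dots> \<le> 2 * sqrt (real N) * (2 / sqrt (real N))"
    using isqrt_sum_le[of N] by (intro mult_right_mono) auto
  also have "\<dots> = 4" using assms(2) by simp
  finally have "(\<Sum>d=1..N. g d / sqrt (real d) * isqrt_sum (X div d)) \<le> 8 * B + 4"
    using part1 b1 b2 by linarith
  with part2 eq show ?thesis by (simp add: X_def)
qed

lemma L_nonzero: "L \<noteq> 0"
proof
  assume "L = 0"
  obtain N :: nat where N: "exp (12 * B + 4) < real N" using reals_Archimedean2 by blast
  moreover have "0 < exp (12 * B + 4)" by simp
  ultimately have "N \<ge> 1" by linarith
  have "12 * B + 4 < ln (real (Suc N))" using N by (smt (verit) exp_less_cancel_iff exp_ln of_nat_Suc of_nat_0_le_iff)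
  also have "\<dots> \<le> 12 * B + 4"
    using ln_le_harmonic_sum[of N] r_sqrt_sum_lower[of N] r_sqrt_sum_upper[OF \<open>L = 0\<close> \<open>N \<ge> 1\<close>] by simp
  finally show False by simp
qed

end

text \<open>The function g ln is the convolution of g mangoldt with g. Hence the bounded sum of g(n)
  ln n / n equals the sum of g(d) mangoldt(d) / d times partial sums of the series for
  \<open>L\<close> at N div d. Replacing these by \<open>L\<close> costs O(d/N) each, in total 8B by
  Chebyshev's bound; then divide by \<open>L\<close>.\<close>

lemma (in real_character) mangoldt_sum_bounded:
  "\<exists>C. \<forall>N. \<bar>\<Sum>d=1..N. g d * mangoldt d / real d\<bar> \<le> C"
proof -
  define h where "h = (\<lambda>n::nat. ln (real n) / real n)"
  have ln_bound: "\<bar>\<Sum>n=1..N. g n * h n\<bar> \<le> 1 + 2 * B" if "N \<ge> 1" for N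
  proof (cases "N \<ge> 3")
    case True
    have h_nonneg: "h n \<ge> 0" for n by (cases "n = 0") (auto simp: h_def)
    have h_decr: "h (Suc n) \<le> h n" if "3 \<le> n" for n
    proof -
      have "ln (real (Suc n)) - ln (real n) = ln (1 + 1 / real n)"
        using that by (subst ln_divide_pos[symmetric]) (auto simp: field_simps)
      also have "\<dots> \<le> 1 / real n" by (intro ln_add_one_self_le_self) simp
      finally have "real n * (ln (real (Suc n)) - ln (real n)) \<le> 1"
        using that by (simp add: field_simps)
      also have "1 \<le> ln (real n)"
        using exp_le that by (subst ln_ge_iff) auto
      finally have "real n * ln (real (Suc n)) \<le> real (Suc n) * ln (real n)"
        by (simp add: algebra_simps)
      then show ?thesis using that by (simp add: h_def field_simps)
    qed
    \<comment> \<open>ln n / n decreases only beyond e, so summation by parts starts at 3.\<close>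
    have "{1..N} = {1..2} \<union> {3..N}" using True by auto
    then have "(\<Sum>n=1..N. g n * h n) = (\<Sum>n=1..2. g n * h n) + (\<Sum>n=3..N. g n * h n)"
      by (simp only:) (rule sum.union_disjoint, auto)
    moreover have "\<bar>\<Sum>n=3..N. g n * h n\<bar> \<le> 2 * B * h 3"
      using True h_nonneg h_decr by (intro abel_bound bounded) auto
    moreover have "2 * B * h 3 \<le> 2 * B * 1"
      using ln_le_minus_one[of 3] B_nonneg by (intro mult_left_mono) (auto simp: h_def)
    moreover have "\<bar>\<Sum>n=1..2. g n * h n\<bar> \<le> 1"
    proof -
      have "(\<Sum>n=1..2. g n * h n) = g 2 * h 2" by (simp add: h_def numeral_2_eq_2)
      moreover have "\<bar>g 2\<bar> * \<bar>h 2\<bar> \<le> 1 * 1"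
        using abs_le_1[of 2] ln_2_less_1 by (intro mult_mono) (auto simp: h_def)
      ultimately show ?thesis by (simp add: abs_mult)
    qed
    ultimately show ?thesis by linarith
  next
    case False
    with that have "N = 1 \<or> N = 2" by auto
    moreover have "\<bar>g 2\<bar> * \<bar>h 2\<bar> \<le> 1 * 1"
      using abs_le_1[of 2] ln_2_less_1 by (intro mult_mono) (auto simp: h_def)
    ultimately show ?thesis using B_nonneg by (auto simp: h_def numeral_2_eq_2 abs_mult)
  qed

  have "\<bar>\<Sum>d=1..N. g d * mangoldt d / real d\<bar> \<le> (1 + 10 * B) / \<bar>L\<bar>" for N
  proof (cases "N = 0")
    case False
    define s where "s = (\<lambda>K. \<Sum>m=1..K. g m / real m)"
    have "(\<Sum>n=1..N. g n * h n) = (\<Sum>n=1..N. \<Sum>d | d dvd n. g d * mangoldt d / real d * (g (n div d) / real (n div d)))"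
    proof (intro sum.cong refl)
      fix n assume n: "n \<in> {1..N}"
      have "(\<Sum>d | d dvd n. g d * mangoldt d / real d * (g (n div d) / real (n div d))) =
          (\<Sum>d | d dvd n. g n / real n * mangoldt d)"
      proof (intro sum.cong refl)
        fix d assume "d \<in> {d. d dvd n}"
        then obtain m where "n = d * m" by auto
        with n show "g d * mangoldt d / real d * (g (n div d) / real (n div d)) = g n / real n * mangoldt d"
          by (auto simp: mult)
      qed
      also have "\<dots> = g n / real n * (\<Sum>d | d dvd n. mangoldt d)" by (rule sum_distrib_left[symmetric])
      also have "\<dots> = g n * h n"
        using n mangoldt_sum[of n, where 'a = real] by (simp add: h_def)
      finally show "g n * h n = (\<Sum>d | d dvd n. g d * mangoldt d / real d * (g (n div d) / real (n div d)))" ..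
    qed
    also have "\<dots> = (\<Sum>d=1..N. \<Sum>m=1..N div d. g d * mangoldt d / real d * (g m / real m))"
      by (rule sum_divisors_swap)
    also have "\<dots> = (\<Sum>d=1..N. g d * mangoldt d / real d * s (N div d))"
      by (simp add: s_def sum_distrib_left)
    also have "\<dots> = (\<Sum>d=1..N. L * (g d * mangoldt d / real d) + g d * mangoldt d / real d * (s (N div d) - L))"
      by (intro sum.cong refl) (simp add: right_diff_distrib)
    also have "\<dots> = L * (\<Sum>d=1..N. g d * mangoldt d / real d) + (\<Sum>d=1..N. g d * mangoldt d / real d * (s (N div d) - L))"
      by (simp only: sum.distrib sum_distrib_left)
    finally have eq: "L * (\<Sum>d=1..N. g d * mangoldt d / real d) = (\<Sum>n=1..N. g n * h n) -
      (\<Sum>d=1..N. g d * mangoldt d / real d * (s (N div d) - L))" by simp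
    have "\<bar>\<Sum>d=1..N. g d * mangoldt d / real d * (s (N div d) - L)\<bar> \<le>
        (\<Sum>d=1..N. \<bar>g d * mangoldt d / real d * (s (N div d) - L)\<bar>)" by (rule sum_abs)
    also have "\<dots> \<le> (\<Sum>d=1..N. 2 * B / real N * mangoldt d)"
    proof (intro sum_mono)
      fix d assume d: "d \<in> {1..N}"
      have "\<bar>s (N div d) - L\<bar> \<le> 2 * B / real (N div d + 1)"
        using L_approx[of "N div d"] by (simp add: s_def abs_minus_commute)
      also have "\<dots> \<le> 2 * B / (real N / real d)"
        using real_div_le_Suc_div[of d N] B_nonneg d by (intro divide_left_mono) auto
      finally have s: "\<bar>s (N div d) - L\<bar> \<le> 2 * B / (real N / real d)" .
      have "\<bar>g d * mangoldt d / real d * (s (N div d) - L)\<bar> =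
        \<bar>g d\<bar> * (mangoldt d / real d * \<bar>s (N div d) - L\<bar>)" by (simp add: abs_mult)
      also have "\<dots> \<le> 1 * (mangoldt d / real d * (2 * B / (real N / real d)))"
        using abs_le_1[of d] s by (intro mult_mono mult_nonneg_nonneg divide_nonneg_nonneg mangoldt_nonneg) auto
      also have "\<dots> = 2 * B / real N * mangoldt d" using d by simp
      finally show "\<bar>g d * mangoldt d / real d * (s (N div d) - L)\<bar> \<le> 2 * B / real N * mangoldt d" .
    qed
    also have "\<dots> = 2 * B / real N * (\<Sum>d=1..N. mangoldt d)" by (simp only: sum_distrib_left)
    also have "\<dots> \<le> 2 * B / real N * (4 * real N)"
      using chebyshev_upper[of N] B_nonneg by (intro mult_left_mono) auto
    also have "\<dots> = 8 * B" using False by simp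
    finally have "\<bar>L * (\<Sum>d=1..N. g d * mangoldt d / real d)\<bar> \<le> 1 + 10 * B"
      using ln_bound[of N] False unfolding eq by linarith
    then show ?thesis using L_nonzero by (simp add: field_simps abs_mult)
  qed (use B_nonneg in simp)
  then show ?thesis by blast
qed

lemma ln_le_2sqrt: "x \<ge> 1 \<Longrightarrow> ln x \<le> 2 * sqrt x" for x :: real
proof -
  assume x: "x \<ge> 1"
  have "ln x = 2 * ln (sqrt x)" using x by (simp add: ln_sqrt)
  also have "\<dots> \<le> 2 * sqrt x" using ln_le_minus_one[of "sqrt x"] x by simp
  finally show ?thesis .
qed

text \<open>The geometric series over the exponents k >= 2 leaves 2 ln p / p^2. As ln p <= 2 sqrt p
  this is of order p^(-3/2), which is dominated by the telescoping 1 / sqrt(p-1) - 1 / sqrt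
  p.\<close>

lemma sum_mangoldt_primes_diff:
  "(\<Sum>n\<in>{n\<in>{1..N}. \<not> prime n}. mangoldt n / real n) \<le> 16"
proof -
  define A where "A = (\<lambda>(p::nat, k::nat). p ^ k) ` ({2..N} \<times> {2..N})"
  have "(\<Sum>n\<in>{n\<in>{1..N}. \<not> prime n}. mangoldt n / real n) = (\<Sum>n\<in>{n\<in>{1..N}. \<not> prime n \<and> primepow n}. mangoldt n / real n)"
    by (intro sum.mono_neutral_right) (auto simp: mangoldt_def)
  also have "\<dots> \<le> (\<Sum>(p,k)\<in>({2..N} \<times> {2..N}). ln (real p) / real (p ^ k))"
  proof (rule sum_le_included[where i = "\<lambda>(p,k). p ^ k"])
    show "\<forall>n\<in>{n \<in> {1..N}. \<not> prime n \<and> primepow n}. \<exists>y\<in>{2..N} \<times> {2..N}. (case y of (p, k) \<Rightarrow> p ^ k) = n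
        \<and> mangoldt n / real n \<le> (case y of (p, k) \<Rightarrow> ln (real p) / real (p ^ k))"
    proof
      fix n assume n: "n \<in> {n \<in> {1..N}. \<not> prime n \<and> primepow n}"
      then obtain p k where pk: "prime p" "k > 0" "n = p ^ k" by (auto simp: primepow_def prime_elem_nat_iff)
      have "k \<noteq> 1" using n pk by auto
      then have k: "k \<ge> 2" using pk by simp
      have p: "p \<ge> 2" using pk by (simp add: prime_ge_2_nat)
      have "p ^ 1 \<le> p ^ k" "k < p ^ k"
        using p k by (auto intro: less_le_trans[OF less_exp power_mono] simp: self_le_power)
      then have "p \<le> N" "k \<le> N" using n pk by auto
      then show "\<exists>y\<in>{2..N} \<times> {2..N}. (case y of (p, k) \<Rightarrow> p ^ k) = n
        \<and> mangoldt n / real n \<le> (case y of (p, k) \<Rightarrow> ln (real p) / real (p ^ k))"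
        using p k pk by (intro bexI[of _ "(p, k)"]) auto
    qed
  qed auto
  also have "\<dots> = (\<Sum>p=2..N. \<Sum>k=2..N. ln (real p) / real (p ^ k))"
    by (rule sum.cartesian_product[symmetric])
  also have "\<dots> \<le> (\<Sum>p=2..N. 2 * ln (real p) / real (p ^ 2))"
  proof (intro sum_mono)
    fix p assume p: "p \<in> {2..N}"
    define x where "x = 1 / real p"
    have x: "0 < x" "x \<le> 1/2" using p by (auto simp: x_def field_simps)
    \<comment> \<open>The subtracted term carries the induction: since 2x <= 1, it absorbs the next
      power.\<close>
    have "(\<Sum>k=2..N. x ^ k) \<le> 2 * x ^ 2 - 2 * x ^ (N + 1)" if "N \<ge> 1" for N
      using that
    proof (induction N rule: dec_induct)
      case (step n)
      have "x ^ (n + 1) * (2 * x) \<le> x ^ (n + 1) * 1" using x by (intro mult_left_mono) auto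
      with step show ?case by (simp add: algebra_simps)
    qed (simp add: power2_eq_square)
    moreover have "x ^ (N + 1) \<ge> 0" using x by simp
    ultimately have "(\<Sum>k=2..N. x ^ k) \<le> 2 * x ^ 2" using p by (smt (verit) atLeastAtMost_iff le_trans one_le_numeral)
    then have "ln (real p) * (\<Sum>k=2..N. x ^ k) \<le> ln (real p) * (2 * x ^ 2)"
      using p by (intro mult_left_mono) auto
    then show "(\<Sum>k=2..N. ln (real p) / real (p ^ k)) \<le> 2 * ln (real p) / real (p ^ 2)"
      by (simp add: x_def sum_distrib_left power_divide mult.commute)
  qed
  also have "\<dots> \<le> (\<Sum>p=2..N. 16 * (1 / sqrt (real (p - 1)) - 1 / sqrt (real p)))"
  proof (intro sum_mono)
    fix p assume p: "p \<in> {2..N}"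
    define a b where "a = sqrt (real (p - 1))" and "b = sqrt (real p)"
    have ab: "0 < a" "a \<le> b" "b * b = a * a + 1" "real p = b * b" using p by (auto simp: a_def b_def)
    have "ln (real p) \<le> 2 * b" using ln_le_2sqrt[of "real p"] p by (simp add: b_def)
    then have "2 * ln (real p) / real (p ^ 2) \<le> 2 * (2 * b) / real (p ^ 2)"
      by (intro divide_right_mono) auto
    also have "\<dots> = 4 / (b * b * b)" using ab(1,2) by (simp add: power2_eq_square ab(4))
    also have "\<dots> \<le> 16 * (1 / a - 1 / b)"
    proof -
      have "(b - a) * (b + a) = 1" using ab by (simp add: algebra_simps)
      then have "b - a = 1 / (b + a)" using ab by (simp add: field_simps)
      have "1 / a - 1 / b = (b - a) / (a * b)" using ab(1,2) by (simp add: field_simps)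
      also have "\<dots> = 1 / ((b + a) * a * b)" unfolding \<open>b - a = 1 / (b + a)\<close> by simp
      also have "\<dots> \<ge> 1 / ((b + b) * b * b)"
        using ab(1,2) by (intro divide_left_mono mult_mono) auto
      finally have "16 * (1 / ((b + b) * b * b)) \<le> 16 * (1 / a - 1 / b)" by simp
      moreover have "4 / (b * b * b) \<le> 16 * (1 / ((b + b) * b * b))" using ab(1,2) by (simp add: field_simps)
      ultimately show ?thesis by (rule order_trans[rotated])
    qed
    finally show "2 * ln (real p) / real (p ^ 2) \<le> 16 * (1 / sqrt (real (p - 1)) - 1 / sqrt (real p))"
      by (simp add: a_def b_def)
  qed
  also have "\<dots> = 16 * (\<Sum>p=2..N. (1 / sqrt (real (p - 1)) - 1 / sqrt (real p)))"
    by (simp only: sum_distrib_left)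
  also have "(\<Sum>p=2..N. (1 / sqrt (real (p - 1)) - 1 / sqrt (real p))) \<le> 1"
  proof (cases "N \<ge> 1")
    case True
    then have "(\<Sum>p=2..N. (1 / sqrt (real (p - 1)) - 1 / sqrt (real p))) = 1 - 1 / sqrt (real N)"
      by (induction N rule: dec_induct) auto
    then show ?thesis by simp
  qed simp
  finally show ?thesis by simp
qed

section \<open>Primes with prescribed values of real characters\<close>

lemma periodic_add_mult:
  fixes f :: "nat \<Rightarrow> 'a"
  assumes "\<And>n. f (n + M) = f n"
  shows "f (n + k * M) = f n"
proof (induction k)
  case (Suc k)
  have "f (n + Suc k * M) = f ((n + k * M) + M)" by (simp add: algebra_simps)
  with Suc assms show ?case by simp
qed simp

lemma periodic_mod:
  fixes f :: "nat \<Rightarrow> 'a"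
  assumes "\<And>n. f (n + M) = f n"
  shows "f (n mod M) = f n"
  using periodic_add_mult[of f M "n mod M" "n div M", OF assms] by simp

text \<open>Multiplication by \<open>b\<close> permutes the residues modulo \<open>M\<close>, so the
  sum over a period equals \<open>g b\<close> times itself and is 0. After full periods are removed,
  fewer than \<open>M\<close> terms remain.\<close>

lemma nonprincipal_partial_sums_bounded:
  fixes g :: "nat \<Rightarrow> real"
  assumes "M > 0" and mult: "\<And>m n. g (m * n) = g m * g n" and abs: "\<And>n. \<bar>g n\<bar> \<le> 1"
    and per: "\<And>n. g (n + M) = g n" and b: "coprime b M" "g b \<noteq> 1"
  shows "\<bar>\<Sum>n<x. g n\<bar> \<le> real M"
proof (induction x rule: less_induct)
  case (less x)
  have "inj_on (\<lambda>n. b * n mod M) {..<M}"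
  proof (rule inj_onI)
    fix m n assume "m \<in> {..<M}" "n \<in> {..<M}" "b * m mod M = b * n mod M"
    then have "[b * m = b * n] (mod M)" by (simp add: cong_def)
    then have "[m = n] (mod M)" using b cong_mult_lcancel_nat by blast
    then show "m = n" using \<open>m \<in> {..<M}\<close> \<open>n \<in> {..<M}\<close> by (simp add: cong_def)
  qed
  then have "bij_betw (\<lambda>n. b * n mod M) {..<M} {..<M}"
    using \<open>M > 0\<close> by (simp add: bij_betw_def endo_inj_surj image_subset_iff)
  then have "(\<Sum>n<M. g n) = (\<Sum>n<M. g (b * n mod M))"
    by (rule sum.reindex_bij_betw[symmetric])
  also have "\<dots> = g b * (\<Sum>n<M. g n)"
    by (simp add: periodic_mod[of g M, OF per] mult sum_distrib_left)
  finally have zero: "(\<Sum>n<M. g n) = 0" using b by simp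
  show ?case
  proof (cases "x < M")
    case True
    have "\<bar>\<Sum>n<x. g n\<bar> \<le> (\<Sum>n<x. \<bar>g n\<bar>)" by (rule sum_abs)
    also have "\<dots> \<le> (\<Sum>n<x. 1)" by (intro sum_mono abs)
    finally show ?thesis using True by simp
  next
    case False
    then have "(\<Sum>n<x. g n) = (\<Sum>n<M. g n) + (\<Sum>n\<in>{M..<x}. g n)"
      by (metis lessThan_atLeast0 linorder_not_less sum.atLeastLessThan_concat zero_le)
    also have "(\<Sum>n\<in>{M..<x}. g n) = (\<Sum>n<x - M. g (n + M))"
      using False sum.shift_bounds_nat_ivl[of g 0 M "x - M"] by (simp add: lessThan_atLeast0)
    finally have "(\<Sum>n<x. g n) = (\<Sum>n<x - M. g n)" by (simp add: zero per)
    then show ?thesis using less[of "x - M"] False \<open>M > 0\<close> by simp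
  qed
qed

lemma coprime_add_right_nat: "coprime (n + M) M \<longleftrightarrow> coprime n (M::nat)"
  by (metis coprime_iff_gcd_eq_1 gcd_add1)

text \<open>The classical argument for Dirichlet's theorem, with the products of the
  \<open>f i\<close> over subsets of \<open>I\<close> in place of all characters modulo
  \<open>M\<close>. If no prime has the prescribed values, the weight \<open>w\<close> vanishes at
  every prime, so its sum against mangoldt(n) / n is bounded; but the principal products force
  growth at least like ln N.\<close>

theorem prime_with_prescribed_real_characters:
  fixes f :: "'i \<Rightarrow> nat \<Rightarrow> real"
  assumes "finite I" "M > 0"
    and mult: "\<And>i m n. i \<in> I \<Longrightarrow> f i (m * n) = f i m * f i n"
    and one: "\<And>i. i \<in> I \<Longrightarrow> f i 1 = 1"
    and per: "\<And>i n. i \<in> I \<Longrightarrow> f i (n + M) = f i n"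
    and range: "\<And>i n. i \<in> I \<Longrightarrow> coprime n M \<Longrightarrow> f i n \<in> {-1, 1}"
    and n0: "coprime n\<^sub>0 M"
  shows "\<exists>q. prime q \<and> coprime q M \<and> (\<forall>i\<in>I. f i q = f i n\<^sub>0)"
proof (rule ccontr)
  assume contra: "\<not> ?thesis"
  define g where "g = (\<lambda>T n. if coprime n M then \<Prod>i\<in>T. f i n else 0)"
  have g_range: "g T n \<in> {-1, 0, 1}" if "T \<in> Pow I" for T n
  proof (cases "coprime n M")
    case True
    have "(\<Prod>i\<in>T. f i n) \<in> {-1, 1}"
    proof -
      from that \<open>finite I\<close> have "finite T" "T \<subseteq> I" by (auto intro: finite_subset)
      then show ?thesis
      proof (induction T rule: finite_induct)
        case (insert i T)
        then show ?case using range[of i n] True by auto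
      qed simp
    qed
    then show ?thesis by (auto simp: g_def)
  qed (simp add: g_def)
  have g_mult: "g T (m * n) = g T m * g T n" if "T \<in> Pow I" for T m n
  proof -
    have "(\<Prod>i\<in>T. f i (m * n)) = (\<Prod>i\<in>T. f i m) * (\<Prod>i\<in>T. f i n)"
      using that by (subst prod.distrib[symmetric]) (auto intro!: prod.cong simp: mult)
    then show ?thesis by (simp add: g_def)
  qed
  have g_one: "g T 1 = 1" if "T \<in> Pow I" for T
    unfolding g_def using that by (auto intro!: prod.neutral simp: one[unfolded One_nat_def])
  have g_per: "g T (n + M) = g T n" if "T \<in> Pow I" for T n
  proof -
    have "(\<Prod>i\<in>T. f i (n + M)) = (\<Prod>i\<in>T. f i n)" using that per by (intro prod.cong) auto
    then show ?thesis by (simp add: g_def coprime_add_right_nat)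
  qed

  define S where "S = (\<lambda>T N. \<Sum>n=1..N. g T n * mangoldt n / real n)"
  \<comment> \<open>Several \<open>T\<close> can give the principal character, since the
    \<open>f i\<close> may be multiplicatively dependent. All of them have value 1 at
    \<open>n\<^sub>0\<close>, so they reinforce the empty product instead of cancelling it.\<close>
  define P where "P = {T \<in> Pow I. \<forall>b. coprime b M \<longrightarrow> g T b = 1}"
  have "finite P" using \<open>finite I\<close> by (simp add: P_def)
  have "{} \<in> P" by (simp add: P_def g_def)
  have nonprincipal: "\<exists>C. \<forall>N. \<bar>S T N\<bar> \<le> C" if T: "T \<in> Pow I - P" for T
  proof -
    obtain b where b: "coprime b M" "g T b \<noteq> 1" using T by (auto simp: P_def)
    have abs: "\<bar>g T n\<bar> \<le> 1" for n using g_range[of T n] T by auto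
    interpret real_character "g T" "real M"
    proof
      show "\<bar>\<Sum>n<x. g T n\<bar> \<le> real M" for x
        using \<open>M > 0\<close> g_mult abs g_per b T by (intro nonprincipal_partial_sums_bounded) auto
    qed (use g_mult g_one g_range T in auto)
    show ?thesis using mangoldt_sum_bounded by (simp add: S_def)
  qed
  then obtain C where C: "\<And>T N. T \<in> Pow I - P \<Longrightarrow> \<bar>S T N\<bar> \<le> C T" by metis

  \<comment> \<open>A prime that is not coprime to \<open>M\<close> divides \<open>M\<close>, so
    \<open>D\<close> bounds the loss at primes. The number 17 below is 1 from
    \<open>mangoldt_sum_lower\<close> plus 16 for the n that are not prime.\<close>
  define D where "D = (\<Sum>n\<in>{n. n dvd M}. mangoldt n / real n :: real)"
  have principal: "S T N \<ge> ln (real N) - 17 - D" if "T \<in> P" "N \<ge> 1" for T N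
  proof -
    have "(\<Sum>n=1..N. mangoldt n / real n) \<le>
       (\<Sum>n=1..N. g T n * mangoldt n / real n + (if \<not> prime n then mangoldt n / real n else 0)
          + (if n dvd M then mangoldt n / real n else 0))"
    proof (intro sum_mono)
      fix n assume "n \<in> {1..N}"
      have nn: "0 \<le> (mangoldt n :: real) / real n" using mangoldt_nonneg by simp
      show "mangoldt n / real n \<le> g T n * mangoldt n / real n + (if \<not> prime n then mangoldt n / real n else 0)
          + (if n dvd M then mangoldt n / real n else 0)"
      proof (cases "coprime n M")
        case True
        with that(1) have "g T n = 1" by (simp add: P_def)
        then show ?thesis using nn by simp
      next
        case False
        then have "g T n = 0" "prime n \<Longrightarrow> n dvd M" by (auto simp: g_def intro: prime_imp_coprime)
        then show ?thesis using nn by auto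
      qed
    qed
    also have "\<dots> = S T N + (\<Sum>n\<in>{n\<in>{1..N}. \<not> prime n}. mangoldt n / real n)
        + (\<Sum>n\<in>{n\<in>{1..N}. n dvd M}. mangoldt n / real n)"
      by (simp only: S_def sum.distrib sum.inter_filter finite_atLeastAtMost)
    also have "(\<Sum>n\<in>{n\<in>{1..N}. n dvd M}. mangoldt n / real n) \<le> D"
      unfolding D_def using \<open>M > 0\<close> mangoldt_nonneg by (intro sum_mono2) auto
    finally show ?thesis using mangoldt_sum_lower[OF that(2)] sum_mangoldt_primes_diff[of N] by linarith
  qed

  \<comment> \<open>Up to the factor \<open>2 ^ card I\<close>, the indicator of those n coprime to
    \<open>M\<close> at which every \<open>f i\<close> has its prescribed value; the sum over
    \<open>T\<close> is the expanded product.\<close>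
  define w where "w = (\<lambda>n. \<Sum>T\<in>Pow I. g T n\<^sub>0 * g T n)"
  have w: "w n = (if coprime n M then \<Prod>i\<in>I. (1 + f i n\<^sub>0 * f i n) else 0)" for n
  proof (cases "coprime n M")
    case True
    have "w n = (\<Sum>T\<in>Pow I. \<Prod>i\<in>T. f i n\<^sub>0 * f i n)"
      using n0 True by (simp add: w_def g_def prod.distrib)
    also have "\<dots> = (\<Prod>i\<in>I. (1 + f i n\<^sub>0 * f i n))"
      using \<open>finite I\<close> prod_add[of I "\<lambda>i. f i n\<^sub>0 * f i n" "\<lambda>_. 1"]
      by (simp add: add.commute)
    finally show ?thesis using True by simp
  qed (simp add: w_def g_def)
  have w_le: "w n \<le> 2 ^ card I" for n
  proof -
    have "w n \<le> (\<Sum>T\<in>Pow I. 1)"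
      unfolding w_def
    proof (intro sum_mono)
      fix T assume "T \<in> Pow I"
      then show "g T n\<^sub>0 * g T n \<le> 1" using g_range[of T n\<^sub>0] g_range[of T n] by auto
    qed
    then show ?thesis using \<open>finite I\<close> by (simp add: card_Pow)
  qed
  have w_prime: "w q = 0" if "prime q" for q
  proof (cases "coprime q M")
    case True
    with contra that obtain i where i: "i \<in> I" "f i q \<noteq> f i n\<^sub>0" by auto
    then have "1 + f i n\<^sub>0 * f i q = 0" using range[OF i(1) n0] range[OF i(1) True] by auto
    with i \<open>finite I\<close> show ?thesis by (auto simp: w)
  qed (simp add: w)

  have upper: "(\<Sum>n=1..N. w n * mangoldt n / real n) \<le> 2 ^ card I * 16" for N
  proof -
    have "(\<Sum>n=1..N. w n * mangoldt n / real n) = (\<Sum>n\<in>{n\<in>{1..N}. \<not> prime n}. w n * mangoldt n / real n)"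
      using w_prime by (intro sum.mono_neutral_right) auto
    also have "\<dots> \<le> (\<Sum>n\<in>{n\<in>{1..N}. \<not> prime n}. 2 ^ card I * (mangoldt n / real n))"
      using w_le mangoldt_nonneg
      by (intro sum_mono) (metis divide_nonneg_nonneg mult_right_mono of_nat_0_le_iff times_divide_eq_right)
    also have "\<dots> = 2 ^ card I * (\<Sum>n\<in>{n\<in>{1..N}. \<not> prime n}. mangoldt n / real n)"
      by (simp only: sum_distrib_left)
    also have "\<dots> \<le> 2 ^ card I * 16"
      using sum_mangoldt_primes_diff by (intro mult_left_mono) auto
    finally show ?thesis .
  qed

  define K where "K = (\<Sum>T\<in>Pow I - P. C T)"
  have lower: "ln (real N) - 17 - D - K \<le> (\<Sum>n=1..N. w n * mangoldt n / real n)"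
    if N: "N \<ge> 1" "ln (real N) - 17 - D \<ge> 0" for N
  proof -
    have "(\<Sum>n=1..N. w n * mangoldt n / real n) = (\<Sum>n=1..N. \<Sum>T\<in>Pow I. g T n\<^sub>0 * (g T n * mangoldt n / real n))"
      by (simp add: w_def sum_distrib_right sum_divide_distrib mult.assoc)
    also have "\<dots> = (\<Sum>T\<in>Pow I. g T n\<^sub>0 * S T N)"
      by (subst sum.swap) (simp add: S_def sum_distrib_left)
    also have "\<dots> = (\<Sum>T\<in>Pow I - P. g T n\<^sub>0 * S T N) + (\<Sum>T\<in>P. g T n\<^sub>0 * S T N)"
      using \<open>finite I\<close> by (intro sum.subset_diff) (auto simp: P_def)
    also have "(\<Sum>T\<in>P. g T n\<^sub>0 * S T N) = (\<Sum>T\<in>P. S T N)"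
      using n0 by (intro sum.cong) (auto simp: P_def)
    finally have eq: "(\<Sum>n=1..N. w n * mangoldt n / real n) =
      (\<Sum>T\<in>Pow I - P. g T n\<^sub>0 * S T N) + (\<Sum>T\<in>P. S T N)" .
    have "- K \<le> (\<Sum>T\<in>Pow I - P. g T n\<^sub>0 * S T N)"
      unfolding K_def sum_negf[symmetric]
    proof (intro sum_mono)
      fix T assume T: "T \<in> Pow I - P"
      then have "\<bar>g T n\<^sub>0 * S T N\<bar> \<le> 1 * \<bar>S T N\<bar>"
        using g_range[of T n\<^sub>0] unfolding abs_mult by (intro mult_right_mono) auto
      then show "- C T \<le> g T n\<^sub>0 * S T N" using C[OF T, of N] by linarith
    qed
    moreover have "S {} N \<le> (\<Sum>T\<in>P. S T N)"
    proof (rule member_le_sum[OF \<open>{} \<in> P\<close> _ \<open>finite P\<close>])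
      show "0 \<le> S T N" if "T \<in> P - {{}}" for T using principal[of T N] that N by auto
    qed
    ultimately show ?thesis using principal[OF \<open>{} \<in> P\<close> N(1)] eq by linarith
  qed
  define Z where "Z = max (17 + D) (17 + D + K + 2 ^ card I * 16 + 1)"
  obtain N :: nat where N: "exp Z \<le> real N" using real_arch_simple by blast
  then have "N > 0" by (metis exp_gt_zero gr0I linorder_not_less of_nat_0)
  then have "Z \<le> ln (real N)" using N by (simp add: ln_ge_iff)
  then show False using lower[of N] upper[of N] \<open>N > 0\<close> by (simp add: Z_def)
qed

section \<open>Legendre's theorem on ternary forms\<close>

lemma int_sqrt_exists:
  assumes "(m::int) \<ge> 0"
  obtains x where "x \<ge> 0" "x\<^sup>2 \<le> m" "m < (x + 1)\<^sup>2"
proof -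
  define x where "x = \<lfloor>sqrt (real_of_int m)\<rfloor>"
  have 1: "real_of_int x \<le> sqrt (real_of_int m)" "sqrt (real_of_int m) < real_of_int x + 1"
    by (simp_all add: x_def)
  have "x \<ge> 0" using assms by (simp add: x_def)
  moreover have "(real_of_int x)\<^sup>2 \<le> (sqrt (real_of_int m))\<^sup>2"
    using 1 \<open>x \<ge> 0\<close> by (intro power_mono) auto
  then have "real_of_int (x\<^sup>2) \<le> real_of_int m" using assms by simp
  then have "x\<^sup>2 \<le> m" by linarith
  moreover have "(sqrt (real_of_int m))\<^sup>2 < (real_of_int x + 1)\<^sup>2"
    using 1 assms by (intro power_strict_mono) auto
  then have "real_of_int m < real_of_int ((x + 1)\<^sup>2)" using assms by simp
  then have "m < (x + 1)\<^sup>2" by linarith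
  ultimately show ?thesis using that by blast
qed

text \<open>A box with sides sqrt(bc), sqrt(ac), sqrt(ab) has more than abc integer points, so two
  of them agree under \<open>\<phi>\<close>. At their difference the form is divisible by abc and
  lies between -abc and 2abc, strictly because of \<open>nonsquare\<close>. This leaves the values 0
  and abc, and an identity reduces the second to the first.\<close>

theorem legendre_ternary:
  fixes a b c :: int
  assumes pos: "a > 0" "b > 0" "c > 0"
    and cop: "coprime a b" "coprime a c" "coprime b c"
    and r: "a dvd r\<^sup>2 - b * c" and s: "b dvd s\<^sup>2 - a * c" and t: "c dvd t\<^sup>2 + a * b"
    and nonsquare: "\<And>k. k\<^sup>2 \<noteq> a * b" "\<And>k. k\<^sup>2 \<noteq> b * c"
  obtains x y z where "(x, y, z) \<noteq> (0, 0, 0)" "a * x\<^sup>2 + b * y\<^sup>2 = c * z\<^sup>2"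
proof -
  obtain X where X: "X \<ge> 0" "X\<^sup>2 \<le> b * c" "b * c < (X + 1)\<^sup>2"
    using int_sqrt_exists[of "b * c"] pos by auto
  obtain Y where Y: "Y \<ge> 0" "Y\<^sup>2 \<le> a * c" "a * c < (Y + 1)\<^sup>2"
    using int_sqrt_exists[of "a * c"] pos by auto
  obtain Z where Z: "Z \<ge> 0" "Z\<^sup>2 \<le> a * b" "a * b < (Z + 1)\<^sup>2"
    using int_sqrt_exists[of "a * b"] pos by auto
  \<comment> \<open>Where the three residues vanish the form factors: modulo a, b times the form is
    (b y - r z)(b y + r z), and similarly modulo b and c.\<close>
  define \<phi> where "\<phi> = (\<lambda>(x, y, z). ((b * y - r * z) mod a, (a * x - s * z) mod b, (a * x - t * y) mod c))"
  define D where "D = {0..X} \<times> {0..Y} \<times> {0..Z}"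
  define R where "R = {0..<a} \<times> {0..<b} \<times> {0..<c}"
  have "(a * b * c)\<^sup>2 = (b * c) * (a * c) * (a * b)" by (simp add: power2_eq_square)
  also have "\<dots> < (X + 1)\<^sup>2 * (Y + 1)\<^sup>2 * (Z + 1)\<^sup>2"
  proof (rule mult_strict_mono)
    show "b * c * (a * c) < (X + 1)\<^sup>2 * (Y + 1)\<^sup>2"
    proof (rule mult_strict_mono)
      show "0 < (X + 1)\<^sup>2" using X(1) by simp
      show "0 \<le> a * c" using pos by simp
    qed (fact X Y)+
    show "0 < (X + 1)\<^sup>2 * (Y + 1)\<^sup>2" using X(1) Y(1) by simp
    show "0 \<le> a * b" using pos by simp
  qed (fact Z)
  also have "\<dots> = ((X + 1) * (Y + 1) * (Z + 1))\<^sup>2" by (simp only: power_mult_distrib)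
  finally have "(a * b * c)\<^sup>2 < ((X + 1) * (Y + 1) * (Z + 1))\<^sup>2" .
  then have "a * b * c < (X + 1) * (Y + 1) * (Z + 1)"
  proof (rule power2_less_imp_less)
    show "0 \<le> (X + 1) * (Y + 1) * (Z + 1)" using X(1) Y(1) Z(1) by simp
  qed
  then have "card R < card D"
    using X(1) Y(1) Z(1) pos unfolding R_def D_def card_cartesian_product
    by (simp add: nat_mult_distrib[symmetric] mult.assoc)
  moreover have "\<phi> ` D \<subseteq> R" "finite R" using pos by (auto simp: \<phi>_def R_def)
  ultimately have "\<not> inj_on \<phi> D" by (metis card_inj_on_le linorder_not_less)
  then obtain u v where uv: "u \<in> D" "v \<in> D" "u \<noteq> v" "\<phi> u = \<phi> v"
    unfolding inj_on_def by blast
  obtain x1 y1 z1 x2 y2 z2 where "u = (x1, y1, z1)" "v = (x2, y2, z2)" by (metis prod_cases3)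
  note uv = uv[unfolded this]
  define x y z where "x = x1 - x2" and "y = y1 - y2" and "z = z1 - z2"
  have nz: "(x, y, z) \<noteq> (0, 0, 0)" using uv(3) by (auto simp: x_def y_def z_def)
  have "a dvd b * y - r * z" "b dvd a * x - s * z" "c dvd a * x - t * y"
    using uv(4) by (simp_all add: \<phi>_def mod_eq_dvd_iff x_def y_def z_def algebra_simps)
  note lin = this
  have "\<bar>x\<bar> \<le> X" "\<bar>y\<bar> \<le> Y" "\<bar>z\<bar> \<le> Z" using uv(1,2) by (auto simp: D_def x_def y_def z_def)
  then have "x\<^sup>2 \<le> X\<^sup>2" "y\<^sup>2 \<le> Y\<^sup>2" "z\<^sup>2 \<le> Z\<^sup>2" by (simp_all add: abs_le_square_iff[symmetric])
  then have "x\<^sup>2 \<le> b * c" "y\<^sup>2 \<le> a * c" "z\<^sup>2 \<le> a * b" using X Y Z by linarith+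
  then have "x\<^sup>2 < b * c" "z\<^sup>2 < a * b" using nonsquare[of z] nonsquare(2)[of x] by linarith+
  then have bounds: "a * x\<^sup>2 < a * (b * c)" "b * y\<^sup>2 \<le> b * (a * c)" "c * z\<^sup>2 < c * (a * b)"
    using \<open>y\<^sup>2 \<le> a * c\<close> pos by simp_all
  define f where "f = a * x\<^sup>2 + b * y\<^sup>2 - c * z\<^sup>2"
  have "a dvd b * f"
  proof -
    have "b * f = (b * y - r * z) * (b * y + r * z) + (r\<^sup>2 - b * c) * z\<^sup>2 + a * (b * x\<^sup>2)"
      by (simp add: f_def power2_eq_square algebra_simps)
    with lin r show ?thesis by simp
  qed
  then have "a dvd f" using cop by (simp add: coprime_dvd_mult_right_iff)
  have "b dvd a * f"
  proof -
    have "a * f = (a * x - s * z) * (a * x + s * z) + (s\<^sup>2 - a * c) * z\<^sup>2 + b * (a * y\<^sup>2)"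
      by (simp add: f_def power2_eq_square algebra_simps)
    with lin s show ?thesis by simp
  qed
  then have "b dvd f" using cop by (simp add: coprime_dvd_mult_right_iff coprime_commute)
  have "c dvd a * f"
  proof -
    have "a * f = (a * x - t * y) * (a * x + t * y) + (t\<^sup>2 + a * b) * y\<^sup>2 - c * (a * z\<^sup>2)"
      by (simp add: f_def power2_eq_square algebra_simps)
    with lin t show ?thesis by simp
  qed
  then have "c dvd f" using cop by (simp add: coprime_dvd_mult_right_iff coprime_commute)
  have "a * b * c dvd f"
    using \<open>a dvd f\<close> \<open>b dvd f\<close> \<open>c dvd f\<close> cop by (intro divides_mult) auto
  then obtain k where k: "f = a * b * c * k" by auto
  have abc: "a * b * c > 0" using pos by simp
  have nn: "a * x\<^sup>2 \<ge> 0" "b * y\<^sup>2 \<ge> 0" "c * z\<^sup>2 \<ge> 0" using pos by simp_all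
  have assoc: "a * (b * c) = a * b * c" "b * (a * c) = a * b * c" "c * (a * b) = a * b * c"
    by (simp_all add: ac_simps)
  have "a * b * c * (-1) < f" "f < a * b * c * 2"
    using bounds nn unfolding assoc by (simp_all add: f_def)
  then have "a * b * c * (-1) < a * b * c * k" "a * b * c * k < a * b * c * 2" unfolding k .
  then have "-1 < k" "k < 2" using abc by (simp_all only: mult_less_cancel_left_pos)
  then consider "k = 0" | "k = 1" by linarith
  then show ?thesis
  proof cases
    case 1
    then show ?thesis using that[OF nz] k by (simp add: f_def)
  next
    case 2
    \<comment> \<open>From $ax^2+by^2 = c(z^2+ab)$ one gets $a(xz+by)^2+b(yz-ax)^2 = c(z^2+ab)^2$.\<close>
    have eq: "a * x\<^sup>2 + b * y\<^sup>2 = c * (z\<^sup>2 + a * b)" using k 2 by (simp add: f_def algebra_simps)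
    have "a * (x * z + b * y)\<^sup>2 + b * (y * z - a * x)\<^sup>2 = (a * x\<^sup>2 + b * y\<^sup>2) * (z\<^sup>2 + a * b)"
      by (simp add: power2_eq_square algebra_simps)
    also have "\<dots> = c * (z\<^sup>2 + a * b)\<^sup>2" by (simp only: eq power2_eq_square[of "z\<^sup>2 + a * b"] mult.assoc)
    finally have "a * (x * z + b * y)\<^sup>2 + b * (y * z - a * x)\<^sup>2 = c * (z\<^sup>2 + a * b)\<^sup>2" .
    moreover have "z\<^sup>2 + a * b > 0" using pos by (simp add: add_nonneg_pos)
    ultimately show ?thesis using that[of "x * z + b * y" "y * z - a * x" "z\<^sup>2 + a * b"] by auto
  qed
qed

section \<open>Legendre symbols: multiplicativity, the values at -1 and 2, non-residues\<close>

lemma Legendre_values: "Legendre a p \<in> {-1, 0, 1}"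
  by (auto simp: Legendre_def)

lemma Legendre_eq_if_cong:
  assumes "[Legendre a p = x] (mod int p)" "x \<in> {-1, 0, 1}" "p > 2"
  shows "Legendre a p = x"
proof -
  have "int p dvd Legendre a p - x" using assms(1) by (simp add: cong_iff_dvd_diff)
  moreover have "\<bar>Legendre a p - x\<bar> < int p"
    using Legendre_values[of a p] assms(2,3) by auto
  ultimately show ?thesis by (metis dvd_imp_le_int eq_iff_diff_eq_0 linorder_not_less abs_of_nat)
qed

lemma Legendre_mult:
  assumes "prime p" "p > 2"
  shows "Legendre (a * b) (int p) = Legendre a p * Legendre b p"
proof (rule Legendre_eq_if_cong)
  have "[Legendre (a * b) (int p) = (a * b) ^ ((p - 1) div 2)] (mod int p)"
    using assms by (rule euler_criterion)
  also have "[(a * b) ^ ((p - 1) div 2) = Legendre a p * Legendre b p] (mod int p)"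
    unfolding power_mult_distrib using assms by (intro cong_mult cong_sym[OF euler_criterion])
  finally show "[Legendre (a * b) (int p) = Legendre a p * Legendre b p] (mod int p)" .
  show "Legendre a p * Legendre b p \<in> {-1, 0, 1}"
    using Legendre_values[of a p] Legendre_values[of b p] by auto
qed (use assms in auto)

lemma Legendre_minus_1:
  assumes "prime p" "p > 2"
  shows "Legendre (-1) (int p) = (-1) ^ ((p - 1) div 2)"
proof (rule Legendre_eq_if_cong[OF euler_criterion])
  show "(-1) ^ ((p - 1) div 2) \<in> {-1, 0, 1 :: int}" by (cases "even ((p - 1) div 2)") auto
qed (use assms in auto)

lemma Legendre_cong: "[a = b] (mod p) \<Longrightarrow> Legendre a p = Legendre b p"
  by (simp add: Legendre_def QuadRes_def cong_def)

lemma Legendre_eq_1_D: "Legendre a p = 1 \<Longrightarrow> \<exists>r. p dvd r\<^sup>2 - a"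
  by (auto simp: Legendre_def QuadRes_def cong_iff_dvd_diff split: if_splits)

lemma Legendre_eq_0_iff: "Legendre a p = 0 \<longleftrightarrow> p dvd a"
  by (auto simp: Legendre_def cong_0_iff)

lemma Legendre_1: "prime p \<Longrightarrow> Legendre 1 (int p) = 1"
proof -
  assume "prime p"
  then have "\<not> int p dvd 1" using prime_gt_1_nat[of p] by auto
  moreover have "QuadRes p 1" unfolding QuadRes_def by (rule exI[of _ 1]) simp
  ultimately show ?thesis by (simp add: Legendre_def cong_0_iff)
qed

text \<open>Gauss's lemma: for p = 8k + 3, the doubles 2x that exceed (p-1)/2 = 4k+1 come from x =
  2k+1, ..., 4k+1, an odd number of them.\<close>

lemma Legendre_2:
  assumes "prime p" "p mod 8 = 3"
  shows "Legendre 2 (int p) = -1"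
proof -
  define k where "k = p div 8"
  have p: "p = 8 * k + 3" using assms(2) by (simp add: k_def) (metis mult_div_mod_eq)
  have ndvd: "\<not> int p dvd 2" using p by (auto dest!: zdvd_imp_le)
  interpret GAUSS p 2
    using assms p ndvd by unfold_locales (auto simp: cong_0_iff)
  have half: "(int p - 1) div 2 = 4 * int k + 1" using p by simp
  have "E = (\<lambda>x. 2 * x) ` {2 * int k + 1..4 * int k + 1}"
  proof
    show "E \<subseteq> (\<lambda>x. 2 * x) ` {2 * int k + 1..4 * int k + 1}"
    proof
      fix y assume "y \<in> E"
      then obtain x where x: "0 < x" "x \<le> 4 * int k + 1" "y = (x * 2) mod int p" "4 * int k + 1 < y"
        by (auto simp: E_def C_def B_def A_def half)
      moreover from x have "(x * 2) mod int p = x * 2" using p by (intro mod_pos_pos_trivial) auto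
      ultimately show "y \<in> (\<lambda>x. 2 * x) ` {2 * int k + 1..4 * int k + 1}" by auto
    qed
    show "(\<lambda>x. 2 * x) ` {2 * int k + 1..4 * int k + 1} \<subseteq> E"
    proof
      fix y assume "y \<in> (\<lambda>x. 2 * x) ` {2 * int k + 1..4 * int k + 1}"
      then obtain x where x: "2 * int k + 1 \<le> x" "x \<le> 4 * int k + 1" "y = x * 2" by auto
      then have "(x * 2) mod int p = x * 2" using p by (intro mod_pos_pos_trivial) auto
      moreover have "x \<in> A" using x by (simp add: A_def half)
      ultimately have "y \<in> C" unfolding C_def B_def using x by (metis image_eqI)
      with x show "y \<in> E" by (simp add: E_def half)
    qed
  qed
  moreover have "inj_on (\<lambda>x. 2 * x) {2 * int k + 1..4 * int k + 1}" by (auto simp: inj_on_def)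
  ultimately have "card E = 2 * k + 1" by (simp add: card_image)
  then show ?thesis using gauss_lemma by simp
qed

text \<open>Otherwise squaring would be onto, hence injective, on the residues modulo p; but 1 and p
  - 1 have the same square.\<close>

lemma quadratic_nonresidue_exists:
  assumes "prime p" "p > 2"
  shows "\<exists>a. Legendre a (int p) = -1"
proof (rule ccontr)
  assume contra: "\<not> ?thesis"
  define sq where "sq = (\<lambda>y::int. y\<^sup>2 mod int p)"
  have surj: "{0..<int p} \<subseteq> sq ` {0..<int p}"
  proof
    fix a assume a: "a \<in> {0..<int p}"
    have "Legendre a p \<noteq> -1" using contra by blast
    then consider "a = 0" | "QuadRes p a" using a by (auto simp: Legendre_def cong_def split: if_splits)
    then show "a \<in> sq ` {0..<int p}"
    proof cases
      case 1
      with assms show ?thesis by (intro image_eqI[of _ _ 0]) (auto simp: sq_def)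
    next
      case 2
      then obtain y where "y\<^sup>2 mod int p = a" using a by (auto simp: QuadRes_def cong_def)
      then have "sq (y mod int p) = a" by (simp add: sq_def power_mod)
      with assms show ?thesis by (intro image_eqI[of _ _ "y mod int p"]) auto
    qed
  qed
  then have "card {0..<int p} \<le> card (sq ` {0..<int p})" by (intro card_mono) auto
  then have "inj_on sq {0..<int p}"
    by (intro eq_card_imp_inj_on antisym card_image_le) auto
  moreover have "sq 1 = sq (int p - 1)"
  proof -
    have "(int p - 1)\<^sup>2 = 1 + int p * (int p - 2)" by (simp add: power2_eq_square algebra_simps)
    then show ?thesis by (simp add: sq_def)
  qed
  ultimately show False using assms by (auto dest!: inj_onD[of _ _ 1 "int p - 1"])
qed

section \<open>Hilbert symbols over a field with inert primes\<close>

locale complex_subfield =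
  fixes K :: "complex set"
  assumes zero: "0 \<in> K" and one: "1 \<in> K"
    and add: "\<And>a b. a \<in> K \<Longrightarrow> b \<in> K \<Longrightarrow> a + b \<in> K"
    and mult: "\<And>a b. a \<in> K \<Longrightarrow> b \<in> K \<Longrightarrow> a * b \<in> K"
    and uminus: "\<And>a. a \<in> K \<Longrightarrow> - a \<in> K"
    and inverse: "\<And>a. a \<in> K \<Longrightarrow> inverse a \<in> K"
begin

lemma diff: "a \<in> K \<Longrightarrow> b \<in> K \<Longrightarrow> a - b \<in> K"
  using add[of a "- b"] uminus[of b] by simp

lemma divide: "a \<in> K \<Longrightarrow> b \<in> K \<Longrightarrow> a / b \<in> K"
  using mult[of a "inverse b"] inverse[of b] by (simp add: field_simps)

lemma of_nat: "of_nat n \<in> K"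
  by (induction n) (auto simp: zero one add)

lemma of_int: "of_int n \<in> K"
  by (cases n) (auto simp: of_nat intro: uminus diff one simp del: of_nat_Suc)

lemma Rats: "a \<in> \<rat> \<Longrightarrow> a \<in> K"
  by (elim Rats_cases') (simp add: divide of_int)

lemma numeral: "numeral n \<in> K"
  using of_nat[of "numeral n"] by simp

lemma power: "a \<in> K \<Longrightarrow> a ^ n \<in> K"
  by (induction n) (auto simp: one mult)

lemma sum: "(\<And>i. i \<in> A \<Longrightarrow> f i \<in> K) \<Longrightarrow> (\<Sum>i\<in>A. f i) \<in> K"
  by (induction A rule: infinite_finite_induct) (auto simp: zero add)

lemmas closed = zero one add mult uminus inverse diff divide of_nat of_int numeral power

text \<open>\<open>rep a b\<close> says that \<open>b\<close> is a norm from \<open>K(\<surd>a)\<close>, i.e. that the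
  Hilbert symbol \<open>(a, b)\<close> over \<open>K\<close> is trivial.\<close>

definition rep :: "complex \<Rightarrow> complex \<Rightarrow> bool" where
  "rep a b \<longleftrightarrow> (\<exists>x\<in>K. \<exists>y\<in>K. b = x\<^sup>2 - a * y\<^sup>2)"

lemma repI: "x \<in> K \<Longrightarrow> y \<in> K \<Longrightarrow> b = x\<^sup>2 - a * y\<^sup>2 \<Longrightarrow> rep a b"
  by (auto simp: rep_def)

lemma rep_one: "rep a 1"
  by (rule repI[of 1 0]) (auto intro: closed)

lemma rep_uminus_self: "rep a (- a)"
  by (rule repI[of 0 1]) (auto intro: closed)

lemma rep_mult:
  assumes "a \<in> K" "rep a b" "rep a c"
  shows "rep a (b * c)"
proof -
  from assms obtain x y u v where "x \<in> K" "y \<in> K" "u \<in> K" "v \<in> K"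
    and bc: "b = x\<^sup>2 - a * y\<^sup>2" "c = u\<^sup>2 - a * v\<^sup>2" by (auto simp: rep_def)
  moreover have "b * c = (x * u + a * y * v)\<^sup>2 - a * (x * v + y * u)\<^sup>2"
    unfolding bc by (simp add: power2_eq_square algebra_simps)
  ultimately show ?thesis using \<open>a \<in> K\<close> by (intro repI) (auto intro: closed)
qed

lemma rep_inverse:
  assumes "b \<in> K" "rep a b"
  shows "rep a (inverse b)"
proof -
  from assms obtain x y where "x \<in> K" "y \<in> K" and b: "b = x\<^sup>2 - a * y\<^sup>2" by (auto simp: rep_def)
  moreover have "inverse b = (x / b)\<^sup>2 - a * (y / b)\<^sup>2"
  proof (cases "b = 0")
    case False
    have "(x / b)\<^sup>2 - a * (y / b)\<^sup>2 = (x\<^sup>2 - a * y\<^sup>2) / b\<^sup>2"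
      by (simp add: power_divide diff_divide_distrib)
    also have "\<dots> = b / b\<^sup>2" by (simp only: b[symmetric])
    also have "\<dots> = inverse b" using False by (simp add: power2_eq_square field_simps)
    finally show ?thesis ..
  qed simp
  ultimately show ?thesis using \<open>b \<in> K\<close> by (intro repI[of "x / b" "y / b"]) (auto intro: closed)
qed

text \<open>When \<open>a\<close> is a square, \<open>x\<^sup>2 - a y\<^sup>2\<close> is a hyperbolic plane and represents everything.\<close>

lemma rep_square:
  assumes "b \<in> K" "x \<in> K" "x \<noteq> 0"
  shows "rep (x\<^sup>2) b"
proof (rule repI[of "(b + 1) / 2" "(b - 1) / (2 * x)"])
  have "x\<^sup>2 * ((b - 1) / (2 * x))\<^sup>2 = ((b - 1) / 2)\<^sup>2"
    using assms by (simp add: power_divide power_mult_distrib)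
  then show "b = ((b + 1) / 2)\<^sup>2 - x\<^sup>2 * ((b - 1) / (2 * x))\<^sup>2"
    by (simp add: power2_eq_square field_simps)
qed (use assms in \<open>auto intro: closed\<close>)

text \<open>A zero with z = 0 makes \<open>a\<close> a square, and then everything is represented;
  otherwise divide by z.\<close>

lemma rep_if_isotropic:
  assumes "a \<in> K" "b \<in> K" "a \<noteq> 0" "x \<in> K" "y \<in> K" "z \<in> K"
    "x \<noteq> 0 \<or> y \<noteq> 0 \<or> z \<noteq> 0" "x\<^sup>2 = a * y\<^sup>2 + b * z\<^sup>2"
  shows "rep a b"
proof (cases "z = 0")
  case True
  then have "x\<^sup>2 = a * y\<^sup>2" using assms by simp
  then have "y \<noteq> 0" using assms True by auto
  with \<open>x\<^sup>2 = a * y\<^sup>2\<close> have "a = (x / y)\<^sup>2" by (simp add: power_divide)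
  moreover have "x / y \<noteq> 0" using \<open>a \<noteq> 0\<close> calculation by auto
  ultimately show ?thesis using assms by (auto intro!: rep_square closed)
next
  case False
  have "b * z\<^sup>2 = x\<^sup>2 - a * y\<^sup>2" using assms by simp
  then have "b = (x / z)\<^sup>2 - a * (y / z)\<^sup>2"
    using False by (simp add: power_divide field_simps)
  then show ?thesis using assms by (intro repI[of "x / z" "y / z"]) (auto intro: closed)
qed

text \<open>Both relations amount to a nontrivial zero of x^2 - a y^2 - b z^2, in which a and b are
  interchangeable.\<close>

lemma rep_sym:
  assumes "a \<in> K" "b \<in> K" "b \<noteq> 0" "rep a b"
  shows "rep b a"
proof -
  from assms obtain x y where xy: "x \<in> K" "y \<in> K" "b = x\<^sup>2 - a * y\<^sup>2" by (auto simp: rep_def)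
  then have "x \<noteq> 0 \<or> y \<noteq> 0" using \<open>b \<noteq> 0\<close> by auto
  then show ?thesis
    using xy assms by - (rule rep_if_isotropic[of b a x 1 y], auto intro: closed)
qed

inductive_set gen :: "complex set \<Rightarrow> complex set" for S where
  gen_base: "a \<in> S \<Longrightarrow> a \<in> gen S"
| gen_one: "1 \<in> gen S"
| gen_mult: "a \<in> gen S \<Longrightarrow> b \<in> gen S \<Longrightarrow> a * b \<in> gen S"
| gen_inverse: "a \<in> gen S \<Longrightarrow> inverse a \<in> gen S"

lemma gen_closed: "a \<in> gen S \<Longrightarrow> S \<subseteq> K - {0} \<Longrightarrow> a \<in> K - {0}"
  by (induction rule: gen.induct) (auto intro: closed)

text \<open>The nonzero values represented for a fixed first argument form a group, so generators
  suffice in the second argument; symmetry transfers this to the first.\<close>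

lemma rep_gen:
  assumes S: "S \<subseteq> K - {0}" and base: "\<And>a b. a \<in> S \<Longrightarrow> b \<in> S \<Longrightarrow> rep a b"
    and "a \<in> gen S" "b \<in> gen S"
  shows "rep a b"
proof -
  have 1: "rep a b" if "a \<in> K" "\<And>b. b \<in> S \<Longrightarrow> rep a b" "b \<in> gen S" for a b
    using that(3)
  proof (induction rule: gen.induct)
    case (gen_inverse b)
    then show ?case using gen_closed[OF _ S] by (intro rep_inverse) auto
  qed (use that in \<open>auto intro: rep_one rep_mult\<close>)
  have "rep b a" if "b \<in> S" for b
    using that S base by (intro 1[OF _ _ assms(3)]) auto
  then have "rep a b" if "b \<in> S" for b
    using that S gen_closed[OF assms(3) S] by (intro rep_sym[of b a]) auto
  then show ?thesis using gen_closed[OF assms(3) S] by (intro 1[OF _ _ assms(4)]) auto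
qed

end

text \<open>The prime p would occur in the square exactly once.\<close>

lemma nonsquare_prime_mult:
  assumes "prime p" "\<not> int p dvd m"
  shows "(k::int)\<^sup>2 \<noteq> int p * m"
proof
  assume eq: "k\<^sup>2 = int p * m"
  then have "int p dvd k\<^sup>2" by simp
  then have "int p dvd k" using assms(1) prime_dvd_power_int_iff[of "int p" 2 k] by simp
  then obtain j where "k = int p * j" by auto
  then have "int p * (int p * j\<^sup>2) = int p * m" using eq by (simp add: power2_eq_square ac_simps)
  moreover have "int p \<noteq> 0" using assms(1) by (auto dest: prime_gt_0_nat)
  ultimately have "m = int p * j\<^sup>2" by simp
  with assms(2) show False by simp
qed

lemma prime_dvd_prime_int: "prime p \<Longrightarrow> prime q \<Longrightarrow> int p dvd int q \<longleftrightarrow> p = q"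
  by (auto simp: primes_dvd_imp_eq)

lemma Legendre_pm1: "prime p \<Longrightarrow> prime q \<Longrightarrow> p \<noteq> q \<Longrightarrow> Legendre (int q) (int p) \<in> {-1, 1}"
  using Legendre_values[of "int q" "int p"] Legendre_eq_0_iff[of "int q" "int p"] prime_dvd_prime_int[of p q] by auto

locale inert_subfield = complex_subfield +
  fixes q :: nat and s :: complex
  assumes s_in: "s \<in> K" and s_sq: "s\<^sup>2 = - of_nat q" and q: "prime q" "q mod 8 = 3"
begin

text \<open>The condition says (-q/p) = -1, so p is inert in Q(sqrt(-q)). The symbols of q and -1
  are kept apart because they enter the solvability conditions separately.\<close>

definition inert :: "nat \<Rightarrow> bool" where
  "inert p \<longleftrightarrow> prime p \<and> p > 2 \<and> p \<noteq> q \<and> Legendre (int q) (int p) = - Legendre (-1) (int p)"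

lemma q_gt_2: "q > 2" and q_odd: "odd q"
proof -
  have "q \<noteq> 2" using q(2) by auto
  then show "q > 2" using prime_ge_2_nat[OF q(1)] by linarith
  then show "odd q" using q(1) prime_odd_nat by blast
qed

lemma Legendre_minus_1_q: "Legendre (-1) (int q) = -1"
proof -
  have "odd ((q - 1) div 2)"
  proof -
    obtain k where "q = 8 * k + 3" using q(2) by (metis mult_div_mod_eq)
    then show ?thesis by simp
  qed
  then show ?thesis using Legendre_minus_1[OF q(1) q_gt_2] by simp
qed

lemma Legendre_2_q: "Legendre 2 (int q) = -1"
  using q by (rule Legendre_2)

lemma inertD:
  assumes "inert p"
  shows "prime p" "p > 2" "p \<noteq> q" "odd p" "Legendre (int q) (int p) = - Legendre (-1) (int p)"
  using assms prime_odd_nat by (auto simp: inert_def)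

lemma Legendre_minus_1_pm1: "inert p \<Longrightarrow> Legendre (-1) (int p) \<in> {-1, 1}"
  using Legendre_minus_1[of p] inertD by (cases "even ((p - 1) div 2)") auto

text \<open>As q = 3 mod 4, reciprocity reads (p/q)(q/p) = (-1/p).\<close>

lemma Legendre_q:
  assumes "inert p"
  shows "Legendre (int p) (int q) = -1"
proof -
  note p = inertD[OF assms]
  have "odd ((q - 1) div 2)" using Legendre_minus_1_q Legendre_minus_1[OF q(1) q_gt_2]
    by (metis neg_one_even_power neg_one_odd_power one_neq_neg_one)
  then have "(-1::int) ^ ((p - 1) div 2 * ((q - 1) div 2)) = (-1) ^ ((p - 1) div 2)"
    by (metis mult.commute neg_one_odd_power power_mult)
  then have "Legendre p q * Legendre q p = Legendre (-1) p"
    using Quadratic_Reciprocity[OF p(1,2) q(1) q_gt_2 p(3)] Legendre_minus_1[OF p(1,2)] by simp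
  then show ?thesis using p(5) Legendre_minus_1_pm1[OF assms] by auto
qed

lemma ternary_to_complex:
  fixes a b c x y z :: int
  assumes "a * x\<^sup>2 + b * y\<^sup>2 = c * z\<^sup>2"
  shows "of_int a * (of_int x)\<^sup>2 + of_int b * (of_int y)\<^sup>2 = (of_int c * (of_int z)\<^sup>2 :: complex)"
proof -
  have "of_int (a * x\<^sup>2 + b * y\<^sup>2) = (of_int (c * z\<^sup>2) :: complex)" using assms by (rule arg_cong)
  then show ?thesis by simp
qed

lemma rep_from_ternary_1:
  fixes b c x y z :: int
  assumes "1 * x\<^sup>2 + b * y\<^sup>2 = c * z\<^sup>2" "(x, y, z) \<noteq> (0, 0, 0)" "b \<noteq> 0"
  shows "rep (- of_int b) (of_int c)"
  using ternary_to_complex[OF assms(1)] assms(2,3)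
  by (intro rep_if_isotropic[of _ _ "of_int x" "of_int y" "of_int z"])
    (auto intro: closed simp: algebra_simps)

text \<open>In K, q x^2 = -(s x)^2, so a coefficient q can be traded for a sign.\<close>

lemma rep_from_ternary_q:
  fixes b c x y z :: int
  assumes "int q * x\<^sup>2 + b * y\<^sup>2 = c * z\<^sup>2" "(x, y, z) \<noteq> (0, 0, 0)" "b \<noteq> 0"
  shows "rep (of_int b) (- of_int c)"
proof (rule rep_if_isotropic[of _ _ "s * of_int x" "of_int y" "of_int z"])
  show "(s * of_int x)\<^sup>2 = of_int b * (of_int y)\<^sup>2 + - of_int c * (of_int z)\<^sup>2"
    using ternary_to_complex[OF assms(1)] by (simp add: power_mult_distrib s_sq algebra_simps)
  show "s * of_int x \<noteq> 0 \<or> of_int y \<noteq> (0::complex) \<or> of_int z \<noteq> (0::complex)"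
    using assms(2) s_sq q_gt_2 by auto
qed (use assms s_in in \<open>auto intro: closed\<close>)

lemma rep_2_minus_1: "rep (-1) 2" "rep 2 (-1)"
  by (rule repI[of 1 1], auto intro: closed) (rule repI[of 1 1], auto intro: closed)

lemma rep_2_2: "rep 2 2"
  by (rule repI[of 2 1], auto intro: closed)

lemma coprime_primes_int: "prime p \<Longrightarrow> prime p' \<Longrightarrow> p \<noteq> p' \<Longrightarrow> coprime (int p) (int p')"
  by (simp add: primes_coprime)

text \<open>Since q = 3 mod 8, (-2/q) = 1 and x^2 + 2 y^2 = q z^2 is solvable. Inserting q = -s^2
  trivialises the symbol (-1, -2), and (-1, 2) is trivial because 2 = 1 + 1.\<close>

lemma rep_minus_1_minus_1: "rep (-1) (-1)"
proof -
  have "Legendre (-1 * 2) (int q) = 1"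
    unfolding Legendre_mult[OF q(1) q_gt_2] by (simp add: Legendre_2_q Legendre_minus_1_q)
  then obtain t where t: "int q dvd t\<^sup>2 - (- 2)" using Legendre_eq_1_D by fastforce
  obtain x y z where "(x, y, z) \<noteq> (0, 0, 0)" "1 * x\<^sup>2 + 2 * y\<^sup>2 = int q * z\<^sup>2"
  proof (rule legendre_ternary[of 1 2 "int q" 0 1 t])
    show "k\<^sup>2 \<noteq> 1 * 2" for k :: int using nonsquare_prime_mult[of 2 1 k] by simp
    show "k\<^sup>2 \<noteq> 2 * int q" for k :: int using nonsquare_prime_mult[of 2 "int q" k] q_odd by simp
  qed (use t q_odd q_gt_2 in auto)
  note xyz = this ternary_to_complex[OF this(2)]
  have "rep (-1) (-2)"
  proof (rule rep_if_isotropic[of _ _ "of_int x" "s * of_int z" "of_int y"])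
    show "(of_int x)\<^sup>2 = -1 * (s * of_int z)\<^sup>2 + -2 * (of_int y :: complex)\<^sup>2"
      using xyz(3) by (simp add: power_mult_distrib s_sq algebra_simps)
    show "of_int x \<noteq> (0::complex) \<or> s * of_int z \<noteq> 0 \<or> of_int y \<noteq> (0::complex)"
      using xyz(1) s_sq q_gt_2 by auto
  qed (use s_in in \<open>auto intro: closed\<close>)
  moreover have "rep (-1) (inverse 2)"
    using rep_2_minus_1 by - (rule rep_inverse, auto intro: closed)
  ultimately have "rep (-1) (- 2 * inverse 2)"
    by - (rule rep_mult, auto intro: closed)
  then show ?thesis by simp
qed

lemma rep_uminus_right:
  assumes "rep a (- b)" "rep (-1) a" "a \<in> K" "a \<noteq> 0"
  shows "rep a b"
proof -
  have "rep a (-1)" using assms by - (rule rep_sym, auto intro: closed)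
  then show ?thesis using rep_mult[of a "- b" "-1"] assms by simp
qed

lemma Legendre_mult3:
  assumes "prime p" "p > 2"
  shows "Legendre (a * b * c) (int p) = Legendre a p * Legendre b p * Legendre c p"
  using assms by (simp add: Legendre_mult)

text \<open>If (2/p) = 1, then 2 x^2 + p y^2 = z^2 is solvable. Otherwise (2p/q) = 1 and (-2q/p) =
  1, so q x^2 + 2 y^2 = p z^2 is solvable; this gives the symbol (2, -p), and (2, -1) is
  trivial.\<close>

lemma rep_2_inert:
  assumes "inert p"
  shows "rep 2 (of_nat p)"
proof -
  note p = inertD[OF assms]
  have ndvd: "\<not> int p dvd 2" using p(2) by (auto dest: zdvd_imp_le)
  then have "Legendre 2 (int p) \<in> {-1, 1}" using Legendre_values[of 2 p] Legendre_eq_0_iff[of 2 p] by auto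
  then consider "Legendre 2 (int p) = 1" | "Legendre 2 (int p) = -1" by auto
  then show ?thesis
  proof cases
    case 1
    then obtain t where t: "int p dvd t\<^sup>2 - 2" using Legendre_eq_1_D by blast
    obtain x y z where "(x, y, z) \<noteq> (0, 0, 0)" "2 * x\<^sup>2 + int p * y\<^sup>2 = 1 * z\<^sup>2"
    proof (rule legendre_ternary[of 2 "int p" 1 1 t 0])
      show "k\<^sup>2 \<noteq> 2 * int p" for k :: int using nonsquare_prime_mult[of 2 "int p" k] p by simp
      show "k\<^sup>2 \<noteq> int p * 1" for k :: int using nonsquare_prime_mult[of p 1 k] p by simp
    qed (use t p in auto)
    then show ?thesis using ternary_to_complex[of 2 x "int p" y 1 z]
      by - (rule rep_if_isotropic[of _ _ "of_int z" "of_int x" "of_int y"], auto intro: closed)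
  next
    case 2
    have "Legendre (2 * int p) (int q) = 1"
      using Legendre_mult[OF q(1) q_gt_2] Legendre_2_q Legendre_q[OF assms] by simp
    then obtain u where u: "int q dvd u\<^sup>2 - 2 * int p" using Legendre_eq_1_D by blast
    have "Legendre (-1 * 2 * int q) (int p) = 1"
      unfolding Legendre_mult3[OF p(1,2)] using 2 p(5) Legendre_minus_1_pm1[OF assms] by auto
    then obtain t where t: "int p dvd t\<^sup>2 - (- 1 * 2 * int q)" using Legendre_eq_1_D by blast
    obtain x y z where xyz: "(x, y, z) \<noteq> (0, 0, 0)" "int q * x\<^sup>2 + 2 * y\<^sup>2 = int p * z\<^sup>2"
    proof (rule legendre_ternary[of "int q" 2 "int p" u 1 t])
      show "k\<^sup>2 \<noteq> int q * 2" for k :: int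
        using nonsquare_prime_mult[of 2 "int q" k] q_odd by (simp add: mult.commute)
      show "k\<^sup>2 \<noteq> 2 * int p" for k :: int using nonsquare_prime_mult[of 2 "int p" k] p by simp
    qed (use t u p q_odd q_gt_2 coprime_primes_int[OF q(1) p(1)] in \<open>auto simp: mult.commute\<close>)
    have "rep 2 (- of_nat p)" using rep_from_ternary_q[OF xyz(2,1)] by simp
    then show ?thesis using rep_2_minus_1 by - (rule rep_uminus_right, auto intro: closed)
  qed
qed

text \<open>It suffices to treat (p, -2), since (p, 2) is known. If (-2/p) = 1, use x^2 + 2 y^2 = p
  z^2; otherwise (2q/p) = -(-2/p) = 1, and q x^2 + p y^2 = 2 z^2 is solvable.\<close>

lemma rep_minus_1_inert:
  assumes "inert p"
  shows "rep (-1) (of_nat p)"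
proof -
  note p = inertD[OF assms]
  have ndvd: "\<not> int p dvd 2" using p(2) by (auto dest: zdvd_imp_le)
  have *: "Legendre (-1 * 2) (int p) \<in> {-1, 1}"
    using Legendre_values[of "-1 * 2" p] Legendre_eq_0_iff[of "-1 * 2" p] ndvd by auto
  have "rep (of_nat p) (- 2)"
  proof (cases "Legendre (-1 * 2) (int p) = 1")
    case True
    then obtain t where t: "int p dvd t\<^sup>2 - -1 * 2" using Legendre_eq_1_D by blast
    obtain x y z where xyz: "(x, y, z) \<noteq> (0, 0, 0)" "1 * x\<^sup>2 + 2 * y\<^sup>2 = int p * z\<^sup>2"
    proof (rule legendre_ternary[of 1 2 "int p" 0 1 t])
      show "k\<^sup>2 \<noteq> 1 * 2" for k :: int using nonsquare_prime_mult[of 2 1 k] by simp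
      show "k\<^sup>2 \<noteq> 2 * int p" for k :: int using nonsquare_prime_mult[of 2 "int p" k] p by simp
    qed (use t p in auto)
    have "rep (- 2) (of_nat p)" using rep_from_ternary_1[OF xyz(2,1)] by simp
    then show ?thesis using p by - (rule rep_sym, auto intro: closed)
  next
    case False
    with * have L: "Legendre (-1 * 2) (int p) = -1" by auto
    have "Legendre (2 * int p) (int q) = 1"
      using Legendre_mult[OF q(1) q_gt_2] Legendre_2_q Legendre_q[OF assms] by simp
    then obtain u where u: "int q dvd u\<^sup>2 - 2 * int p" using Legendre_eq_1_D by blast
    have "Legendre (2 * int q) (int p) = 1"
      using L p(5) Legendre_minus_1_pm1[OF assms] unfolding Legendre_mult[OF p(1,2)] by auto
    then obtain t where t: "int p dvd t\<^sup>2 - 2 * int q" using Legendre_eq_1_D by blast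
    obtain x y z where xyz: "(x, y, z) \<noteq> (0, 0, 0)" "int q * x\<^sup>2 + int p * y\<^sup>2 = 2 * z\<^sup>2"
    proof (rule legendre_ternary[of "int q" "int p" 2 u t 1])
      show "k\<^sup>2 \<noteq> int q * int p" for k :: int
        using nonsquare_prime_mult[of q "int p" k] prime_dvd_prime_int[OF q(1) p(1)] q p by simp
      show "k\<^sup>2 \<noteq> int p * 2" for k :: int
        using nonsquare_prime_mult[of 2 "int p" k] p by (simp add: mult.commute)
    qed (use t u p q_odd q_gt_2 coprime_primes_int[OF q(1) p(1)] in \<open>auto simp: mult.commute\<close>)
    show ?thesis using rep_from_ternary_q[OF xyz(2,1)] p by simp
  qed
  moreover have "rep (of_nat p) 2"
    using rep_2_inert[OF assms] p by - (rule rep_sym, auto intro: closed)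
  then have "rep (of_nat p) (inverse 2)" by - (rule rep_inverse, auto intro: closed)
  ultimately have "rep (of_nat p) (- 2 * inverse 2)" by - (rule rep_mult, auto intro: closed)
  then show ?thesis using p by - (rule rep_sym, auto intro: closed)
qed

text \<open>The mutual symbols of the two primes decide which form is solvable: without -1 or q if
  both are 1, with a change of sign if they differ, with the coefficient q if both are -1.\<close>

lemma rep_inert_inert:
  assumes "inert p" "inert p'" "p \<noteq> p'"
  shows "rep (of_nat p) (of_nat p')"
proof -
  note p = inertD[OF assms(1)] and p' = inertD[OF assms(2)]
  have pm: "Legendre p' p \<in> {-1, 1}" "Legendre p p' \<in> {-1, 1}"
    using Legendre_pm1 p(1) p'(1) assms(3) by auto
  note Lq = Legendre_q[OF assms(1)] Legendre_q[OF assms(2)]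
  note cop = coprime_primes_int[OF p(1) p'(1) assms(3)] coprime_primes_int[OF q(1) p(1)] coprime_primes_int[OF q(1) p'(1)]
  note nd = prime_dvd_prime_int[OF p(1) p'(1)] prime_dvd_prime_int[OF q(1) p(1)] prime_dvd_prime_int[OF p'(1) p(1)]
  have sym: "rep (of_nat n) (of_nat m)" if "rep (of_nat m) (of_nat n)" "inert n" for m n
    using that inertD[of n] by - (rule rep_sym, auto intro: closed)
  have qr: "Legendre p p' * Legendre p' p = (-1) ^ ((p - 1) div 2 * ((p' - 1) div 2))"
    using Quadratic_Reciprocity p p' assms(3) by simp
  note m1 = Legendre_minus_1[OF p(1,2)] Legendre_minus_1[OF p'(1,2)]
  have both_1: ?thesis if L: "Legendre p p' = 1" "Legendre p' p = 1"
  proof -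
    from L obtain t u where tu: "int p dvd t\<^sup>2 - int p'" "int p' dvd u\<^sup>2 - int p" using Legendre_eq_1_D by metis
    obtain x y z where xyz: "(x, y, z) \<noteq> (0, 0, 0)" "int p * x\<^sup>2 + int p' * y\<^sup>2 = 1 * z\<^sup>2"
    proof (rule legendre_ternary[of "int p" "int p'" 1 t u 0])
      show "k\<^sup>2 \<noteq> int p * int p'" for k :: int using nonsquare_prime_mult[of p "int p'" k] nd p assms(3) by simp
      show "k\<^sup>2 \<noteq> int p' * 1" for k :: int using nonsquare_prime_mult[of p' 1 k] p' by simp
    qed (use tu cop p p' in auto)
    then show ?thesis using ternary_to_complex[OF xyz(2)] p
      by - (rule rep_if_isotropic[of _ _ "of_int z" "of_int x" "of_int y"], auto intro: closed)
  qed
  \<comment> \<open>Unequal symbols force both primes to be 3 mod 4 by reciprocity, hence (-a/b) =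
    1.\<close>
  have mixed: "rep (of_nat a) (of_nat b)"
    if ab: "inert a" "inert b" "a \<noteq> b" and L: "Legendre a b = -1" "Legendre b a = 1" for a b
  proof -
    note a = inertD[OF ab(1)] and b = inertD[OF ab(2)]
    have "(-1::int) ^ ((a - 1) div 2 * ((b - 1) div 2)) = -1"
      using Quadratic_Reciprocity[OF a(1,2) b(1,2) ab(3)] L by simp
    then have "odd ((b - 1) div 2)" by (metis even_mult_iff neg_one_even_power one_neq_neg_one)
    then have "Legendre (-1) b = -1" using Legendre_minus_1[OF b(1,2)] by simp
    then have "Legendre (-1 * int a) b = 1" using Legendre_mult[OF b(1,2), of "-1" "int a"] L by simp
    then obtain t where t: "int b dvd t\<^sup>2 - -1 * int a" using Legendre_eq_1_D by blast
    obtain u where u: "int a dvd u\<^sup>2 - int b" using L Legendre_eq_1_D by blast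
    obtain x y z where xyz: "(x, y, z) \<noteq> (0, 0, 0)" "1 * x\<^sup>2 + int a * y\<^sup>2 = int b * z\<^sup>2"
    proof (rule legendre_ternary[of 1 "int a" "int b" 0 u t])
      show "k\<^sup>2 \<noteq> 1 * int a" for k :: int using nonsquare_prime_mult[of a 1 k] a by simp
      show "k\<^sup>2 \<noteq> int a * int b" for k :: int
        using nonsquare_prime_mult[of a "int b" k] prime_dvd_prime_int[OF a(1) b(1)] a ab(3) by simp
    qed (use t u a b coprime_primes_int[OF a(1) b(1) ab(3)] in auto)
    have "rep (- of_nat a) (of_nat b)" using rep_from_ternary_1[OF xyz(2,1)] a by simp
    then have "rep (of_nat b) (- of_nat a)" using b by - (rule rep_sym, auto intro: closed)
    then have "rep (of_nat b) (of_nat a)"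
      using rep_minus_1_inert[OF ab(2)] b by - (rule rep_uminus_right, auto intro: closed)
    then show ?thesis using sym ab by blast
  qed
  \<comment> \<open>Modulo a the condition is (qb/a) = (-1/a) = 1, hence the last assumption. When
    both symbols are -1, reciprocity provides it for at least one of the two primes.\<close>
  have both_minus_1: "rep (of_nat a) (of_nat b)"
    if ab: "inert a" "inert b" "a \<noteq> b" and L: "Legendre a b = -1" "Legendre b a = -1" "Legendre (-1) a = 1" for a b
  proof -
    note a = inertD[OF ab(1)] and b = inertD[OF ab(2)]
    have "Legendre (int a * int b) q = 1"
      using Legendre_mult[OF q(1) q_gt_2] Legendre_q ab by simp
    then obtain u where u: "int q dvd u\<^sup>2 - int a * int b" using Legendre_eq_1_D by blast
    have "Legendre (int q * int b) a = 1" using Legendre_mult[OF a(1,2)] a(5) L by simp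
    then obtain v where v: "int a dvd v\<^sup>2 - int q * int b" using Legendre_eq_1_D by blast
    have "Legendre (-1 * int q * int a) b = 1"
      unfolding Legendre_mult3[OF b(1,2)] using b(5) L Legendre_minus_1_pm1[OF ab(2)] by auto
    then obtain t where t: "int b dvd t\<^sup>2 - -1 * int q * int a" using Legendre_eq_1_D by blast
    obtain x y z where xyz: "(x, y, z) \<noteq> (0, 0, 0)" "int q * x\<^sup>2 + int a * y\<^sup>2 = int b * z\<^sup>2"
    proof (rule legendre_ternary[of "int q" "int a" "int b" u v t])
      show "k\<^sup>2 \<noteq> int q * int a" for k :: int
        using nonsquare_prime_mult[of q "int a" k] prime_dvd_prime_int[OF q(1) a(1)] q a by simp
      show "k\<^sup>2 \<noteq> int a * int b" for k :: int
        using nonsquare_prime_mult[of a "int b" k] prime_dvd_prime_int[OF a(1) b(1)] a ab(3) by simp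
    qed (use t u v a b q_gt_2 coprime_primes_int[OF a(1) b(1) ab(3)] coprime_primes_int[OF q(1) a(1)]
          coprime_primes_int[OF q(1) b(1)] in auto)
    have "rep (of_nat a) (- of_nat b)" using rep_from_ternary_q[OF xyz(2,1)] a by simp
    then show ?thesis
      using rep_minus_1_inert[OF ab(1)] a by - (rule rep_uminus_right, auto intro: closed)
  qed
  consider "Legendre p p' = 1" "Legendre p' p = 1" | "Legendre p p' = -1" "Legendre p' p = 1"
    | "Legendre p p' = 1" "Legendre p' p = -1" | "Legendre p p' = -1" "Legendre p' p = -1" using pm by auto
  then show ?thesis
  proof cases
    case 4
    then have "Legendre (-1) p = 1 \<or> Legendre (-1) p' = 1"
      using qr m1 by (cases "even ((p - 1) div 2)"; cases "even ((p' - 1) div 2)") auto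
    then show ?thesis using both_minus_1 4 assms sym by metis
  qed (use both_1 mixed assms sym in metis)+
qed

lemma rep_base:
  assumes "\<And>p. p \<in> S \<Longrightarrow> p = 2 \<or> inert p"
    and "a \<in> insert (-1) (of_nat ` S)" "b \<in> insert (-1) (of_nat ` S)"
  shows "rep a b"
proof -
  define B where "B = insert (-1 :: complex) (insert 2 (of_nat ` {p. inert p}))"
  have B: "B \<subseteq> K - {0}" using inertD(2) by (fastforce simp: B_def intro: closed)
  have m1: "rep (-1) b" if "b \<in> B" for b
    using that rep_minus_1_minus_1 rep_2_minus_1 rep_minus_1_inert by (auto simp: B_def)
  have two: "rep 2 b" if "b \<in> B" for b
    using that rep_2_2 rep_2_minus_1 rep_2_inert by (auto simp: B_def)
  have "rep a b" if ab: "a \<in> B" "b \<in> B" for a b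
  proof -
    consider "a = -1" | "b = -1" | "a = 2" | "b = 2" | p p' where "inert p" "inert p'" "a = of_nat p" "b = of_nat p'"
      using ab by (auto simp: B_def)
    then show ?thesis
    proof cases
      case (5 p p')
      show ?thesis
      proof (cases "p = p'")
        case True
        \<comment> \<open>For equal primes, (a, a) is the product of (a, -a) and (a, -1).\<close>
        have "rep a (- a)" by (rule rep_uminus_self)
        then show ?thesis using True 5 m1[OF ab(1)] ab B by - (rule rep_uminus_right, auto)
      qed (use 5 rep_inert_inert in auto)
    qed (use ab m1 two B rep_sym in blast)+
  qed
  moreover have "insert (-1) (of_nat ` S) \<subseteq> B" using assms(1) by (fastforce simp: B_def)
  ultimately show ?thesis using assms(2,3) by blast
qed

end

section \<open>Choice of the field\<close>

text \<open>For odd n these are the Kronecker symbols (-1/n) here and (2/n) in \<open>char8\<close>.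
  Both are -1 exactly for n = 3 mod 8.\<close>

definition char4 :: "nat \<Rightarrow> real" where
  "char4 n = (if n mod 4 = 1 then 1 else if n mod 4 = 3 then -1 else 0)"

definition char8 :: "nat \<Rightarrow> real" where
  "char8 n = (if n mod 8 = 1 \<or> n mod 8 = 7 then 1 else if n mod 8 = 3 \<or> n mod 8 = 5 then -1 else 0)"

lemma less_8_cases: "(a::nat) < 8 \<Longrightarrow> a \<in> {0,1,2,3,4,5,6,7}"
  by (simp add: less_Suc_eq numeral_eq_Suc)

lemma char4_mult: "char4 (m * n) = char4 m * char4 n"
proof -
  have "char4 (a * b mod 4) = char4 a * char4 b" if "a < 4" "b < 4" for a b
  proof -
    from that have "a \<in> {0,1,2,3}" "b \<in> {0,1,2,3}" by auto
    then show ?thesis by (elim insertE emptyE; simp add: char4_def)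
  qed
  from this[of "m mod 4" "n mod 4"] have "char4 ((m mod 4) * (n mod 4) mod 4) = char4 (m mod 4) * char4 (n mod 4)"
    by (simp only: mod_less_divisor zero_less_numeral)
  moreover have "char4 (j mod 4) = char4 j" for j by (simp only: char4_def mod_mod_trivial)
  ultimately show ?thesis by (simp only: mod_mult_eq)
qed

lemma char8_mult: "char8 (m * n) = char8 m * char8 n"
proof -
  have "char8 (a * b mod 8) = char8 a * char8 b" if "a < 8" "b < 8" for a b
  proof -
    from that have "a \<in> {0,1,2,3,4,5,6,7}" "b \<in> {0,1,2,3,4,5,6,7}" by (simp_all only: less_8_cases)
    then show ?thesis by (elim insertE emptyE; simp add: char8_def)
  qed
  from this[of "m mod 8" "n mod 8"] have "char8 ((m mod 8) * (n mod 8) mod 8) = char8 (m mod 8) * char8 (n mod 8)"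
    by (simp only: mod_less_divisor zero_less_numeral)
  moreover have "char8 (j mod 8) = char8 j" for j by (simp only: char8_def mod_mod_trivial)
  ultimately show ?thesis by (simp only: mod_mult_eq)
qed

lemma Legendre_with_prescribed_sign:
  assumes "prime p" "p > 2"
  shows "\<exists>n::nat. Legendre (int n) (int p) = - Legendre (-1) (int p)"
proof -
  have "Legendre (-1) (int p) \<in> {-1, 1}"
    using Legendre_minus_1[OF assms] by (cases "even ((p - 1) div 2)") auto
  moreover have "\<exists>n::nat. Legendre (int n) (int p) = 1" using Legendre_1[OF assms(1)] by (metis of_nat_1)
  moreover have "\<exists>n::nat. Legendre (int n) (int p) = -1"
  proof -
    obtain a where a: "Legendre a (int p) = -1" using quadratic_nonresidue_exists[OF assms] by blast
    have "[int (nat (a mod int p)) = a] (mod int p)" using assms by (simp add: cong_def)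
    then show ?thesis using a Legendre_cong by metis
  qed
  ultimately show ?thesis by auto
qed

text \<open>The Chinese remainder theorem gives an integer with all the desired symbols, so the
  prescribed values are compatible; the theorem on real characters then replaces it by a
  prime.\<close>

lemma inert_prime_exists:
  assumes "finite S" "\<And>p. p \<in> S \<Longrightarrow> prime p"
  shows "\<exists>q. prime q \<and> q mod 8 = 3 \<and>
    (\<forall>p\<in>S. p > 2 \<longrightarrow> p \<noteq> q \<and> Legendre (int q) (int p) = - Legendre (-1) (int p))"
proof -
  define S' where "S' = S - {2}"
  have S': "finite S'" "prime p" "p > 2" "odd p" if "p \<in> S'" for p
    using that assms prime_ge_2_nat[of p] prime_odd_nat[of p] by (auto simp: S'_def le_less)
  have fin: "finite S'" using assms by (simp add: S'_def)
  have nin: "4 \<notin> S'" "8 \<notin> S'" using S'(4) by force+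
  define M where "M = 8 * \<Prod>S'"
  \<comment> \<open>The indices 4 and 8 are not prime, so they can name the two characters at 2 next
    to the primes in \<open>S'\<close>.\<close>
  define f where "f = (\<lambda>i n. if i = 4 then char4 n else if i = 8 then char8 n
    else real_of_int (Legendre (int n) (int i)))"
  define I where "I = insert 4 (insert 8 S')"
  obtain u :: "nat \<Rightarrow> nat" where u: "Legendre (int (u p)) (int p) = - Legendre (-1) (int p)" if "p \<in> S'" for p
    using Legendre_with_prescribed_sign S' by metis
  have "\<exists>n. \<forall>i\<in>insert 8 S'. [n = (if i = 8 then 3 else u i)] (mod i)"
  proof (rule chinese_remainder_nat)
    show "\<forall>i\<in>insert 8 S'. \<forall>j\<in>insert 8 S'. i \<noteq> j \<longrightarrow> coprime i j"
    proof (intro ballI impI)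
      fix i j assume ij: "i \<in> insert 8 S'" "j \<in> insert 8 S'" "i \<noteq> j"
      have *: "coprime 8 p" if "p \<in> S'" for p
        using S'(4)[OF that] coprime_power_left_iff[of 2 3 p] by simp
      show "coprime i j" using ij * S'(2) by (auto simp: coprime_commute primes_coprime)
    qed
  qed (use fin in auto)
  then obtain n where n_cong: "\<forall>i\<in>insert 8 S'. [n = (if i = 8 then 3 else u i)] (mod i)" ..
  have n: "[n = 3] (mod 8)" "[n = u p] (mod p)" if "p \<in> S'" for p
  proof -
    show "[n = 3] (mod 8)" using n_cong by simp
    have "p \<noteq> 8" using that nin by auto
    then show "[n = u p] (mod p)" using bspec[OF n_cong, of p] that by simp
  qed
  have nL: "Legendre (int n) (int p) = - Legendre (-1) (int p)" if "p \<in> S'" for p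
    using n(2)[OF that] u[OF that] Legendre_cong[of "int n" "int (u p)" "int p"]
    by (simp add: cong_int_iff)
  have n8: "n mod 8 = 3" using n_cong by (simp add: cong_def)
  have mod_8_4: "k mod 8 mod 4 = k mod 4" "k mod 8 mod 2 = k mod 2" for k :: nat
    by (simp_all add: mod_mod_cancel)
  have n4: "n mod 4 = 3" "odd n" using mod_8_4[of n] n8 by (simp_all add: odd_iff_mod_2_eq_one)
  have copS: "coprime a M \<longleftrightarrow> odd a \<and> (\<forall>p\<in>S'. \<not> p dvd a)" for a
  proof -
    have "coprime a 8 \<longleftrightarrow> odd a" using coprime_power_right_iff[of a 2 3] by (simp add: coprime_right_2_iff_odd)
    moreover have "coprime a (\<Prod>S') \<longleftrightarrow> (\<forall>p\<in>S'. \<not> p dvd a)"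
    proof (intro iffI ballI)
      fix p assume "coprime a (\<Prod>S')" "p \<in> S'"
      moreover from this have "p dvd \<Prod>S'" using fin by (auto intro: dvd_prodI)
      ultimately show "\<not> p dvd a" using S'(2) coprime_common_divisor not_prime_unit by blast
    next
      assume "\<forall>p\<in>S'. \<not> p dvd a"
      then show "coprime a (\<Prod>S')"
        using S'(2) prime_imp_coprime coprime_commute by (intro prod_coprime_right) blast
    qed
    ultimately show ?thesis by (simp add: M_def)
  qed
  have ndvd: "\<not> p dvd a \<longleftrightarrow> Legendre (int a) (int p) \<in> {-1, 1}" for p a
    using Legendre_eq_0_iff[of "int a" "int p"] Legendre_values[of "int a" "int p"] by auto
  have "0 < p" if "p \<in> S'" for p using S'(3)[OF that] by simp
  then have "\<Prod>S' > 0" by (rule prod_pos)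
  then have M_pos: "M > 0" by (simp add: M_def)
  have f_S': "f p a = real_of_int (Legendre (int a) (int p))" if "p \<in> S'" for p a
    using that nin by (auto simp: f_def)
  have f_48: "f 4 = char4" "f 8 = char8" by (simp_all add: f_def)
  have I_cases: "P i" if "i \<in> I" "P 4" "P 8" "\<And>p. p \<in> S' \<Longrightarrow> P p" for P i
    using that by (auto simp: I_def)
  have "\<exists>q. prime q \<and> coprime q M \<and> (\<forall>i\<in>I. f i q = f i n)"
  proof (rule prime_with_prescribed_real_characters)
    show "f i (a * b) = f i a * f i b" if "i \<in> I" for i a b
      using that by (rule I_cases) (simp_all add: f_48 f_S' char4_mult char8_mult Legendre_mult S'(2,3))
    show "f i 1 = 1" if "i \<in> I" for i
      using that by (rule I_cases) (simp_all add: f_48 f_S' char4_def char8_def Legendre_1[simplified] S'(2))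
    show "f i (a + M) = f i a" if "i \<in> I" for i a
      using that
    proof (rule I_cases)
      have 8: "(a + M) mod 8 = a mod 8" by (simp add: M_def)
      then have "(a + M) mod 4 = a mod 4" using mod_8_4(1)[of "a + M"] mod_8_4(1)[of a] by simp
      with 8 show "f 4 (a + M) = f 4 a" "f 8 (a + M) = f 8 a" by (simp_all only: f_48 char4_def char8_def)
      fix p assume "p \<in> S'"
      then have "p dvd M" using fin by (auto simp: M_def intro: dvd_mult dvd_prodI)
      then have "[int (a + M) = int a] (mod int p)" by (simp add: cong_iff_dvd_diff)
      from Legendre_cong[OF this] \<open>p \<in> S'\<close> show "f p (a + M) = f p a" by (simp only: f_S')
    qed
    show "f i a \<in> {-1, 1}" if "i \<in> I" "coprime a M" for i a
      using that(1)
    proof (rule I_cases)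
      obtain b where b: "a mod 8 = b" by blast
      have "b mod 2 = 1" using that copS mod_8_4(2)[of a] b by (simp add: odd_iff_mod_2_eq_one)
      moreover have "b < 8" using b by auto
      then have "b \<in> {0,1,2,3,4,5,6,7}" by (rule less_8_cases)
      ultimately have "b \<in> {1,3,5,7}" by auto
      moreover have "a mod 4 = b mod 4" using mod_8_4(1)[of a] b by simp
      ultimately have "a mod 4 = 1 \<or> a mod 4 = 3" "a mod 8 = 1 \<or> a mod 8 = 7 \<or> a mod 8 = 3 \<or> a mod 8 = 5"
        unfolding b by auto
      then show "f 4 a \<in> {-1, 1}" "f 8 a \<in> {-1, 1}" by (auto simp: f_48 char4_def char8_def)
      fix p assume "p \<in> S'"
      then show "f p a \<in> {-1, 1}" using that(2) copS[of a] ndvd[of p a] by (auto simp: f_S')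
    qed
    have "\<not> p dvd n" if "p \<in> S'" for p
      unfolding ndvd nL[OF that] using Legendre_minus_1[OF S'(2,3)[OF that]]
      by (cases "even ((p - 1) div 2)") auto
    with n4 show "coprime n M" by (simp add: copS)
  qed (use fin M_pos in \<open>auto simp: I_def\<close>)
  then obtain q where q: "prime q" "coprime q M" "\<And>i. i \<in> I \<Longrightarrow> f i q = f i n" by blast
  have "f 4 q = f 4 n" "f 8 q = f 8 n" using q(3) by (auto simp: I_def)
  then have "q mod 4 = 3" "q mod 8 = 3 \<or> q mod 8 = 5"
    using n4(1) n8 by (auto simp: f_48 char4_def char8_def split: if_splits)
  then have "q mod 8 = 3" using mod_8_4(1)[of q] by auto
  moreover have "p \<noteq> q \<and> Legendre (int q) (int p) = - Legendre (-1) (int p)" if "p \<in> S" "p > 2" for p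
  proof -
    have p: "p \<in> S'" using that by (simp add: S'_def)
    then have "f p q = f p n" using q(3) by (simp add: I_def)
    moreover have "\<not> p dvd q" using q(2) copS[of q] p by simp
    ultimately show ?thesis using nL[OF p] p by (auto simp: f_S')
  qed
  ultimately show ?thesis using q(1) by blast
qed

section \<open>The field Q(sqrt(-q)) inside the complex numbers\<close>

lemma Rats_complex_Im: "x \<in> \<rat> \<Longrightarrow> Im x = 0"
  by (elim Rats_cases') (simp add: Im_divide)

definition quadratic_field :: "complex \<Rightarrow> complex set" where
  "quadratic_field s = {x + s * y | x y. x \<in> \<rat> \<and> y \<in> \<rat>}"

text \<open>As \<open>s\<close> is purely imaginary, 1 and \<open>s\<close> are independent over Q
  for every positive \<open>q\<close>. Prime \<open>q\<close> give the splitting fields, and q = 1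
  gives Q(i).\<close>

locale imaginary_root =
  fixes q :: nat and s :: complex
  assumes q_pos: "q > 0" and s_def: "s = \<i> * of_real (sqrt (real q))"
begin

lemma s_sq: "s\<^sup>2 = - of_nat q"
  by (simp add: s_def power_mult_distrib flip: of_real_power)

lemma independent_parts:
  assumes "x \<in> \<rat>" "y \<in> \<rat>" "x + s * y = 0"
  shows "x = 0" "y = 0"
proof -
  have "Re (s * y) = 0" using Rats_complex_Im[OF assms(2)] by (simp add: s_def)
  then have "Re x = 0" using arg_cong[OF assms(3), of Re] by simp
  then show "x = 0" using Rats_complex_Im[OF assms(1)] by (simp add: complex_eq_iff)
  then show "y = 0" using assms(3) q_pos by (simp add: s_def)
qed

lemma quadratic_fieldI: "x \<in> \<rat> \<Longrightarrow> y \<in> \<rat> \<Longrightarrow> x + s * y \<in> quadratic_field s"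
  by (auto simp: quadratic_field_def)

lemma Rats_subset: "x \<in> \<rat> \<Longrightarrow> x \<in> quadratic_field s"
  using quadratic_fieldI[of x 0] by simp

lemma s_in: "s \<in> quadratic_field s"
  using quadratic_fieldI[of 0 1] by simp

sublocale complex_subfield "quadratic_field s"
proof
  fix a b assume "a \<in> quadratic_field s" "b \<in> quadratic_field s"
  then obtain x y u v where xy: "x \<in> \<rat>" "y \<in> \<rat>" "u \<in> \<rat>" "v \<in> \<rat>" and ab: "a = x + s * y" "b = u + s * v"
    by (auto simp: quadratic_field_def)
  have "a + b = (x + u) + s * (y + v)" by (simp add: ab algebra_simps)
  then show "a + b \<in> quadratic_field s" using xy by (simp add: quadratic_fieldI)
  have "a * b = (x * u + s\<^sup>2 * (y * v)) + s * (x * v + y * u)"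
    by (simp add: ab power2_eq_square algebra_simps)
  also have "\<dots> = (x * u - of_nat q * y * v) + s * (x * v + y * u)" by (simp add: s_sq)
  finally have "a * b = (x * u - of_nat q * y * v) + s * (x * v + y * u)" .
  then show "a * b \<in> quadratic_field s" using xy by (simp add: quadratic_fieldI)
next
  fix a assume "a \<in> quadratic_field s"
  then obtain x y where xy: "x \<in> \<rat>" "y \<in> \<rat>" and a: "a = x + s * y" by (auto simp: quadratic_field_def)
  have "- a = (- x) + s * (- y)" by (simp add: a)
  then show "- a \<in> quadratic_field s" using xy by (simp only: quadratic_fieldI Rats_minus_iff)
  define N where "N = x * x + of_nat q * y * y"
  have N: "(x + s * y) * (x - s * y) = N"
  proof -
    have "(x + s * y) * (x - s * y) = x * x - s\<^sup>2 * (y * y)" by (simp add: power2_eq_square algebra_simps)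
    then show ?thesis by (simp add: N_def s_sq)
  qed
  have "inverse a = x / N + s * (- y / N)"
  proof (cases "a = 0")
    case True
    then show ?thesis using independent_parts[OF xy] by (simp add: a)
  next
    case False
    have "x - s * y \<noteq> 0"
      using independent_parts[of x "- y"] xy False by (auto simp: a)
    then have "N \<noteq> 0" using N False by (auto simp: a)
    then show ?thesis using N False by (simp add: a field_simps)
  qed
  moreover have "N \<in> \<rat>" using xy by (simp add: N_def)
  ultimately show "inverse a \<in> quadratic_field s"
    using xy quadratic_fieldI[of "x / N" "- y / N"] by simp
qed (auto intro: Rats_subset)

lemma imaginary_quadratic_field: "imaginary_quadratic_field (quadratic_field s)"
proof -
  have "rat_complex.dim (quadratic_field s) = card {1, s}"
  proof (rule rat_complex.dim_eq_card)
    have span2: "rat_complex.span {1, s} = quadratic_field s"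
    proof (rule Set.set_eqI)
      fix x
      have "x \<in> rat_complex.span {1, s} \<longleftrightarrow> (\<exists>k l. x - of_rat k = of_rat l * s)"
        by (simp add: rat_complex.span_breakdown_eq rat_complex.span_singleton image_iff)
      also have "\<dots> \<longleftrightarrow> (\<exists>k l. x = of_rat k + s * of_rat l)"
        by (simp add: diff_eq_eq ac_simps)
      also have "\<dots> \<longleftrightarrow> x \<in> quadratic_field s"
        unfolding quadratic_field_def Rats_def by blast
      finally show "x \<in> rat_complex.span {1, s} \<longleftrightarrow> x \<in> quadratic_field s" .
    qed
    show "rat_complex.span {1, s} = rat_complex.span (quadratic_field s)"
      unfolding span2[symmetric] rat_complex.span_span ..
    show "\<not> rat_complex.dependent {1, s}"
    proof -
      have "s \<notin> rat_complex.span {1}"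
      proof
        assume "s \<in> rat_complex.span {1}"
        then obtain k where "s = of_rat k" by (auto simp: rat_complex.span_singleton)
        then have "Im s = 0" using Rats_complex_Im[of s] by simp
        then show False using q_pos by (simp add: s_def)
      qed
      then have "rat_complex.independent (insert s {1})"
        by (intro rat_complex.independent_insertI) (auto simp: rat_complex.independent_empty)
      then show ?thesis by (simp add: insert_commute)
    qed
  qed
  moreover have "s \<noteq> 1" using q_pos by (auto simp: s_def complex_eq_iff)
  moreover have "s \<notin> \<real>" using q_pos by (auto simp: s_def complex_is_Real_iff)
  ultimately show ?thesis
    using s_in by (auto simp: imaginary_quadratic_field_def intro: closed)
qed

end

lemma (in complex_subfield) of_nat_in_gen:
  "n > 0 \<Longrightarrow> prime_factors n \<subseteq> S \<Longrightarrow> of_nat n \<in> gen (insert (-1) (of_nat ` S))"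
proof (induction n rule: less_induct)
  case (less n)
  show ?case
  proof (cases "n = 1")
    case False
    then obtain p m where p: "prime p" "n = p * m" by (metis dvdE prime_factor_nat)
    then have m: "m > 0" "m < n" using less.prems prime_gt_1_nat[of p] by auto
    have "prime_factors n = insert p (prime_factors m)"
      using p m by (simp add: prime_factors_product prime_prime_factors)
    then have "of_nat m \<in> gen (insert (-1) (of_nat ` S))" "p \<in> S" using less m by auto
    then show ?thesis using p by (auto intro: gen.intros)
  qed (auto intro: gen.intros)
qed

text \<open>\<open>G\<close> is generated by -1 and the primes in the numerators and denominators of
  \<open>A\<close>. It appears in the conclusion because later steps produce new coefficients such
  as -abc, which must again have trivial symbols.\<close>

theorem splitting_field_exists:
  assumes "finite A" "A \<subseteq> \<rat> - {0::complex}"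
  obtains q s G where "imaginary_root q s" "A \<subseteq> G" "G \<subseteq> \<rat> - {0}"
    "\<And>a b. a \<in> G \<Longrightarrow> b \<in> G \<Longrightarrow> a * b \<in> G" "\<And>a. a \<in> G \<Longrightarrow> - a \<in> G"
    "\<And>a b. a \<in> G \<Longrightarrow> b \<in> G \<Longrightarrow> \<exists>x\<in>quadratic_field s. \<exists>y\<in>quadratic_field s. b = x\<^sup>2 - a * y\<^sup>2"
proof -
  have "\<exists>x y. a = of_int x / of_int y \<and> x \<noteq> 0 \<and> y \<noteq> 0" if "a \<in> A" for a
  proof -
    have "a \<in> \<rat>" "a \<noteq> 0" using that assms by auto
    then show ?thesis by (elim Rats_cases') auto
  qed
  then obtain num den where nd: "a = of_int (num a) / of_int (den a)" "num a \<noteq> 0" "den a \<noteq> 0" if "a \<in> A" for a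
    by metis
  define S where "S = (\<Union>a\<in>A. prime_factors (nat \<bar>num a\<bar>) \<union> prime_factors (nat \<bar>den a\<bar>))"
  have S: "finite S" "\<And>p. p \<in> S \<Longrightarrow> prime p" using assms(1) by (auto simp: S_def)
  obtain q where q_props: "prime q" "q mod 8 = 3"
    "\<forall>p\<in>S. p > 2 \<longrightarrow> p \<noteq> q \<and> Legendre (int q) (int p) = - Legendre (-1) (int p)"
    using inert_prime_exists[OF S] by blast
  define s where "s = \<i> * of_real (sqrt (real q))"
  interpret imaginary_root q s using q_props by unfold_locales (auto simp: s_def dest: prime_gt_0_nat)
  interpret inert_subfield "quadratic_field s" q s
    using q_props s_in s_sq by unfold_locales auto
  define S1 where "S1 = insert (-1 :: complex) (of_nat ` S)"
  define G where "G = gen S1"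
  have S1: "S1 \<subseteq> quadratic_field s - {0}" using S(2)[of 0] by (auto simp: S1_def intro: closed)
  have "rep a b" if "a \<in> S1" "b \<in> S1" for a b
  proof (rule rep_base)
    fix p assume "p \<in> S"
    moreover from this have "p = 2 \<or> p > 2" using S(2) prime_ge_2_nat[of p] by force
    ultimately show "p = 2 \<or> inert p" using q_props(3) S(2) by (auto simp: inert_def)
  qed (use that in \<open>auto simp: S1_def\<close>)
  then have rep: "rep a b" if "a \<in> G" "b \<in> G" for a b
    using rep_gen[OF S1] that unfolding G_def by blast
  have m1: "-1 \<in> G" by (auto simp: G_def S1_def intro: gen_base)
  have mult: "a * b \<in> G" if "a \<in> G" "b \<in> G" for a b using that unfolding G_def by (rule gen_mult)
  have of_int_G: "of_int x \<in> G" if "x \<noteq> 0" "prime_factors (nat \<bar>x\<bar>) \<subseteq> S" for x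
  proof -
    have "of_nat (nat \<bar>x\<bar>) \<in> G" unfolding G_def S1_def using that by (intro of_nat_in_gen) auto
    moreover have "of_int x = (of_nat (nat \<bar>x\<bar>) :: complex) \<or> of_int x = (-1) * (of_nat (nat \<bar>x\<bar>) :: complex)"
      by (cases "x \<ge> 0") auto
    ultimately show ?thesis using mult m1 by metis
  qed
  have "a \<in> G" if "a \<in> A" for a
  proof -
    have "prime_factors (nat \<bar>num a\<bar>) \<subseteq> S" "prime_factors (nat \<bar>den a\<bar>) \<subseteq> S" using that by (auto simp: S_def)
    then have "of_int (num a) \<in> G" "of_int (den a) \<in> G" using nd[OF that] of_int_G by blast+
    then have "of_int (num a) * inverse (of_int (den a)) \<in> G"
      unfolding G_def by (intro gen_mult gen_inverse)
    then show ?thesis using nd(1)[OF that] by (simp add: field_simps)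
  qed
  moreover have "a \<in> \<rat> - {0}" if "a \<in> G" for a
    using that unfolding G_def by (induction rule: gen.induct) (use S(2)[of 0] in \<open>auto simp: S1_def\<close>)
  ultimately show ?thesis
    using that[of q s G] imaginary_root_axioms mult mult[OF m1] rep unfolding rep_def by auto
qed

section \<open>Cubic forms and trilinear forms\<close>

text \<open>Vectors are functions on all of \<open>nat\<close>; that they belong to n-space is
  expressed by vanishing from index n on.\<close>

definition combo :: "'a::comm_ring_1 \<Rightarrow> (nat \<Rightarrow> 'a) \<Rightarrow> 'a \<Rightarrow> (nat \<Rightarrow> 'a) \<Rightarrow> nat \<Rightarrow> 'a" where
  "combo a u b v = (\<lambda>i. a * u i + b * v i)"

definition lincomb :: "nat \<Rightarrow> (nat \<Rightarrow> 'a::comm_ring_1) \<Rightarrow> (nat \<Rightarrow> nat \<Rightarrow> 'a) \<Rightarrow> nat \<Rightarrow> 'a" where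
  "lincomb m c w = (\<lambda>i. \<Sum>j<m. c j * w j i)"

text \<open>\<open>T_closed\<close> encodes rational coefficients, for all subfields at once: it is
  applied to Q in the orthogonalisation and to K on the isotropic space.\<close>

locale sym_trilinear =
  fixes T :: "(nat \<Rightarrow> complex) \<Rightarrow> (nat \<Rightarrow> complex) \<Rightarrow> (nat \<Rightarrow> complex) \<Rightarrow> complex"
  assumes lin: "T (combo a u b v) w x = a * T u w x + b * T v w x"
    and sym12: "T u v w = T v u w"
    and sym23: "T u v w = T u w v"
    and T_closed: "complex_subfield K \<Longrightarrow> (\<And>i. u i \<in> K) \<Longrightarrow> (\<And>i. v i \<in> K) \<Longrightarrow> (\<And>i. w i \<in> K) \<Longrightarrow> T u v w \<in> K"

lemma power_product_as_list:
  fixes f :: "nat \<Rightarrow> nat"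
  assumes "finite A"
  shows "\<exists>is. length is = (\<Sum>i\<in>A. f i) \<and>
    (\<forall>x :: nat \<Rightarrow> 'a::comm_semiring_1. (\<Prod>i\<in>A. x i ^ f i) = prod_list (map x is))"
  using assms
proof (induction A rule: finite_induct)
  case (insert a A)
  then obtain "is" where "length is = (\<Sum>i\<in>A. f i)"
    "\<And>x :: nat \<Rightarrow> 'a. (\<Prod>i\<in>A. x i ^ f i) = prod_list (map x is)" by blast
  then show ?case using insert
    by (intro exI[of _ "replicate (f a) a @ is"]) (simp add: prod_list_replicate)
qed simp

lemma cubic_power_product:
  fixes f :: "nat \<Rightarrow> nat"
  assumes "finite A" "(\<Sum>i\<in>A. f i) = 3"
  shows "\<exists>i j k. \<forall>x :: nat \<Rightarrow> 'a::comm_semiring_1. (\<Prod>i\<in>A. x i ^ f i) = x i * x j * x k"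
proof -
  obtain "is" where "length is = 3" "\<forall>x :: nat \<Rightarrow> 'a. (\<Prod>i\<in>A. x i ^ f i) = prod_list (map x is)"
    using power_product_as_list[OF assms(1), of f] assms(2) by metis
  moreover from this(1) obtain i j k where "is = [i, j, k]"
    by (auto simp: length_Suc_conv numeral_3_eq_3)
  ultimately have "\<forall>x :: nat \<Rightarrow> 'a. (\<Prod>i\<in>A. x i ^ f i) = x i * x j * x k"
    by (simp add: mult.assoc)
  then show ?thesis by blast
qed

definition eval_complex :: "rat mpolynomial \<Rightarrow> (nat \<Rightarrow> complex) \<Rightarrow> complex" where
  "eval_complex C x = (\<Sum>m\<in>Poly_Mapping.keys C. of_rat (Poly_Mapping.lookup C m) *
       (\<Prod>i\<in>Poly_Mapping.keys m. x i ^ Poly_Mapping.lookup m i))"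

lemma eval_complex_of_rat:
  assumes "cubic_form n C"
  shows "eval_complex C (\<lambda>i. of_rat (x i)) = of_rat (eval_poly C (vec n x))"
proof -
  have "(\<Prod>i\<in>Poly_Mapping.keys m. (vec n x $ i) ^ Poly_Mapping.lookup m i) =
      (\<Prod>i\<in>Poly_Mapping.keys m. x i ^ Poly_Mapping.lookup m i)" if "m \<in> Poly_Mapping.keys C" for m
    using that assms by (intro prod.cong) (auto simp: cubic_form_def subset_eq)
  then show ?thesis
    by (simp add: eval_complex_def eval_poly_def of_rat_sum of_rat_mult of_rat_prod of_rat_power)
qed

theorem cubic_form_trilinear:
  assumes "cubic_form n (C :: rat mpolynomial)"
  obtains T where "sym_trilinear T" "\<And>x. eval_complex C x = T x x x"
proof -
  have "\<exists>i j k. \<forall>x :: nat \<Rightarrow> complex. (\<Prod>i\<in>Poly_Mapping.keys m. x i ^ Poly_Mapping.lookup m i) = x i * x j * x k"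
    if "m \<in> Poly_Mapping.keys C" for m
    using that assms by (intro cubic_power_product) (auto simp: cubic_form_def)
  then obtain i j k where ijk: "\<And>m (x :: nat \<Rightarrow> complex). m \<in> Poly_Mapping.keys C \<Longrightarrow>
      (\<Prod>i\<in>Poly_Mapping.keys m. x i ^ Poly_Mapping.lookup m i) = x (i m) * x (j m) * x (k m)" by metis
  \<comment> \<open>The sum over the six permutations of u, v, w. On the diagonal it is six times
    the monomial, hence the division by 6 in \<open>T\<close>.\<close>
  define P where "P = (\<lambda>m (u :: nat \<Rightarrow> complex) v w.
    u (i m) * v (j m) * w (k m) + u (i m) * w (j m) * v (k m) + v (i m) * u (j m) * w (k m) +
    v (i m) * w (j m) * u (k m) + w (i m) * u (j m) * v (k m) + w (i m) * v (j m) * u (k m))"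
  define T where "T = (\<lambda>u v w. \<Sum>m\<in>Poly_Mapping.keys C. of_rat (Poly_Mapping.lookup C m) * (P m u v w / 6))"
  have "sym_trilinear T"
  proof
    have "P m (combo a u b v) w x = a * P m u w x + b * P m v w x" for m a u b v w x
      by (simp add: P_def combo_def algebra_simps)
    then show "T (combo a u b v) w x = a * T u w x + b * T v w x" for a u b v w x
      by (simp add: T_def sum_distrib_left sum.distrib[symmetric] add_divide_distrib algebra_simps)
    show "T u v w = T v u w" "T u v w = T u w v" for u v w
      unfolding T_def P_def by (simp_all add: ac_simps)
  next
    fix K and u v w :: "nat \<Rightarrow> complex"
    assume K: "complex_subfield K" and uvw: "\<And>i. u i \<in> K" "\<And>i. v i \<in> K" "\<And>i. w i \<in> K"
    interpret K: complex_subfield K by (rule K)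
    have P: "P m u v w \<in> K" for m
      unfolding P_def by (intro K.add K.mult uvw)
    have "of_rat r * (P m u v w / 6) \<in> K" for r m
      by (intro K.mult K.divide K.numeral P K.Rats[OF Rats_of_rat])
    then show "T u v w \<in> K" unfolding T_def by (intro K.sum)
  qed
  moreover have "eval_complex C x = T x x x" for x
    unfolding eval_complex_def T_def P_def by (intro sum.cong refl) (simp add: ijk algebra_simps)
  ultimately show ?thesis using that by blast
qed

section \<open>Cubic forms with given coefficients, and the zeros supplied by
  \<open>gamma_field\<close>\<close>

lemma eval_poly_superset:
  assumes "finite A" "Poly_Mapping.keys p \<subseteq> A"
  shows "eval_poly p x = (\<Sum>m\<in>A. Poly_Mapping.lookup p m *
       (\<Prod>i\<in>Poly_Mapping.keys m. (x $ i) ^ Poly_Mapping.lookup m i))"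
  unfolding eval_poly_def using assms
  by (intro sum.mono_neutral_left) (auto simp: in_keys_iff)

lemma eval_poly_add: "eval_poly (p + q) x = eval_poly p x + eval_poly q x"
proof -
  let ?A = "Poly_Mapping.keys p \<union> Poly_Mapping.keys q"
  have "Poly_Mapping.keys (p + q) \<subseteq> ?A" by (rule keys_add)
  then show ?thesis
    by (simp add: eval_poly_superset[of ?A] lookup_add distrib_right sum.distrib)
qed

lemma eval_poly_sum: "eval_poly (\<Sum>a\<in>A. p a) x = (\<Sum>a\<in>A. eval_poly (p a) x)"
  by (induction A rule: infinite_finite_induct) (simp_all add: eval_poly_add, simp_all add: eval_poly_def)

lemma cubic_form_add: "cubic_form n p \<Longrightarrow> cubic_form n q \<Longrightarrow> cubic_form n (p + q)"
  unfolding cubic_form_def using keys_add[of p q] by blast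

lemma cubic_form_sum: "(\<And>a. a \<in> A \<Longrightarrow> cubic_form n (p a)) \<Longrightarrow> cubic_form n (\<Sum>a\<in>A. p a)"
  by (induction A rule: infinite_finite_induct) (simp_all add: cubic_form_add, simp_all add: cubic_form_def)

definition cubic_monomial :: "nat \<Rightarrow> nat \<Rightarrow> nat \<Rightarrow> nat \<Rightarrow>\<^sub>0 nat" where
  "cubic_monomial i j k = Poly_Mapping.single i 1 + Poly_Mapping.single j 1 + Poly_Mapping.single k 1"

lemma keys_cubic_monomial: "Poly_Mapping.keys (cubic_monomial i j k) \<subseteq> {i, j, k}"
  unfolding cubic_monomial_def
  by (intro order_trans[OF keys_add] Un_least order_trans[OF keys_add]) auto

lemma cubic_monomial_sum:
  "(\<Sum>l\<in>Poly_Mapping.keys (cubic_monomial i j k). Poly_Mapping.lookup (cubic_monomial i j k) l) = 3"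
proof -
  have "(\<Sum>l\<in>Poly_Mapping.keys (cubic_monomial i j k). Poly_Mapping.lookup (cubic_monomial i j k) l) =
      (\<Sum>l\<in>{i,j,k}. Poly_Mapping.lookup (cubic_monomial i j k) l)"
    using keys_cubic_monomial by (intro sum.mono_neutral_left) (auto simp: in_keys_iff)
  also have "\<dots> = 3"
    by (simp add: cubic_monomial_def lookup_add lookup_single when_def sum.distrib)
  finally show ?thesis .
qed

lemma cubic_monomial_prod:
  fixes x :: "nat \<Rightarrow> 'a::comm_semiring_1"
  shows "(\<Prod>l\<in>Poly_Mapping.keys (cubic_monomial i j k). x l ^ Poly_Mapping.lookup (cubic_monomial i j k) l) = x i * x j * x k"
proof -
  have "(\<Prod>l\<in>Poly_Mapping.keys (cubic_monomial i j k). x l ^ Poly_Mapping.lookup (cubic_monomial i j k) l) =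
      (\<Prod>l\<in>{i,j,k}. x l ^ Poly_Mapping.lookup (cubic_monomial i j k) l)"
    using keys_cubic_monomial by (intro prod.mono_neutral_left) (auto simp: in_keys_iff)
  also have "\<dots> = (\<Prod>l\<in>{i,j,k}. (if i = l then x l else 1) * (if j = l then x l else 1) * (if k = l then x l else 1))"
    by (intro prod.cong refl) (simp add: cubic_monomial_def lookup_add lookup_single when_def power_add)
  also have "\<dots> = x i * x j * x k"
    by (simp only: prod.distrib) simp
  finally show ?thesis .
qed

lemma cubic_form_from_coefficients:
  fixes c :: "nat \<Rightarrow> nat \<Rightarrow> nat \<Rightarrow> complex"
  assumes "complex_subfield K" "\<And>i j k. i < m \<Longrightarrow> j < m \<Longrightarrow> k < m \<Longrightarrow> c i j k \<in> K"
  obtains D where "cubic_form m D" "range (Poly_Mapping.lookup D) \<subseteq> K"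
    "\<And>x. eval_poly D x = (\<Sum>i<m. \<Sum>j<m. \<Sum>k<m. c i j k * (x $ i * x $ j * x $ k))"
proof
  interpret K: complex_subfield K by fact
  define D where "D = (\<Sum>i<m. \<Sum>j<m. \<Sum>k<m. Poly_Mapping.single (cubic_monomial i j k) (c i j k))"
  show "cubic_form m D"
    unfolding D_def
    by (intro cubic_form_sum) (use keys_cubic_monomial cubic_monomial_sum in \<open>fastforce simp: cubic_form_def\<close>)
  show "range (Poly_Mapping.lookup D) \<subseteq> K"
    unfolding D_def using assms(2)
    by (auto simp: lookup_sum lookup_single when_def K.zero intro!: K.sum)
  show "eval_poly D x = (\<Sum>i<m. \<Sum>j<m. \<Sum>k<m. c i j k * (x $ i * x $ j * x $ k))" for x
    unfolding D_def eval_poly_sum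
    by (intro sum.cong refl) (simp add: eval_poly_def cubic_monomial_prod[of "\<lambda>i. x $ i"])
qed

text \<open>A finite infimum in \<open>enat\<close> is attained, so \<open>g\<close> itself has the
  defining property.\<close>

lemma gamma_field_zero:
  assumes "gamma_field K = enat g" "g \<le> m" "cubic_form m D" "range (Poly_Mapping.lookup D) \<subseteq> K"
  shows "\<exists>x\<in>carrier_vec m. (\<forall>i<m. x $ i \<in> K) \<and> x \<noteq> 0\<^sub>v m \<and> eval_poly D x = 0"
proof -
  define A where "A = {enat n | n. \<forall>m\<ge>n. \<forall>C. cubic_form m C \<and> range (Poly_Mapping.lookup C) \<subseteq> K \<longrightarrow>
        (\<exists>x\<in>carrier_vec m. (\<forall>i<m. x $ i \<in> K) \<and> x \<noteq> 0\<^sub>v m \<and> eval_poly C x = 0)}"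
  have g: "Inf A = enat g" using assms(1) by (simp add: gamma_field_def A_def)
  then have "A \<noteq> {}" by (auto simp: Inf_enat_def)
  then have "enat g \<in> A" using g LeastI_ex[of "\<lambda>x. x \<in> A"] by (auto simp: Inf_enat_def)
  then show ?thesis using assms(2-4) by (auto simp: A_def)
qed

lemma lincomb_Suc: "lincomb (Suc m) c w = combo 1 (lincomb m c w) (c m) (w m)"
  by (simp add: lincomb_def combo_def)

context sym_trilinear
begin

lemma lin2: "T w (combo a u b v) x = a * T w u x + b * T w v x"
  by (simp add: sym12[of w] lin)

lemma lin3: "T w x (combo a u b v) = a * T w x u + b * T w x v"
  by (simp add: sym23[of w x] lin2)

lemma T_lincomb: "T (lincomb m c w) u v = (\<Sum>j<m. c j * T (w j) u v)"
proof (induction m)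
  case 0
  have "lincomb 0 c w = combo 0 u 0 u" by (simp add: lincomb_def combo_def)
  then show ?case by (simp only: lin) simp
qed (simp add: lincomb_Suc lin)

lemma T_lincomb2: "T u (lincomb m c w) v = (\<Sum>j<m. c j * T u (w j) v)"
  by (simp add: sym12[of u] T_lincomb)

lemma T_lincomb3: "T u v (lincomb m c w) = (\<Sum>j<m. c j * T u v (w j))"
  by (simp add: sym23[of u v] T_lincomb2)

text \<open>In coordinates on the span of the \<open>w j\<close>, the cubic is a form over K in m >=
  g variables. Only the coordinate vector is known to be nonzero; for the combination itself this
  must come from independence of the \<open>w j\<close>.\<close>

lemma zero_on_span:
  assumes "complex_subfield K" "gamma_field K = enat g" "g \<le> m" and w: "\<And>j i. j < m \<Longrightarrow> w j i \<in> K"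
  obtains c where "\<And>j. c j \<in> K" "\<exists>j<m. c j \<noteq> 0"
    "T (lincomb m c w) (lincomb m c w) (lincomb m c w) = 0"
proof -
  interpret K: complex_subfield K by fact
  obtain D where D: "cubic_form m D" "range (Poly_Mapping.lookup D) \<subseteq> K"
    "\<And>x. eval_poly D x = (\<Sum>i<m. \<Sum>j<m. \<Sum>k<m. T (w i) (w j) (w k) * (x $ i * x $ j * x $ k))"
  proof (rule cubic_form_from_coefficients[of K m "\<lambda>i j k. T (w i) (w j) (w k)"])
    show "T (w i) (w j) (w k) \<in> K" if "i < m" "j < m" "k < m" for i j k
      using w that by (intro T_closed[OF assms(1)]) auto
  qed (use assms(1) in auto)
  obtain x where x: "x \<in> carrier_vec m" "\<forall>i<m. x $ i \<in> K" "x \<noteq> 0\<^sub>v m" "eval_poly D x = 0"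
    using gamma_field_zero[OF assms(2,3) D(1,2)] by blast
  define c where "c = (\<lambda>j. if j < m then x $ j else 0)"
  have "T (lincomb m c w) (lincomb m c w) (lincomb m c w) =
      (\<Sum>i<m. \<Sum>j<m. \<Sum>k<m. c i * (c j * (c k * T (w i) (w j) (w k))))"
    by (simp only: T_lincomb, simp only: T_lincomb2, simp only: T_lincomb3 sum_distrib_left)
  also have "\<dots> = eval_poly D x"
    unfolding D(3) by (intro sum.cong refl) (simp add: c_def)
  finally have "T (lincomb m c w) (lincomb m c w) (lincomb m c w) = 0" using x by simp
  moreover have "\<exists>j<m. c j \<noteq> 0"
    using x(1,3) by (auto simp: c_def vec_eq_iff)
  moreover have "c j \<in> K" for j using x(2) K.zero by (simp add: c_def)
  ultimately show ?thesis using that by blast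
qed

lemma cube_combo:
  "T (combo a u b v) (combo a u b v) (combo a u b v) =
    a^3 * T u u u + 3 * a^2 * b * T u u v + 3 * a * b^2 * T u v v + b^3 * T v v v"
  by (simp add: lin lin2 lin3 sym12 sym23 power2_eq_square power3_eq_cube algebra_simps)

lemma square_combo: "T w (combo a u b v) (combo a u b v) = a^2 * T w u u + 2 * a * b * T w u v + b^2 * T w v v"
  by (simp add: lin2 lin3 sym23[of w v u] power2_eq_square algebra_simps)

lemma cube_combo3:
  assumes w_def: "w = combo 1 (combo a x b u) c v"
  shows "T w w w = a^3 * T x x x + 3 * a^2 * (b * T x x u + c * T x x v)
    + 3 * a * (b^2 * T x u u + 2 * b * c * T x u v + c^2 * T x v v)
    + (b^3 * T u u u + 3 * b^2 * c * T u u v + 3 * b * c^2 * T u v v + c^3 * T v v v)"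
proof -
  have w: "w = combo a x 1 (combo b u c v)" by (simp add: w_def combo_def algebra_simps)
  show ?thesis
    unfolding w cube_combo[of a x 1 "combo b u c v"] cube_combo[of b u c v]
      square_combo[of x b u c v] lin3[of x x b u c v] by simp
qed

end

section \<open>Orthogonal bases and isotropic subspaces\<close>

text \<open>Independence modulo the line of \<open>x\<close>. The coefficients are arbitrary complex
  numbers even for rational vectors, so that combinations over K are covered.\<close>

definition indep_mod :: "nat \<Rightarrow> (nat \<Rightarrow> nat \<Rightarrow> complex) \<Rightarrow> (nat \<Rightarrow> complex) \<Rightarrow> bool" where
  "indep_mod m f x \<longleftrightarrow> (\<forall>c d. (\<forall>i. lincomb m c f i + d * x i = 0) \<longrightarrow> (\<forall>j<m. c j = 0))"

lemma indep_modD: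
  "indep_mod m f x \<Longrightarrow> (\<And>i. lincomb m c f i + d * x i = 0) \<Longrightarrow> j < m \<Longrightarrow> c j = 0"
  unfolding indep_mod_def by blast

lemma indep_mod_permute:
  assumes "indep_mod m f x" "\<tau> permutes {..<m}"
  shows "indep_mod m (\<lambda>j. f (\<tau> j)) x"
  unfolding indep_mod_def
proof (intro allI impI)
  fix c d j assume z: "\<forall>i. lincomb m c (\<lambda>j. f (\<tau> j)) i + d * x i = 0" and j: "j < m"
  have "lincomb m c (\<lambda>j. f (\<tau> j)) i = lincomb m (\<lambda>j. c (inv_into UNIV \<tau> j)) f i" for i
  proof -
    have "(\<Sum>j<m. c (inv_into UNIV \<tau> j) * f j i) = (\<Sum>j<m. c (inv_into UNIV \<tau> (\<tau> j)) * f (\<tau> j) i)"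
      using sum.permute[OF assms(2), of "\<lambda>j. c (inv_into UNIV \<tau> j) * f j i"] by (simp add: o_def)
    then show ?thesis by (simp add: lincomb_def permutes_inverses[OF assms(2)])
  qed
  then have "c (inv_into UNIV \<tau> (\<tau> j)) = 0"
    using z j permutes_in_image[OF assms(2), of j]
    by (intro indep_modD[OF assms(1), of "\<lambda>j. c (inv_into UNIV \<tau> j)" d]) auto
  then show "c j = 0" by (simp add: permutes_inverses[OF assms(2)])
qed

lemma indep_mod_add:
  assumes "indep_mod m f x" "j < m" "k < m" "j \<noteq> k"
  shows "indep_mod m (f(j := combo 1 (f j) 1 (f k))) x"
  unfolding indep_mod_def
proof (intro allI impI)
  fix c d l
  assume z: "\<forall>i. lincomb m c (f(j := combo 1 (f j) 1 (f k))) i + d * x i = 0" and l: "l < m"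
  define c' where "c' = c(k := c k + c j)"
  have "lincomb m c (f(j := combo 1 (f j) 1 (f k))) i = lincomb m c' f i" for i
  proof -
    have "lincomb m c (f(j := combo 1 (f j) 1 (f k))) i = (\<Sum>l<m. c l * f l i + (if l = j then c j * f k i else 0))"
      unfolding lincomb_def by (intro sum.cong refl) (simp add: combo_def algebra_simps)
    also have "\<dots> = (\<Sum>l<m. c l * f l i) + c j * f k i"
      using assms(2) by (simp add: sum.distrib)
    also have "\<dots> = (\<Sum>l<m. c l * f l i + (if l = k then c j * f k i else 0))"
      using assms(3) by (simp add: sum.distrib)
    also have "\<dots> = lincomb m c' f i"
      unfolding lincomb_def by (intro sum.cong refl) (simp add: c'_def algebra_simps)
    finally show ?thesis .
  qed
  then have c': "c' l = 0" if "l < m" for l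
    using z that by (intro indep_modD[OF assms(1), of c' d]) auto
  have "c j = 0" using c'[OF assms(2)] assms(4) by (simp add: c'_def)
  then show "c l = 0" using c'[OF l] by (auto simp: c'_def split: if_splits)
qed

context sym_trilinear
begin

text \<open>Gram-Schmidt over \<open>\<rat>\<close> for the form \<open>T x\<close> (possibly degenerate), modulo \<open>x\<close> itself,
  which lies in the radical.\<close>

lemma orthogonal_basis:
  assumes "\<And>a b u v. a \<in> \<rat> \<Longrightarrow> b \<in> \<rat> \<Longrightarrow> u \<in> V \<Longrightarrow> v \<in> V \<Longrightarrow> combo a u b v \<in> V"
    and "\<And>u v. u \<in> V \<Longrightarrow> v \<in> V \<Longrightarrow> T x u v \<in> \<rat>"
    and "\<And>v. v \<in> V \<Longrightarrow> T x x v = 0"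
    and "\<And>j. j < m \<Longrightarrow> f j \<in> V" "indep_mod m f x"
  shows "\<exists>e. (\<forall>j<m. e j \<in> V) \<and> indep_mod m e x \<and> (\<forall>j<m. \<forall>k<m. j \<noteq> k \<longrightarrow> T x (e j) (e k) = 0)"
  using assms
proof (induction m arbitrary: f V)
  case (Suc m)
  note V = Suc.prems(1-3) and f = Suc.prems(4,5)
  \<comment> \<open>The pivot step. The induction passes to the part \<open>V'\<close> of
    \<open>V\<close> orthogonal to the pivot, which is why \<open>V\<close> is generalised.\<close>
  have main: ?case if f': "\<And>j. j < Suc m \<Longrightarrow> f' j \<in> V" "indep_mod (Suc m) f' x" "T x (f' m) (f' m) \<noteq> 0" for f'
  proof -
    define p where "p = f' m"
    have p: "p \<in> V" "T x p p \<noteq> 0" using f'(1)[of m] f'(3) by (simp_all add: p_def)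
    define \<alpha> where "\<alpha> = (\<lambda>j. T x (f' j) p / T x p p)"
    define g where "g = (\<lambda>j. combo 1 (f' j) (- \<alpha> j) p)"
    define V' where "V' = {v \<in> V. T x v p = 0}"
    have "\<exists>e. (\<forall>j<m. e j \<in> V') \<and> indep_mod m e x \<and> (\<forall>j<m. \<forall>k<m. j \<noteq> k \<longrightarrow> T x (e j) (e k) = 0)"
    proof (rule Suc.IH)
      show "combo a u b v \<in> V'" if "a \<in> \<rat>" "b \<in> \<rat>" "u \<in> V'" "v \<in> V'" for a b u v
        using that V(1) by (simp add: V'_def lin2)
      show "g j \<in> V'" if "j < m" for j
      proof -
        have "f' j \<in> V" using f'(1)[of j] that by simp
        then have "\<alpha> j \<in> \<rat>" unfolding \<alpha>_def using V(2) p by (intro Rats_divide) auto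
        then have "g j \<in> V" unfolding g_def using \<open>f' j \<in> V\<close> p by (intro V(1)) auto
        moreover have "T x (g j) p = 0" using p by (simp add: g_def lin2 \<alpha>_def)
        ultimately show ?thesis by (simp add: V'_def)
      qed
      show "indep_mod m g x"
        unfolding indep_mod_def
      proof (intro allI impI)
        fix c d j assume z: "\<forall>i. lincomb m c g i + d * x i = 0" and j: "j < m"
        define c' where "c' = c(m := - (\<Sum>j<m. c j * \<alpha> j))"
        have "lincomb (Suc m) c' f' i = lincomb m c g i" for i
          by (simp add: lincomb_def c'_def g_def combo_def p_def right_diff_distrib sum_subtractf sum_distrib_right mult.assoc)
        then have "c' j = 0" using z j by (intro indep_modD[OF f'(2), of c' d]) auto
        then show "c j = 0" using j by (simp add: c'_def)
      qed
    qed (use V in \<open>auto simp: V'_def\<close>)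
    then obtain e where e: "\<And>j. j < m \<Longrightarrow> e j \<in> V'" "indep_mod m e x"
      "\<And>j k. j < m \<Longrightarrow> k < m \<Longrightarrow> j \<noteq> k \<Longrightarrow> T x (e j) (e k) = 0" by blast
    define e' where "e' = e(m := p)"
    have ep: "T x (e j) p = 0" if "j < m" for j using e(1)[OF that] by (simp add: V'_def)
    have "e' j \<in> V" if "j < Suc m" for j
      using that e(1)[of j] p by (cases "j = m") (auto simp: e'_def V'_def)
    moreover have "T x (e' j) (e' k) = 0" if "j < Suc m" "k < Suc m" "j \<noteq> k" for j k
      using that e(3)[of j k] ep[of j] ep[of k] sym23[of x p] by (auto simp: e'_def less_Suc_eq)
    moreover have "indep_mod (Suc m) e' x"
      unfolding indep_mod_def
    proof (intro allI impI)
      fix c d j assume z: "\<forall>i. lincomb (Suc m) c e' i + d * x i = 0" and j: "j < Suc m"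
      have e'p: "e' m = p" by (simp add: e'_def)
      have e'm: "lincomb m c e' = lincomb m c e" by (simp add: lincomb_def e'_def)
      have "combo 1 (lincomb (Suc m) c e') d x = combo 0 x 0 x"
        using z by (simp add: combo_def)
      \<comment> \<open>Pairing the relation with \<open>p\<close> removes the \<open>e j\<close>
        and, because T x x p = 0, also \<open>x\<close>; only \<open>c m * T x p p\<close>
        remains.\<close>
      then have "T x (combo 1 (lincomb (Suc m) c e') d x) p = 0" by (simp add: lin2)
      moreover have "T x (lincomb m c e) p = 0" by (simp add: T_lincomb2 ep)
      ultimately have "c m * T x p p = 0"
        using V(3)[OF p(1)] by (simp add: lincomb_Suc e'm e'p lin2)
      then have "c m = 0" using p by simp
      then have "lincomb (Suc m) c e' = lincomb m c e" by (simp add: lincomb_Suc e'm) (simp add: combo_def)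
      then have "c j = 0" if "j < m" for j using z that by (intro indep_modD[OF e(2), of c d]) auto
      with \<open>c m = 0\<close> j show "c j = 0" by (auto simp: less_Suc_eq)
    qed
    ultimately show ?thesis by blast
  qed
  have diag: ?case if f': "\<And>j. j < Suc m \<Longrightarrow> f' j \<in> V" "indep_mod (Suc m) f' x" "k < Suc m" "T x (f' k) (f' k) \<noteq> 0" for f' k
  proof (rule main)
    let ?t = "Transposition.transpose k m"
    have perm: "?t permutes {..<Suc m}" using f'(3) by (intro permutes_swap_id) auto
    show "indep_mod (Suc m) (\<lambda>j. f' (?t j)) x" using indep_mod_permute[OF f'(2) perm] .
    show "f' (?t j) \<in> V" if "j < Suc m" for j
      using that permutes_in_image[OF perm, of j] f'(1) by simp
    show "T x (f' (?t m)) (f' (?t m)) \<noteq> 0" using f'(4) by simp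
  qed
  show ?case
  proof (cases "\<exists>j<Suc m. \<exists>k<Suc m. T x (f j) (f k) \<noteq> 0")
    case True
    then obtain j k where jk: "j < Suc m" "k < Suc m" "T x (f j) (f k) \<noteq> 0" by blast
    show ?thesis
    proof (cases "T x (f j) (f j) \<noteq> 0 \<or> T x (f k) (f k) \<noteq> 0")
      case True
      then show ?thesis using diag f jk by blast
    next
      case False
      \<comment> \<open>Both diagonal values vanish, so the form takes the nonzero value 2 T x (f j)
        (f k) at f j + f k.\<close>
      then have "j \<noteq> k" using jk by auto
      show ?thesis
      proof (rule diag)
        show "indep_mod (Suc m) (f(j := combo 1 (f j) 1 (f k))) x"
          using f jk \<open>j \<noteq> k\<close> by (intro indep_mod_add) auto
        show "(f(j := combo 1 (f j) 1 (f k))) l \<in> V" if "l < Suc m" for l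
          using that f(1) jk V(1) by auto
        show "T x ((f(j := combo 1 (f j) 1 (f k))) j) ((f(j := combo 1 (f j) 1 (f k))) j) \<noteq> 0"
          using False jk by (simp add: square_combo)
      qed (use jk in auto)
    qed
  next
    case False
    then show ?thesis using f by (intro exI[of _ f]) auto
  qed
qed (auto simp: indep_mod_def)

end

locale splitting_group = complex_subfield +
  fixes G :: "complex set"
  assumes G_Rats: "G \<subseteq> \<rat> - {0}"
    and G_mult: "\<And>a b. a \<in> G \<Longrightarrow> b \<in> G \<Longrightarrow> a * b \<in> G"
    and G_uminus: "\<And>a. a \<in> G \<Longrightarrow> - a \<in> G"
    and G_rep: "\<And>a b. a \<in> G \<Longrightarrow> b \<in> G \<Longrightarrow> rep a b"
begin

lemma ternary_isotropic:
  assumes "a \<in> G" "b \<in> G" "c \<in> G"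
  obtains x y where "x \<in> K" "y \<in> K" "a * x\<^sup>2 + b * y\<^sup>2 + c = 0"
proof -
  \<comment> \<open>Multiplied by a, the form is (a x)^2 + ab y^2 + ac, so a zero amounts to
    representing -ac by X^2 + ab y^2.\<close>
  have "rep (- (a * b)) (- (a * c))" using assms by (intro G_rep G_uminus G_mult)
  then obtain X y where X: "X \<in> K" "y \<in> K" "- (a * c) = X\<^sup>2 - - (a * b) * y\<^sup>2" by (auto simp: rep_def)
  have a: "a \<noteq> 0" "a \<in> K" using assms(1) G_Rats Rats by auto
  have "a * (X / a)\<^sup>2 + b * y\<^sup>2 + c = (X\<^sup>2 + a * b * y\<^sup>2 + a * c) / a"
    using a by (simp add: power2_eq_square field_simps)
  also have "X\<^sup>2 + a * b * y\<^sup>2 = - (a * c)" unfolding X(3) by simp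
  finally have "a * (X / a)\<^sup>2 + b * y\<^sup>2 + c = 0" by simp
  with X a that show ?thesis by (blast intro: divide)
qed

text \<open>\<open>(w\<^sub>0, w\<^sub>1, w\<^sub>2)\<close> is isotropic and \<open>(v\<^sub>0, v\<^sub>1, v\<^sub>2)\<close> is orthogonal to it; for nonzero \<open>a, b, c\<close>
  this is the splitting of \<open>\<langle>a, b, c\<rangle>\<close> as a hyperbolic plane plus \<open>\<langle>-abc\<rangle>\<close>.\<close>

lemma ternary_split:
  assumes "a \<in> insert 0 G" "b \<in> insert 0 G" "c \<in> insert 0 G"
  obtains w0 w1 w2 v0 v1 v2 where
    "w0 \<in> K" "w1 \<in> K" "w2 \<in> K" "v0 \<in> K" "v1 \<in> K" "v2 \<in> K"
    "a * w0 * w0 + b * w1 * w1 + c * w2 * w2 = 0" "a * w0 * v0 + b * w1 * v1 + c * w2 * v2 = 0"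
    "a * v0 * v0 + b * v1 * v1 + c * v2 * v2 \<in> insert 0 G"
    "\<forall>\<alpha> \<beta>. \<alpha> * w0 + \<beta> * v0 = 0 \<and> \<alpha> * w1 + \<beta> * v1 = 0 \<and> \<alpha> * w2 + \<beta> * v2 = 0 \<longrightarrow> \<alpha> = 0 \<and> \<beta> = 0"
proof -
  consider "a = 0" | "b = 0" | "c = 0" | "a \<in> G" "b \<in> G" "c \<in> G" using assms by auto
  then show ?thesis
  proof cases
    case 1
    \<comment> \<open>With a zero coefficient, w is the basis vector in the radical, and v is
      another basis vector, whose value is a given coefficient.\<close>
    show ?thesis by (rule that[of 1 0 0 0 1 0]) (use assms zero one 1 in auto)
  next
    case 2
    show ?thesis by (rule that[of 0 1 0 1 0 0]) (use assms zero one 2 in auto)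
  next
    case 3
    show ?thesis by (rule that[of 0 0 1 1 0 0]) (use assms zero one 3 in auto)
  next
    case 4
    then obtain x y where xy: "x \<in> K" "y \<in> K" "a * x\<^sup>2 + b * y\<^sup>2 + c = 0" by (rule ternary_isotropic)
    have abc: "a \<in> K" "b \<in> K" "c \<in> K" "a \<noteq> 0" "b \<noteq> 0" "c \<noteq> 0" using 4 G_Rats Rats by auto
    have "x \<noteq> 0 \<or> y \<noteq> 0" using xy abc by auto
    have c: "c = - (a * x\<^sup>2 + b * y\<^sup>2)" using xy(3) by (metis add.commute eq_neg_iff_add_eq_0)
    have 1: "a * x * x + b * y * y + c * 1 * 1 = 0" using xy(3) by (simp add: power2_eq_square algebra_simps)
    have 2: "a * x * (b * y) + b * y * (- (a * x)) + c * 1 * 0 = 0" by simp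
    \<comment> \<open>The vector v = (b y, -a x, 0) is orthogonal to the isotropic w = (x, y, 1),
      and its value is ab(b y^2 + a x^2) = -abc.\<close>
    have "a * (b * y) * (b * y) + b * (- (a * x)) * (- (a * x)) + c * 0 * 0 = a * b * (- c)"
      unfolding c by (simp add: power2_eq_square algebra_simps)
    moreover have "a * b * (- c) \<in> G" using 4 by (intro G_mult G_uminus)
    ultimately have 3: "a * (b * y) * (b * y) + b * (- (a * x)) * (- (a * x)) + c * 0 * 0 \<in> insert 0 G" by simp
    have 5: "b * y \<in> K" "- (a * x) \<in> K" using xy abc by (auto intro: closed)
    show ?thesis
    proof (rule that[OF xy(1,2) one 5 zero 1 2 3])
      show "\<forall>\<alpha> \<beta>. \<alpha> * x + \<beta> * (b * y) = 0 \<and> \<alpha> * y + \<beta> * (- (a * x)) = 0 \<and> \<alpha> * 1 + \<beta> * 0 = 0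
          \<longrightarrow> \<alpha> = 0 \<and> \<beta> = 0"
        using abc \<open>x \<noteq> 0 \<or> y \<noteq> 0\<close> by auto
    qed
  qed
qed

text \<open>The induction replaces the last three diagonal entries by the single value of v, which
  leads from 2k+3 to 2k+1 variables, and adjoins the isotropic vector w orthogonal to v.\<close>

lemma totally_isotropic:
  fixes k :: nat
  assumes "\<And>i. i < 2 * k + 1 \<Longrightarrow> a i \<in> insert 0 G"
  shows "\<exists>W. (\<forall>j i. W j i \<in> K) \<and> (\<forall>j<k. \<forall>j'<k. (\<Sum>i<2*k+1. a i * W j i * W j' i) = 0) \<and>
    (\<forall>c. (\<forall>i<2*k+1. (\<Sum>j<k. c j * W j i) = 0) \<longrightarrow> (\<forall>j<k. c j = 0))"
  using assms
proof (induction k arbitrary: a)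
  case 0
  show ?case using zero by (intro exI[of _ "\<lambda>_ _. 0"]) auto
next
  case (Suc k)
  have "a (2*k) \<in> insert 0 G" "a (2*k+1) \<in> insert 0 G" "a (2*k+2) \<in> insert 0 G" using Suc.prems by auto
  then obtain w0 w1 w2 v0 v1 v2 where
    wK: "w0 \<in> K" "w1 \<in> K" "w2 \<in> K" "v0 \<in> K" "v1 \<in> K" "v2 \<in> K" and
    ww: "a (2*k) * w0 * w0 + a (2*k+1) * w1 * w1 + a (2*k+2) * w2 * w2 = 0" and
    wv: "a (2*k) * w0 * v0 + a (2*k+1) * w1 * v1 + a (2*k+2) * w2 * v2 = 0" and
    vv: "a (2*k) * v0 * v0 + a (2*k+1) * v1 * v1 + a (2*k+2) * v2 * v2 \<in> insert 0 G" and
    ind: "\<forall>\<alpha> \<beta>. \<alpha> * w0 + \<beta> * v0 = 0 \<and> \<alpha> * w1 + \<beta> * v1 = 0 \<and> \<alpha> * w2 + \<beta> * v2 = 0 \<longrightarrow> \<alpha> = 0 \<and> \<beta> = 0"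
    by (rule ternary_split)
  define e where "e = a (2*k) * v0 * v0 + a (2*k+1) * v1 * v1 + a (2*k+2) * v2 * v2"
  have "(a(2*k := e)) i \<in> insert 0 G" if "i < 2 * k + 1" for i
    using that vv Suc.prems by (auto simp: e_def)
  then have "\<exists>W. (\<forall>j i. W j i \<in> K) \<and> (\<forall>j<k. \<forall>j'<k. (\<Sum>i<2*k+1. (a(2*k := e)) i * W j i * W j' i) = 0) \<and>
    (\<forall>c. (\<forall>i<2*k+1. (\<Sum>j<k. c j * W j i) = 0) \<longrightarrow> (\<forall>j<k. c j = 0))" by (rule Suc.IH)
  then obtain W where W: "(\<forall>j i. W j i \<in> K) \<and> (\<forall>j<k. \<forall>j'<k. (\<Sum>i<2*k+1. (a(2*k := e)) i * W j i * W j' i) = 0) \<and>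
    (\<forall>c. (\<forall>i<2*k+1. (\<Sum>j<k. c j * W j i) = 0) \<longrightarrow> (\<forall>j<k. c j = 0))" ..
  have WK: "W j i \<in> K" for j i using W by simp
  have Worth: "(\<Sum>i<2*k+1. (a(2*k := e)) i * W j i * W j' i) = 0" if "j < k" "j' < k" for j j'
    using W that by blast
  have Wind: "\<forall>j<k. c j = 0" if "\<And>i. i < 2*k+1 \<Longrightarrow> (\<Sum>j<k. c j * W j i) = 0" for c
    using W that by blast
  \<comment> \<open>The rows below \<open>k\<close> are the old vectors with their last coordinate
    spread along v; row \<open>k\<close> is w.\<close>
  define W' where "W' = (\<lambda>j i. if j < k then (if i < 2*k then W j i else if i = 2*k then W j (2*k) * v0
      else if i = 2*k+1 then W j (2*k) * v1 else W j (2*k) * v2)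
    else (if i < 2*k then 0 else if i = 2*k then w0 else if i = 2*k+1 then w1 else w2))"
  have split: "(\<Sum>i<2*Suc k+1. h i) = (\<Sum>i<2*k. h i) + (h (2*k) + h (2*k+1) + h (2*k+2))" for h :: "nat \<Rightarrow> complex"
    by (simp add: add.assoc)
  have W1: "(\<Sum>i<2*Suc k+1. a i * W' j i * W' j' i) = 0" if "j < k" "j' < k" for j j'
  proof -
    have "(\<Sum>i<2*k. a i * W' j i * W' j' i) = (\<Sum>i<2*k. (a(2*k := e)) i * W j i * W j' i)"
      using that by (intro sum.cong) (auto simp: W'_def)
    moreover have "a (2*k) * W' j (2*k) * W' j' (2*k) + a (2*k+1) * W' j (2*k+1) * W' j' (2*k+1)
      + a (2*k+2) * W' j (2*k+2) * W' j' (2*k+2) = e * W j (2*k) * W j' (2*k)"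
      using that by (simp add: W'_def e_def algebra_simps)
    ultimately have "(\<Sum>i<2*Suc k+1. a i * W' j i * W' j' i) = (\<Sum>i<2*k+1. (a(2*k := e)) i * W j i * W j' i)"
      unfolding split by simp
    then show ?thesis using Worth[OF that] by simp
  qed
  have W2: "(\<Sum>i<2*Suc k+1. a i * W' j i * W' k i) = 0" "(\<Sum>i<2*Suc k+1. a i * W' k i * W' j i) = 0" if "j < k" for j
  proof -
    have "a (2*k) * W' j (2*k) * W' k (2*k) + a (2*k+1) * W' j (2*k+1) * W' k (2*k+1)
      + a (2*k+2) * W' j (2*k+2) * W' k (2*k+2)
      = W j (2*k) * (a (2*k) * w0 * v0 + a (2*k+1) * w1 * v1 + a (2*k+2) * w2 * v2)"
      using that by (simp add: W'_def algebra_simps)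
    then show *: "(\<Sum>i<2*Suc k+1. a i * W' j i * W' k i) = 0"
      unfolding split wv by (simp add: W'_def)
    show "(\<Sum>i<2*Suc k+1. a i * W' k i * W' j i) = 0"
      using * by (simp only: mult.assoc mult.commute[of "W' k _"])
  qed
  have W3: "(\<Sum>i<2*Suc k+1. a i * W' k i * W' k i) = 0"
    unfolding split using ww by (simp add: W'_def)
  have orth: "(\<Sum>i<2*Suc k+1. a i * W' j i * W' j' i) = 0" if jj': "j < Suc k" "j' < Suc k" for j j'
  proof -
    consider "j < k" "j' < k" | "j < k" "j' = k" | "j = k" "j' < k" | "j = k" "j' = k"
      using jj' less_Suc_eq by auto
    then show ?thesis by cases (simp_all only: W1 W2 W3)
  qed
  have inj: "c j = 0" if z: "\<And>i. i < 2*Suc k+1 \<Longrightarrow> (\<Sum>j<Suc k. c j * W' j i) = 0" and "j < Suc k" for c j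
  proof -
    define \<beta> where "\<beta> = (\<Sum>j<k. c j * W j (2*k))"
    have \<beta>: "\<beta> * v = (\<Sum>j<k. c j * (W j (2*k) * v))" for v
      by (simp add: \<beta>_def sum_distrib_right mult.assoc)
    have "c k * w0 + \<beta> * v0 = 0" using z[of "2*k"] by (simp add: W'_def \<beta> add.commute)
    moreover have "c k * w1 + \<beta> * v1 = 0" using z[of "2*k+1"] by (simp add: W'_def \<beta> add.commute)
    moreover have "c k * w2 + \<beta> * v2 = 0" using z[of "2*k+2"] by (simp add: W'_def \<beta> add.commute)
    ultimately have "c k = 0" "\<beta> = 0" using ind by blast+
    have "(\<Sum>j<k. c j * W j i) = 0" if "i < 2*k+1" for i
    proof (cases "i = 2*k")
      case False
      then have "(\<Sum>j<k. c j * W j i) = (\<Sum>j<Suc k. c j * W' j i)"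
        using that \<open>c k = 0\<close> by (simp add: W'_def)
      then show ?thesis using z[of i] that by simp
    qed (use \<open>\<beta> = 0\<close> in \<open>simp add: \<beta>_def\<close>)
    from Wind[OF this] \<open>c k = 0\<close> \<open>j < Suc k\<close> show ?thesis by (auto simp: less_Suc_eq)
  qed
  have "W' j i \<in> K" for j i using WK wK zero by (auto simp: W'_def intro: mult)
  with orth inj show ?case by (intro exI[of _ W'] conjI allI impI) blast+
qed

end

section \<open>Rational points and lines\<close>

text \<open>The form 3aP + 3bQ + cR will be the equation of the residual line in a plane with
  coordinates (a, b, c).\<close>

lemma linear_form_solutions:
  fixes P Q R :: complex
  assumes "P \<in> \<rat>" "Q \<in> \<rat>" "R \<in> \<rat>"
  obtains a1 b1 c1 a2 b2 c2 where "a1 \<in> \<rat>" "b1 \<in> \<rat>" "c1 \<in> \<rat>" "a2 \<in> \<rat>" "b2 \<in> \<rat>" "c2 \<in> \<rat>"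
    "3 * a1 * P + 3 * b1 * Q + c1 * R = 0" "3 * a2 * P + 3 * b2 * Q + c2 * R = 0"
    "\<forall>a b. a * a1 + b * a2 = 0 \<and> a * b1 + b * b2 = 0 \<and> a * c1 + b * c2 = 0 \<longrightarrow> a = 0 \<and> b = 0"
proof -
  consider "P \<noteq> 0" | "P = 0" "Q \<noteq> 0" | "P = 0" "Q = 0" by auto
  then show ?thesis
  proof cases
    case 1
    show ?thesis by (rule that[of "- Q" P 0 "- R" 0 "3 * P"]) (use 1 assms in auto)
  next
    case 2
    show ?thesis by (rule that[of 1 0 0 0 "- R" "3 * Q"]) (use 2 assms in auto)
  next
    case 3
    show ?thesis by (rule that[of 1 0 0 0 1 0]) (use 3 in auto)
  qed
qed

locale trilinear_over_field = sym_trilinear T + imaginary_root q s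
  for T :: "(nat \<Rightarrow> complex) \<Rightarrow> (nat \<Rightarrow> complex) \<Rightarrow> (nat \<Rightarrow> complex) \<Rightarrow> complex" and q s
begin

lemma T_Rats: "(\<And>i. u i \<in> \<rat>) \<Longrightarrow> (\<And>i. v i \<in> \<rat>) \<Longrightarrow> (\<And>i. w i \<in> \<rat>) \<Longrightarrow> T u v w \<in> \<rat>"
  by (rule T_closed) (unfold_locales, auto)

lemma rational_parts:
  assumes "\<And>i. z i \<in> quadratic_field s"
  obtains u v where "\<forall>i. u i \<in> \<rat>" "\<forall>i. v i \<in> \<rat>" "z = combo 1 u s v" "\<forall>i. z i = 0 \<longrightarrow> u i = 0 \<and> v i = 0"
proof -
  have "\<forall>i. \<exists>x y. x \<in> \<rat> \<and> y \<in> \<rat> \<and> z i = x + s * y" using assms unfolding quadratic_field_def by blast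
  then obtain u v where uv: "\<And>i. u i \<in> \<rat>" "\<And>i. v i \<in> \<rat>" "\<And>i. z i = u i + s * v i" by metis
  have "u i = 0 \<and> v i = 0" if "z i = 0" for i
    using independent_parts[of "u i" "v i"] uv(1,2) uv(3)[of i] that by simp
  moreover have "z = combo 1 u s v" by (rule ext) (simp only: combo_def uv(3) mult_1)
  ultimately show ?thesis using that[of u v] uv(1,2) by blast
qed

text \<open>Expand T at u + s v using s^2 = -q, and separate the rational part from the multiple of
  s.\<close>

lemma cubic_zero_parts:
  assumes u: "\<And>i. u i \<in> \<rat>" and v: "\<And>i. v i \<in> \<rat>" and z: "z = combo 1 u s v" and "T z z z = 0"
  shows "T u u u = 3 * of_nat q * T u v v" "3 * T u u v = of_nat q * T v v v"
proof -
  have "T z z z = T u u u + 3 * s * T u u v + 3 * s\<^sup>2 * T u v v + s\<^sup>2 * s * T v v v"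
    unfolding z cube_combo by (simp add: power3_eq_cube power2_eq_square)
  also have "\<dots> = (T u u u - 3 * of_nat q * T u v v) + s * (3 * T u u v - of_nat q * T v v v)"
    by (simp add: s_sq algebra_simps)
  finally have eq: "(T u u u - 3 * of_nat q * T u v v) + s * (3 * T u u v - of_nat q * T v v v) = 0"
    using assms(4) by simp
  have "T u u u - 3 * of_nat q * T u v v \<in> \<rat>" "3 * T u u v - of_nat q * T v v v \<in> \<rat>"
    using T_Rats u v by simp_all
  from independent_parts[OF this eq]
  show "T u u u = 3 * of_nat q * T u v v" "3 * T u u v = of_nat q * T v v v" by simp_all
qed

lemma cube_scale: "T (\<lambda>i. a * u i) (\<lambda>i. a * u i) (\<lambda>i. a * u i) = a^3 * T u u u"
proof -
  have "(\<lambda>i. a * u i) = combo a u 0 u" by (simp add: combo_def)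
  then show ?thesis by (simp add: cube_combo)
qed

text \<open>On the line through a \<open>K\<close>-rational zero \<open>z\<close> and its conjugate, the third zero is rational.\<close>

lemma rational_zero:
  assumes zK: "\<And>i. z i \<in> quadratic_field s" and "z \<noteq> (\<lambda>_. 0)" and "T z z z = 0"
  obtains x where "\<And>i. x i \<in> \<rat>" "x \<noteq> (\<lambda>_. 0)" "T x x x = 0" "\<And>i. z i = 0 \<Longrightarrow> x i = 0"
proof -
  obtain u v where uv': "\<forall>i. u i \<in> \<rat>" "\<forall>i. v i \<in> \<rat>" "z = combo 1 u s v"
    "\<forall>i. z i = 0 \<longrightarrow> u i = 0 \<and> v i = 0" by (rule rational_parts[OF zK])
  note uv = uv'(1,2)[rule_format] uv'(3) uv'(4)[rule_format]
  note parts = cubic_zero_parts[OF uv(1-3) assms(3)]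
  show ?thesis
  proof (cases "\<exists>b\<in>\<rat>. \<exists>c\<in>\<rat>. (b \<noteq> 0 \<or> c \<noteq> 0) \<and> combo b u c v = (\<lambda>_. 0)")
    case True
    then obtain b c where bc: "b \<in> \<rat>" "c \<in> \<rat>" "b \<noteq> 0 \<or> c \<noteq> 0" "\<And>i. b * u i + c * v i = 0"
      by (auto simp: combo_def fun_eq_iff)
    \<comment> \<open>If u and v are proportional, z is a scalar multiple of a rational vector,
      which is then itself a zero.\<close>
    have "\<exists>x \<kappa>. (\<forall>i. x i \<in> \<rat>) \<and> z = (\<lambda>i. \<kappa> * x i) \<and> (\<forall>i. z i = 0 \<longrightarrow> x i = 0)"
    proof (cases "b = 0")
      case True
      then have "v i = 0" for i using bc by auto
      then have "z = (\<lambda>i. 1 * u i)" unfolding uv(3) combo_def by simp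
      then show ?thesis
        by - (rule exI[of _ u], rule exI[of _ 1], intro conjI allI impI uv(1) uv(4)[THEN conjunct1])
    next
      case False
      then have "u i = (- c / b) * v i" for i using bc(4)[of i] by (simp add: field_simps eq_neg_iff_add_eq_0)
      then have "z = (\<lambda>i. (- c / b + s) * v i)" unfolding uv(3) combo_def by (simp add: fun_eq_iff algebra_simps)
      then show ?thesis
        by - (rule exI[of _ v], rule exI[of _ "- c / b + s"], intro conjI allI impI uv(2) uv(4)[THEN conjunct2])
    qed
    then obtain x \<kappa> where x: "\<And>i. x i \<in> \<rat>" "z = (\<lambda>i. \<kappa> * x i)" "\<And>i. z i = 0 \<Longrightarrow> x i = 0" by blast
    have nz: "\<kappa> \<noteq> 0" "x \<noteq> (\<lambda>_. 0)" using x(2) assms(2) by auto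
    have "\<kappa>^3 * T x x x = 0" using assms(3) unfolding x(2) cube_scale .
    then have "T x x x = 0" using nz(1) by simp
    show ?thesis by (rule that[OF x(1) nz(2) \<open>T x x x = 0\<close> x(3)])
  next
    case False
    \<comment> \<open>By \<open>parts\<close> the cubic at b u + c v is (q b^2 + c^2)(3 b T u v v +
      c T v v v). The pair (b, c) annihilates the linear factor; (1, 0) is taken when that factor is
      identically 0.\<close>
    define b where "b = (if T u v v = 0 \<and> T v v v = 0 then 1 else T v v v)"
    define c where "c = (if T u v v = 0 \<and> T v v v = 0 then 0 else - 3 * T u v v)"
    have bc: "b \<in> \<rat>" "c \<in> \<rat>" "b \<noteq> 0 \<or> c \<noteq> 0" using T_Rats uv(1,2) by (auto simp: b_def c_def)
    have "T (combo b u c v) (combo b u c v) (combo b u c v) =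
      b^3 * T u u u + b^2 * c * (3 * T u u v) + 3 * b * c^2 * T u v v + c^3 * T v v v"
      by (simp add: cube_combo)
    also have "\<dots> = (of_nat q * b^2 + c^2) * (3 * b * T u v v + c * T v v v)"
      unfolding parts by (simp add: power2_eq_square power3_eq_cube algebra_simps)
    also have "3 * b * T u v v + c * T v v v = 0" by (auto simp: b_def c_def)
    finally have 1: "T (combo b u c v) (combo b u c v) (combo b u c v) = 0" by simp
    have 2: "combo b u c v \<noteq> (\<lambda>_. 0)" using False bc by blast
    have 3: "combo b u c v i \<in> \<rat>" for i unfolding combo_def using bc(1,2) uv(1,2) by simp
    have 4: "combo b u c v i = 0" if "z i = 0" for i using uv(4)[OF that] by (simp add: combo_def)
    show ?thesis by (rule that[OF 3 2 1 4])
  qed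
qed

text \<open>The plane through \<open>x\<close>, \<open>z\<close> and the conjugate of \<open>z\<close> meets the cubic in the two conjugate lines
  joining \<open>x\<close> to \<open>z\<close> and to its conjugate; the residual line is rational.\<close>

lemma rational_line:
  assumes x: "\<And>i. x i \<in> \<rat>" and z: "\<And>i. z i \<in> quadratic_field s"
    and ind: "\<And>a b. (\<And>i. a * x i + b * z i = 0) \<Longrightarrow> a = 0 \<and> b = 0"
    and T: "T x x x = 0" "T x x z = 0" "T x z z = 0" "T z z z = 0"
  obtains y w where "\<And>i. y i \<in> \<rat>" "\<And>i. w i \<in> \<rat>"
    "\<And>a b. a \<in> \<rat> \<Longrightarrow> b \<in> \<rat> \<Longrightarrow> (\<And>i. a * y i + b * w i = 0) \<Longrightarrow> a = 0 \<and> b = 0"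
    "\<And>a b. T (combo a y b w) (combo a y b w) (combo a y b w) = 0"
    "\<And>i. x i = 0 \<Longrightarrow> z i = 0 \<Longrightarrow> y i = 0 \<and> w i = 0"
proof -
  obtain u v where uv': "\<forall>i. u i \<in> \<rat>" "\<forall>i. v i \<in> \<rat>" "z = combo 1 u s v"
    "\<forall>i. z i = 0 \<longrightarrow> u i = 0 \<and> v i = 0" by (rule rational_parts[OF z])
  note uv = uv'(1,2)[rule_format] uv'(3) uv'(4)[rule_format]
  note parts = cubic_zero_parts[OF uv(1-3) T(4)]
  have on_line: "T (combo a x b z) (combo a x b z) (combo a x b z) = 0" for a b
    unfolding cube_combo using T by simp
  show ?thesis
  proof (cases "\<exists>a\<in>\<rat>. \<exists>b\<in>\<rat>. \<exists>c\<in>\<rat>. (a \<noteq> 0 \<or> b \<noteq> 0 \<or> c \<noteq> 0) \<and> (\<forall>i. a * x i + b * u i + c * v i = 0)")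
    case True
    then obtain a b c where abc: "a \<noteq> 0 \<or> b \<noteq> 0 \<or> c \<noteq> 0" "\<And>i. a * x i + b * u i + c * v i = 0"
      and abc_Rats: "a \<in> \<rat>" "b \<in> \<rat>" "c \<in> \<rat>" by blast
    \<comment> \<open>If x, u, v are dependent over Q, the line through x and z is itself rational;
      \<open>y\<close> is a second rational point on it, distinct from x because \<open>e\<close> is
      nonzero.\<close>
    have "\<exists>y c' e. (\<forall>i. y i \<in> \<rat>) \<and> e \<noteq> 0 \<and> y = combo c' x e z \<and> (\<forall>i. z i = 0 \<longrightarrow> y i = 0)"
    proof (cases "b = 0")
      case True
      have "c \<noteq> 0"
      proof
        assume "c = 0"
        then have "a * x i + 0 * z i = 0" for i using abc(2)[of i] True by simp
        from ind[OF this] show False using abc(1) True \<open>c = 0\<close> by simp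
      qed
      then have v: "v i = - (a / c) * x i" for i
        using abc(2)[of i] True by (simp add: field_simps eq_neg_iff_add_eq_0)
      have "u = combo (s * (a / c)) x 1 z" unfolding uv(3) combo_def v by (simp add: fun_eq_iff)
      then show ?thesis
        by - (rule exI[of _ u], rule exI[of _ "s * (a / c)"], rule exI[of _ 1],
            intro conjI allI impI uv(1) uv(4)[THEN conjunct1] one_neq_zero)
    next
      case False
      define e where "e = s - c / b"
      have "e \<noteq> 0"
      proof
        assume "e = 0"
        then have "- c / b + s * 1 = 0" by (simp add: e_def)
        from independent_parts(2)[OF _ _ this] abc_Rats show False by simp
      qed
      have u: "u i = - (a / b) * x i - (c / b) * v i" for i
      proof -
        have "b * u i = - a * x i - c * v i" using abc(2)[of i] by (simp add: algebra_simps eq_neg_iff_add_eq_0)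
        then have "u i = (- a * x i - c * v i) / b" using False by (simp add: field_simps)
        then show ?thesis by (simp add: diff_divide_distrib)
      qed
      have "z = combo (- (a / b)) x e v" unfolding uv(3) combo_def u e_def by (simp add: fun_eq_iff algebra_simps)
      then have "v = combo (a / b / e) x (1 / e) z"
        using \<open>e \<noteq> 0\<close> by (simp add: combo_def fun_eq_iff add_divide_distrib diff_divide_distrib)
      moreover have "1 / e \<noteq> 0" using \<open>e \<noteq> 0\<close> by simp
      ultimately show ?thesis
        by - (rule exI[of _ v], rule exI[of _ "a / b / e"], rule exI[of _ "1 / e"],
            intro conjI allI impI uv(2) uv(4)[THEN conjunct2])
    qed
    then obtain y c' e where y: "\<And>i. y i \<in> \<rat>" "e \<noteq> 0" "y = combo c' x e z" "\<And>i. z i = 0 \<Longrightarrow> y i = 0" by blast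
    show ?thesis
    proof (rule that[of x y])
      fix a b assume *: "\<And>i. a * x i + b * y i = 0"
      have "(a + b * c') * x i + (b * e) * z i = 0" for i
        using *[of i] unfolding y(3) by (simp add: combo_def algebra_simps)
      from ind[OF this] show "a = 0 \<and> b = 0" using y(2) by auto
    next
      fix a b
      have "combo a x b y = combo (a + b * c') x (b * e) z"
        unfolding y(3) by (simp add: combo_def algebra_simps)
      then show "T (combo a x b y) (combo a x b y) (combo a x b y) = 0" using on_line by simp
      show "x i \<in> \<rat>" "y i \<in> \<rat>" for i by (rule x y(1))+
      show "x i = 0 \<and> y i = 0" if "x i = 0" "z i = 0" for i using that(1) y(4)[OF that(2)] by simp
    qed
  next
    case False
    define P Q R where "P = T x v v" and "Q = T u v v" and "R = T v v v"
    have PQR: "P \<in> \<rat>" "Q \<in> \<rat>" "R \<in> \<rat>" using T_Rats x uv(1,2) by (simp_all add: P_def Q_def R_def)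
    have "T x x u + s * T x x v = 0" using T(2) unfolding uv(3) lin3 by simp
    then have xx: "T x x u = 0" "T x x v = 0" using independent_parts[of "T x x u" "T x x v"] T_Rats x uv(1,2) by auto
    have "(T x u u - of_nat q * P) + s * (2 * T x u v) = 0"
      using T(3) unfolding uv(3) square_combo s_sq by (simp add: P_def algebra_simps)
    then have "T x u u - of_nat q * P = 0" "2 * T x u v = 0"
      using independent_parts[of "T x u u - of_nat q * P" "2 * T x u v"] T_Rats x uv(1,2) PQR by auto
    then have xz: "T x u u = of_nat q * P" "T x u v = 0" by simp_all
    \<comment> \<open>On the plane the cubic is the product of q b^2 + c^2, the two conjugate lines,
      and a rational linear form; independent solutions of the latter span the residual
      line.\<close>
    have cube: "T (combo 1 (combo a x b u) c v) (combo 1 (combo a x b u) c v) (combo 1 (combo a x b u) c v)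
        = (of_nat q * b^2 + c^2) * (3 * a * P + 3 * b * Q + c * R)" for a b c
    proof -
      have "T (combo 1 (combo a x b u) c v) (combo 1 (combo a x b u) c v) (combo 1 (combo a x b u) c v)
        = 3 * a * (b^2 * T x u u + c^2 * P) + b^3 * T u u u + b^2 * c * (3 * T u u v) + 3 * b * c^2 * Q + c^3 * R"
        unfolding cube_combo3[OF refl] by (simp add: T(1) xx xz P_def Q_def R_def)
      also have "\<dots> = (of_nat q * b^2 + c^2) * (3 * a * P + 3 * b * Q + c * R)"
        unfolding parts xz Q_def[symmetric] R_def[symmetric]
        by (simp add: power2_eq_square power3_eq_cube algebra_simps)
      finally show ?thesis .
    qed
    obtain a1 b1 c1 a2 b2 c2 where rat: "a1 \<in> \<rat>" "b1 \<in> \<rat>" "c1 \<in> \<rat>" "a2 \<in> \<rat>" "b2 \<in> \<rat>" "c2 \<in> \<rat>"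
      and L: "3 * a1 * P + 3 * b1 * Q + c1 * R = 0" "3 * a2 * P + 3 * b2 * Q + c2 * R = 0"
      and indep': "\<forall>a b. a * a1 + b * a2 = 0 \<and> a * b1 + b * b2 = 0 \<and> a * c1 + b * c2 = 0 \<longrightarrow> a = 0 \<and> b = 0"
      using PQR by (rule linear_form_solutions)
    note indep = indep'[rule_format, OF conjI, OF _ conjI]
    define y w where "y = combo 1 (combo a1 x b1 u) c1 v" and "w = combo 1 (combo a2 x b2 u) c2 v"
    have yw: "combo a y b w = combo 1 (combo (a * a1 + b * a2) x (a * b1 + b * b2) u) (a * c1 + b * c2) v" for a b
      by (simp add: y_def w_def combo_def algebra_simps)
    show ?thesis
    proof (rule that[of y w])
      fix a b :: complex assume ab: "a \<in> \<rat>" "b \<in> \<rat>" and *: "\<And>i. a * y i + b * w i = 0"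
      have "(a * a1 + b * a2) * x i + (a * b1 + b * b2) * u i + (a * c1 + b * c2) * v i = 0" for i
        using *[of i] by (simp add: y_def w_def combo_def algebra_simps)
      moreover have "a * a1 + b * a2 \<in> \<rat>" "a * b1 + b * b2 \<in> \<rat>" "a * c1 + b * c2 \<in> \<rat>" using ab rat by simp_all
      ultimately show "a = 0 \<and> b = 0" using False indep[of a b] by blast
    next
      fix a b
      have "3 * (a * a1 + b * a2) * P + 3 * (a * b1 + b * b2) * Q + (a * c1 + b * c2) * R =
          a * (3 * a1 * P + 3 * b1 * Q + c1 * R) + b * (3 * a2 * P + 3 * b2 * Q + c2 * R)"
        by (simp add: algebra_simps)
      then show "T (combo a y b w) (combo a y b w) (combo a y b w) = 0" unfolding yw cube L by simp
      show "y i \<in> \<rat>" "w i \<in> \<rat>" for i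
        unfolding y_def w_def combo_def using x uv(1,2) rat by simp_all
      show "y i = 0 \<and> w i = 0" if "x i = 0" "z i = 0" for i
        using that(1) uv(4)[OF that(2)] by (simp add: y_def w_def combo_def)
    qed
  qed
qed

end

section \<open>The main theorem\<close>

definition unit_fun :: "nat \<Rightarrow> nat \<Rightarrow> complex" where
  "unit_fun j = (\<lambda>i. if i = j then 1 else 0)"

lemma lincomb_unit_fun: "lincomb n c unit_fun i = (if i < n then c i else 0)"
  by (simp add: lincomb_def unit_fun_def if_distrib[of "\<lambda>x. _ * x"] cong: if_cong)

lemma lincomb_lincomb:
  "lincomb k c (\<lambda>j. lincomb m (W j) e) = lincomb m (\<lambda>l. \<Sum>j<k. c j * W j l) e"
  unfolding lincomb_def
  by (rule ext) (simp only: sum_distrib_left sum_distrib_right mult.assoc, rule sum.swap)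

lemma (in sym_trilinear) rational_zero_exists:
  assumes "enat n \<ge> gamma_sup" "n > 0"
  obtains x where "\<And>i. x i \<in> \<rat>" "x \<noteq> (\<lambda>_. 0)" "T x x x = 0" "\<And>i. i \<ge> n \<Longrightarrow> x i = 0"
proof -
  \<comment> \<open>Any imaginary quadratic field serves for the first zero; this one is
    Q(i).\<close>
  define s where "s = \<i> * of_real (sqrt (real 1))"
  interpret trilinear_over_field T 1 s by unfold_locales (simp_all add: s_def)
  let ?K = "quadratic_field s"
  have "gamma_field ?K \<le> gamma_sup"
    unfolding gamma_sup_def using imaginary_quadratic_field by (intro SUP_upper) simp
  then have "gamma_field ?K \<le> enat n" using assms(1) by (rule order_trans)
  then obtain g where g: "gamma_field ?K = enat g" "g \<le> n" by (cases "gamma_field ?K") auto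
  have unit_K: "unit_fun j i \<in> ?K" for j i using zero one by (simp add: unit_fun_def)
  obtain c where c: "\<And>j. c j \<in> ?K" "\<exists>j<n. c j \<noteq> 0"
    "T (lincomb n c unit_fun) (lincomb n c unit_fun) (lincomb n c unit_fun) = 0"
    by (erule zero_on_span[OF complex_subfield_axioms g unit_K])
  have nz: "lincomb n c unit_fun \<noteq> (\<lambda>_. 0)" using c(2) by (auto simp: fun_eq_iff lincomb_unit_fun)
  have zK: "lincomb n c unit_fun i \<in> ?K" for i using c(1) zero by (simp add: lincomb_unit_fun)
  obtain x where x: "\<And>i. x i \<in> \<rat>" "x \<noteq> (\<lambda>_. 0)" "T x x x = 0" "\<And>i. lincomb n c unit_fun i = 0 \<Longrightarrow> x i = 0"
    by (erule rational_zero[OF zK nz c(3)])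
  have "x i = 0" if "i \<ge> n" for i using that by (intro x(4)) (simp add: lincomb_unit_fun)
  then show ?thesis by (rule that[OF x(1-3)])
qed

text \<open>The hyperplane \<open>T x x v = 0\<close> contains \<open>x\<close>; a complement of \<open>x\<close> in it has dimension \<open>n - 2\<close>.\<close>

lemma (in sym_trilinear) hyperplane_basis:
  assumes x: "\<And>i. x i \<in> \<rat>" "x \<noteq> (\<lambda>_. 0)" "\<And>i. i \<ge> n \<Longrightarrow> x i = 0" and m: "m + 2 \<le> n"
  obtains f where "\<And>j i. f j i \<in> \<rat>" "\<And>j i. j < m \<Longrightarrow> i \<ge> n \<Longrightarrow> f j i = 0"
    "\<And>j. j < m \<Longrightarrow> T x x (f j) = 0" "indep_mod m f x"
proof -
  interpret Q: complex_subfield \<rat> by unfold_locales auto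
  have unit_Q: "unit_fun j i \<in> \<rat>" for j i by (simp add: unit_fun_def)
  obtain p where p: "x p \<noteq> 0" using x(2) by auto
  then have "p < n" using x(3) linorder_not_less by blast
  obtain r where r: "r < n" "r \<noteq> p" "\<And>j. j < n \<Longrightarrow> j \<noteq> p \<Longrightarrow> T x x (unit_fun j) \<noteq> 0 \<Longrightarrow> T x x (unit_fun r) \<noteq> 0"
  proof (cases "\<exists>r<n. r \<noteq> p \<and> T x x (unit_fun r) \<noteq> 0")
    case False
    have "(if p = 0 then 1 else 0) < n" "(if p = 0 then 1 else 0) \<noteq> p" using m by auto
    with False that show ?thesis by blast
  qed (use that in blast)
  have "card {..<m} \<le> card ({..<n} - {p, r})"
    using m \<open>p < n\<close> r(1,2) by (simp add: card_Diff_subset)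
  then obtain \<sigma> where \<sigma>: "\<sigma> ` {..<m} \<subseteq> {..<n} - {p, r}" "inj_on \<sigma> {..<m}"
    using card_le_inj[of "{..<m}" "{..<n} - {p, r}"] by auto
  define \<mu> where "\<mu> = (\<lambda>j. T x x (unit_fun (\<sigma> j)) / T x x (unit_fun r))"
  define f where "f = (\<lambda>j. combo 1 (unit_fun (\<sigma> j)) (- \<mu> j) (unit_fun r))"
  have \<sigma>D: "\<sigma> j < n" "\<sigma> j \<noteq> p" "\<sigma> j \<noteq> r" if "j < m" for j using \<sigma>(1) that by auto
  show ?thesis
  proof (rule that[of f])
    show "f j i \<in> \<rat>" for j i
    proof -
      have "\<mu> j \<in> \<rat>" unfolding \<mu>_def
        by (intro Rats_divide T_closed[OF Q.complex_subfield_axioms] x unit_Q)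
      then show ?thesis unfolding f_def combo_def using unit_Q by simp
    qed
    show "f j i = 0" if "j < m" "i \<ge> n" for j i
      using that \<sigma>D[of j] r(1) by (simp add: f_def combo_def unit_fun_def)
    show "T x x (f j) = 0" if "j < m" for j
      using r(3)[of "\<sigma> j"] \<sigma>D[OF that] by (auto simp: f_def lin3 \<mu>_def)
    show "indep_mod m f x"
      unfolding indep_mod_def
    proof (intro allI impI)
      fix c d j assume z: "\<forall>i. lincomb m c f i + d * x i = 0" and j: "j < m"
      \<comment> \<open>Every \<open>f j\<close> vanishes at the coordinate \<open>p\<close>, where
        \<open>x\<close> does not; this forces d = 0.\<close>
      have "lincomb m c f p = 0"
        unfolding lincomb_def using \<sigma>D r(2) by (intro sum.neutral) (auto simp: f_def combo_def unit_fun_def)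
      then have "d = 0" using z[rule_format, of p] p by simp
      moreover have "lincomb m c f (\<sigma> j) = c j"
      proof -
        have "lincomb m c f (\<sigma> j) = (\<Sum>l<m. if l = j then c j else 0)"
          unfolding lincomb_def
        proof (intro sum.cong refl)
          fix l assume "l \<in> {..<m}"
          then have "\<sigma> j = \<sigma> l \<longleftrightarrow> l = j" using \<sigma>(2) j by (auto simp: inj_on_def)
          then show "c l * f l (\<sigma> j) = (if l = j then c j else 0)"
            using \<sigma>D(3)[OF j] by (simp add: f_def combo_def unit_fun_def)
        qed
        then show ?thesis using j by simp
      qed
      ultimately show "c j = 0" using z[rule_format, of "\<sigma> j"] by simp
    qed
  qed
qed

lemma (in sym_trilinear) rational_line_exists:
  assumes "gamma_sup = enat \<gamma>" "n \<ge> 2 * \<gamma> + 3"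
  obtains y w where "\<And>i. y i \<in> \<rat>" "\<And>i. w i \<in> \<rat>" "\<And>i. i \<ge> n \<Longrightarrow> y i = 0 \<and> w i = 0"
    "\<And>a b. a \<in> \<rat> \<Longrightarrow> b \<in> \<rat> \<Longrightarrow> (\<And>i. a * y i + b * w i = 0) \<Longrightarrow> a = 0 \<and> b = 0"
    "\<And>a b. T (combo a y b w) (combo a y b w) (combo a y b w) = 0"
proof -
  interpret Q: complex_subfield \<rat> by unfold_locales auto
  have "\<gamma> \<le> n" "n > 0" using assms(2) by linarith+
  then have n: "enat n \<ge> gamma_sup" "n > 0" by (simp_all only: assms(1) enat_ord_simps)
  obtain x where x: "\<And>i. x i \<in> \<rat>" "x \<noteq> (\<lambda>_. 0)" "T x x x = 0" "\<And>i. i \<ge> n \<Longrightarrow> x i = 0"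
    by (erule rational_zero_exists[OF n])
  define m where "m = 2 * \<gamma> + 1"
  have mn: "m + 2 \<le> n" using assms(2) by (simp add: m_def)
  obtain f where
    f: "\<And>j i. f j i \<in> \<rat>" "\<And>j i. j < m \<Longrightarrow> i \<ge> n \<Longrightarrow> f j i = 0" "\<And>j. j < m \<Longrightarrow> T x x (f j) = 0" "indep_mod m f x"
    by (erule hyperplane_basis[OF x(1,2,4) mn, rotated])
  define V where "V = {v. (\<forall>i. v i \<in> \<rat>) \<and> (\<forall>i\<ge>n. v i = 0) \<and> T x x v = 0}"
  have "\<exists>e. (\<forall>j<m. e j \<in> V) \<and> indep_mod m e x \<and> (\<forall>j<m. \<forall>k<m. j \<noteq> k \<longrightarrow> T x (e j) (e k) = 0)"
  proof (rule orthogonal_basis)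
    show "combo a u b v \<in> V" if "a \<in> \<rat>" "b \<in> \<rat>" "u \<in> V" "v \<in> V" for a b u v
      using that by (simp add: V_def lin3) (simp add: combo_def)
    show "T x u v \<in> \<rat>" if "u \<in> V" "v \<in> V" for u v
      using that x(1) by (intro T_closed[OF Q.complex_subfield_axioms]) (simp_all add: V_def)
    show "f j \<in> V" if "j < m" for j using that f by (simp add: V_def)
  qed (use f in \<open>simp_all add: V_def\<close>)
  then obtain e where e: "\<And>j. j < m \<Longrightarrow> e j \<in> V" "indep_mod m e x"
    "\<And>j k. j < m \<Longrightarrow> k < m \<Longrightarrow> j \<noteq> k \<Longrightarrow> T x (e j) (e k) = 0" by blast
  define a where "a = (\<lambda>j. T x (e j) (e j))"
  \<comment> \<open>\<open>G\<close> excludes 0, so zero diagonal entries are set aside here and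
    readmitted through \<open>insert 0 G\<close>.\<close>
  define A where "A = a ` {..<m} - {0}"
  have "a j \<in> \<rat>" if "j < m" for j
    unfolding a_def using e(1)[OF that] x(1) by (intro T_closed[OF Q.complex_subfield_axioms]) (simp_all add: V_def)
  then have A: "finite A" "A \<subseteq> \<rat> - {0}" by (auto simp: A_def)
  obtain q s G where root: "imaginary_root q s" and AG: "A \<subseteq> G" and G: "G \<subseteq> \<rat> - {0}"
    "\<And>a b. a \<in> G \<Longrightarrow> b \<in> G \<Longrightarrow> a * b \<in> G" "\<And>a. a \<in> G \<Longrightarrow> - a \<in> G"
    "\<And>a b. a \<in> G \<Longrightarrow> b \<in> G \<Longrightarrow> \<exists>x\<in>quadratic_field s. \<exists>y\<in>quadratic_field s. b = x\<^sup>2 - a * y\<^sup>2"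
    by (erule splitting_field_exists[OF A])
  interpret imaginary_root q s by (rule root)
  interpret trilinear_over_field T q s ..
  let ?K = "quadratic_field s"
  interpret splitting_group ?K G
    by unfold_locales (use G in \<open>simp_all add: rep_def\<close>)
  have "a i \<in> insert 0 G" if "i < 2 * \<gamma> + 1" for i using that AG by (auto simp: A_def m_def)
  from totally_isotropic[of \<gamma> a, OF this] obtain W where
    W': "(\<forall>j i. W j i \<in> ?K) \<and> (\<forall>j<\<gamma>. \<forall>j'<\<gamma>. (\<Sum>i<m. a i * W j i * W j' i) = 0) \<and>
      (\<forall>c. (\<forall>i<m. (\<Sum>j<\<gamma>. c j * W j i) = 0) \<longrightarrow> (\<forall>j<\<gamma>. c j = 0))"
    unfolding m_def ..
  then have W: "\<And>j i. W j i \<in> ?K" "\<And>j j'. j < \<gamma> \<Longrightarrow> j' < \<gamma> \<Longrightarrow> (\<Sum>i<m. a i * W j i * W j' i) = 0"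
    "\<And>c. (\<And>i. i < m \<Longrightarrow> (\<Sum>j<\<gamma>. c j * W j i) = 0) \<Longrightarrow> \<forall>j<\<gamma>. c j = 0"
    by simp_all
  define w where "w = (\<lambda>j. lincomb m (W j) e)"
  have eK: "e j i \<in> ?K" if "j < m" for j i using e(1)[OF that] Rats_subset by (simp add: V_def)
  have wK: "w j i \<in> ?K" for j i
    unfolding w_def lincomb_def using W(1) eK by (intro sum mult) auto
  have wB: "T x (w j) (w j') = 0" if "j < \<gamma>" "j' < \<gamma>" for j j'
  proof -
    have "T x (w j) (w j') = (\<Sum>i<m. W j i * (\<Sum>l<m. W j' l * T x (e i) (e l)))"
      by (simp only: w_def T_lincomb2, simp only: T_lincomb3)
    also have "\<dots> = (\<Sum>i<m. a i * W j i * W j' i)"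
    proof (intro sum.cong refl)
      fix i assume "i \<in> {..<m}"
      then have "(\<Sum>l<m. W j' l * T x (e i) (e l)) = (\<Sum>l<m. if l = i then W j' i * a i else 0)"
        using e(3) by (intro sum.cong refl) (auto simp: a_def)
      then show "W j i * (\<Sum>l<m. W j' l * T x (e i) (e l)) = a i * W j i * W j' i"
        using \<open>i \<in> {..<m}\<close> by simp
    qed
    finally show ?thesis using W(2)[OF that] by simp
  qed
  have "gamma_field ?K \<le> enat \<gamma>"
    unfolding assms(1)[symmetric] gamma_sup_def using imaginary_quadratic_field by (intro SUP_upper) simp
  then obtain g where g: "gamma_field ?K = enat g" "g \<le> \<gamma>" by (cases "gamma_field ?K") auto
  obtain c where c: "\<And>j. c j \<in> ?K" "\<exists>j<\<gamma>. c j \<noteq> 0"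
    "T (lincomb \<gamma> c w) (lincomb \<gamma> c w) (lincomb \<gamma> c w) = 0"
    by (erule zero_on_span[OF complex_subfield_axioms g wK])
  define z where "z = lincomb \<gamma> c w"
  have z_e: "z = lincomb m (\<lambda>l. \<Sum>j<\<gamma>. c j * W j l) e" unfolding z_def w_def by (rule lincomb_lincomb)
  have zK: "z i \<in> ?K" for i unfolding z_def lincomb_def using c(1) wK by (intro sum mult)
  have z_zero: "z i = 0" if "i \<ge> n" for i
    unfolding z_e lincomb_def using e(1) that by (intro sum.neutral) (simp add: V_def)
  have Txxz: "T x x z = 0"
    unfolding z_e T_lincomb3 using e(1) by (intro sum.neutral) (simp add: V_def)
  have Txzz: "T x z z = 0"
    unfolding z_def by (simp only: T_lincomb2, simp only: T_lincomb3) (simp add: wB)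
  have indep: "a' = 0 \<and> b = 0" if *: "\<And>i. a' * x i + b * z i = 0" for a' b
  proof -
    have "lincomb m (\<lambda>l. \<Sum>j<\<gamma>. (b * c j) * W j l) e i + a' * x i = 0" for i
      using *[of i] unfolding z_e lincomb_def
      by (simp add: sum_distrib_left sum_distrib_right mult.assoc add.commute)
    \<comment> \<open>Two independence statements in succession: that of the \<open>e l\<close>
      modulo x, then that of the rows of \<open>W\<close>.\<close>
    from indep_modD[OF e(2) this] have "\<forall>j<\<gamma>. b * c j = 0" by (intro W(3)) simp
    then have "b = 0" using c(2) by auto
    then show ?thesis using * x(2) by (auto simp: fun_eq_iff)
  qed
  obtain y v where yv: "\<And>i. y i \<in> \<rat>" "\<And>i. v i \<in> \<rat>"
    "\<And>a b. a \<in> \<rat> \<Longrightarrow> b \<in> \<rat> \<Longrightarrow> (\<And>i. a * y i + b * v i = 0) \<Longrightarrow> a = 0 \<and> b = 0"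
    "\<And>a b. T (combo a y b v) (combo a y b v) (combo a y b v) = 0"
    "\<And>i. x i = 0 \<Longrightarrow> z i = 0 \<Longrightarrow> y i = 0 \<and> v i = 0"
    by (erule rational_line[OF x(1) zK indep x(3) Txxz Txzz c(3)[folded z_def], rotated])
  show ?thesis
    by (rule that[OF yv(1,2) yv(5)[OF x(4) z_zero] yv(3,4)])
qed

theorem theorem1p1:
  fixes n :: nat and C :: "rat mpolynomial"
  assumes "cubic_form n C"
    and "enat n \<ge> 2 * gamma_sup + 3"
  shows "\<exists>x\<in>carrier_vec n. \<exists>y\<in>carrier_vec n.
    (\<forall>a b. a \<cdot>\<^sub>v x + b \<cdot>\<^sub>v y = 0\<^sub>v n \<longrightarrow> a = 0 \<and> b = 0) \<and>
    (\<forall>s t. eval_poly C (s \<cdot>\<^sub>v x + t \<cdot>\<^sub>v y) = 0)"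
proof -
  obtain \<gamma> where \<gamma>: "gamma_sup = enat \<gamma>"
    using assms(2) by (cases gamma_sup) (auto simp: numeral_eq_enat times_enat_simps)
  have "n \<ge> 2 * \<gamma> + 3" using assms(2) unfolding \<gamma> by (simp add: numeral_eq_enat)
  obtain T where "sym_trilinear T" and T: "\<And>x. eval_complex C x = T x x x"
    by (erule cubic_form_trilinear[OF assms(1)])
  then interpret sym_trilinear T by simp
  obtain y w where yw: "\<And>i. y i \<in> \<rat>" "\<And>i. w i \<in> \<rat>" "\<And>i. i \<ge> n \<Longrightarrow> y i = 0 \<and> w i = 0"
    "\<And>a b. a \<in> \<rat> \<Longrightarrow> b \<in> \<rat> \<Longrightarrow> (\<And>i. a * y i + b * w i = 0) \<Longrightarrow> a = 0 \<and> b = 0"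
    "\<And>a b. T (combo a y b w) (combo a y b w) (combo a y b w) = 0"
    by (erule rational_line_exists[OF \<gamma> \<open>n \<ge> 2 * \<gamma> + 3\<close>])
  have "\<forall>i. \<exists>r. y i = of_rat r" "\<forall>i. \<exists>r. w i = of_rat r" using yw(1,2) unfolding Rats_def by blast+
  then obtain y' w' where y': "\<And>i. y i = of_rat (y' i)" and w': "\<And>i. w i = of_rat (w' i)" by metis
  have lin: "a \<cdot>\<^sub>v vec n y' + b \<cdot>\<^sub>v vec n w' = vec n (\<lambda>i. a * y' i + b * w' i)" for a b
    by (intro eq_vecI) auto
  have combo: "combo (of_rat a) y (of_rat b) w = (\<lambda>i. of_rat (a * y' i + b * w' i))" for a b
    by (simp add: combo_def y' w' of_rat_add of_rat_mult)
  show ?thesis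
  proof (intro bexI conjI allI impI)
    fix a b assume "a \<cdot>\<^sub>v vec n y' + b \<cdot>\<^sub>v vec n w' = 0\<^sub>v n"
    then have 0: "vec n (\<lambda>i. a * y' i + b * w' i) = 0\<^sub>v n" by (simp only: lin)
    have "of_rat a * y i + of_rat b * w i = 0" for i
    proof (cases "i < n")
      case True
      have "a * y' i + b * w' i = 0" using arg_cong[OF 0, of "\<lambda>v. v $ i"] True by simp
      then have "of_rat (a * y' i + b * w' i) = (0 :: complex)" by simp
      then show ?thesis by (simp only: y' w' of_rat_add of_rat_mult)
    qed (use yw(3) in simp)
    from yw(4)[OF _ _ this] have "of_rat a = (0 :: complex) \<and> of_rat b = (0 :: complex)" by simp
    then show "a = 0" "b = 0" by simp_all
  next
    fix a b
    have "of_rat (eval_poly C (vec n (\<lambda>i. a * y' i + b * w' i))) = (0 :: complex)"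
      using yw(5)[of "of_rat a" "of_rat b"] unfolding combo
      by (simp only: eval_complex_of_rat[OF assms(1), symmetric] T)
    then show "eval_poly C (a \<cdot>\<^sub>v vec n y' + b \<cdot>\<^sub>v vec n w') = 0" unfolding lin by simp
  qed auto
qed

end
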